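(* Let $M$ be a non-quasianalytic regular weight sequence of moderate growth. Then for every $d\ge 1$ the ring ${}_d\mathcal{E}^{\{M\}}$ has property $(\mathscr{D})$.
   Context: A weight sequence is a sequence $M=(M_k)_{k\ge0}$ of positive reals with $M_k=\mu_1\cdots\mu_k$, $M_0=1$, where $\mu=(\mu_k)$ is positive and increasing with $\mu_0=1$ (equivalently $M$ is log-convex), and $M_k^{1/k}\to\infty$. Set $m_k:=M_k/k!$. $M$ is non-quasianalytic if $\sum_{k\ge1}1/\mu_k<\infty$. $M$ has moderate growth if $\exists C>0\ \forall j,k\in\mathbb{N}: M_{j+k}\le C^{j+k}M_jM_k$; $M$ is derivation closed if $\exists C>0\ \forall k: M_{k+1}\le C^{k+1}M_k$. For a positive sequence $m$ with $m_0=1$ and $m_k^{1/k}\to\infty$ put $h_m(t):=\inf_{k\in\mathbb{N}} m_kt^k$ for $t>0$, $\overline\Gamma_m(t):=\min\{k: h_m(t)=m_kt^k\}$, and (when $m_{k+1}/m_k\to\infty$) $\underline\Gamma_m(t):=\min\{k: m_{k+1}/m_k\ge 1/t\}$. $M$ is regular if $m_k^{1/k}\to\infty$, $M$ is derivation closed, and there is $C\ge1$ with $\overline\Gamma_m(Ct)\le\underline\Gamma_m(t)$ for all $t>0$. For open $U\subseteq\mathbb{R}^d$ and $\sigma>0$, $\mathcal{B}^M_\sigma(U)$ is the set of $f\in C^\infty(U)$ with $\sup_{x\in U,\alpha\in\mathbb{N}^d}|\partial^\alpha f(x)|/(\sigma^{|\alpha|}M_{|\alpha|})<\infty$. $\mathcal{E}^{\{M\}}(U)$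 is the set of $f\in C^\infty(U)$ such that for every relatively compact open $V\subseteq U$ there is $\sigma>0$ with $f|_V\in\mathcal{B}^M_\sigma(V)$. ${}_d\mathcal{E}^{\{M\}}$ denotes the ring of germs at $0\in\mathbb{R}^d$ of complex valued $\mathcal{E}^{\{M\}}$-functions. A subring $\mathcal{S}$ of the ring of germs at $0\in\mathbb{R}^d$ of complex valued $C^\infty$ functions has property $(\mathscr{D})$ if for every (arbitrary complex valued) function germ $f$ at $0\in\mathbb{R}^d$: if there is an integer $j\ge1$ with $f^j,f^{j+1}\in\mathcal{S}$, then $f\in\mathcal{S}$. *)

theory Defs
  imports "HOL-Analysis.Analysis"
begin

definition mu :: "(nat \<Rightarrow> real) \<Rightarrow> nat \<Rightarrow> real" where
  "mu M k = (if k = 0 then 1 else M k / M (k - 1))"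

definition weight_sequence :: "(nat \<Rightarrow> real) \<Rightarrow> bool" where
  "weight_sequence M \<longleftrightarrow>
     (\<exists>\<mu> :: nat \<Rightarrow> real. (\<forall>k. \<mu> k > 0) \<and> mono \<mu> \<and> \<mu> 0 = 1 \<and>
        (\<forall>k. M k = (\<Prod>i\<in>{1..k}. \<mu> i))) \<and>
     filterlim (\<lambda>k. root k (M k)) at_top sequentially"

definition small_m :: "(nat \<Rightarrow> real) \<Rightarrow> nat \<Rightarrow> real" where
  "small_m M k = M k / fact k"

definition non_quasianalytic :: "(nat \<Rightarrow> real) \<Rightarrow> bool" where
  "non_quasianalytic M \<longleftrightarrow> summable (\<lambda>k. 1 / mu M (Suc k))"

definition moderate_growth :: "(nat \<Rightarrow> real) \<Rightarrow> bool" where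
  "moderate_growth M \<longleftrightarrow> (\<exists>C>0. \<forall>j k. M (j + k) \<le> C ^ (j + k) * M j * M k)"

definition derivation_closed :: "(nat \<Rightarrow> real) \<Rightarrow> bool" where
  "derivation_closed M \<longleftrightarrow> (\<exists>C>0. \<forall>k. M (k + 1) \<le> C ^ (k + 1) * M k)"

definition h_fun :: "(nat \<Rightarrow> real) \<Rightarrow> real \<Rightarrow> real" where
  "h_fun m t = (INF k. m k * t ^ k)"

definition Gamma_upper :: "(nat \<Rightarrow> real) \<Rightarrow> real \<Rightarrow> nat" where
  "Gamma_upper m t = (LEAST k. h_fun m t = m k * t ^ k)"

definition Gamma_lower :: "(nat \<Rightarrow> real) \<Rightarrow> real \<Rightarrow> nat" where
  "Gamma_lower m t = (LEAST k. m (Suc k) / m k \<ge> 1 / t)"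

definition regular :: "(nat \<Rightarrow> real) \<Rightarrow> bool" where
  "regular M \<longleftrightarrow>
     filterlim (\<lambda>k. root k (small_m M k)) at_top sequentially \<and>
     derivation_closed M \<and>
     (\<exists>C\<ge>1. \<forall>t>0. Gamma_upper (small_m M) (C * t) \<le> Gamma_lower (small_m M) t)"

text \<open>Iterated partial derivatives: a multi-index alpha with |alpha| = k is encoded
  as a list of k standard basis vectors (the coordinate directions, with multiplicity).\<close>
fun pderivs :: "(real^('n::finite)) list \<Rightarrow> (real^'n \<Rightarrow> complex) \<Rightarrow> real^'n \<Rightarrow> complex"
  where
  "pderivs [] f = f"
| "pderivs (b # bs) f = (\<lambda>x. frechet_derivative (pderivs bs f) (at x) b)"

definition smooth_on :: "(real^'n) set \<Rightarrow> (real^'n \<Rightarrow> complex) \<Rightarrow> bool" where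
  "smooth_on U f \<longleftrightarrow> (\<forall>bs. set bs \<subseteq> Basis \<longrightarrow> pderivs bs f differentiable_on U)"

definition B_M :: "(nat \<Rightarrow> real) \<Rightarrow> real \<Rightarrow> (real^'n) set \<Rightarrow> (real^'n \<Rightarrow> complex) \<Rightarrow> bool" where
  "B_M M \<sigma> U f \<longleftrightarrow> smooth_on U f \<and>
     (\<exists>C. \<forall>x\<in>U. \<forall>bs. set bs \<subseteq> Basis \<longrightarrow>
        norm (pderivs bs f x) / (\<sigma> ^ length bs * M (length bs)) \<le> C)"

definition E_M :: "(nat \<Rightarrow> real) \<Rightarrow> (real^'n) set \<Rightarrow> (real^'n \<Rightarrow> complex) \<Rightarrow> bool" where
  "E_M M U f \<longleftrightarrow> smooth_on U f \<and>
     (\<forall>V. open V \<and> V \<subseteq> U \<and> compact (closure V) \<and> closure V \<subseteq> U \<longrightarrow>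
        (\<exists>\<sigma>>0. B_M M \<sigma> V f))"

text \<open>Germs at 0: a function represents a germ in the ring of E^{M}-germs iff it
  is of class E^{M} on some open neighbourhood of 0 (this depends only on the germ).\<close>
definition germ_E_M :: "(nat \<Rightarrow> real) \<Rightarrow> (real^'n \<Rightarrow> complex) \<Rightarrow> bool" where
  "germ_E_M M f \<longleftrightarrow> (\<exists>U. open U \<and> 0 \<in> U \<and> E_M M U f)"

text \<open>Property (D) for a ring of germs, given by its membership predicate on
  representatives; f ranges over arbitrary complex-valued functions.\<close>
definition property_D :: "((real^'n \<Rightarrow> complex) \<Rightarrow> bool) \<Rightarrow> bool" where
  "property_D S \<longleftrightarrow>
     (\<forall>f :: real^'n \<Rightarrow> complex. \<forall>j::nat. j \<ge> 1 \<and> S (\<lambda>x. f x ^ j) \<and> S (\<lambda>x. f x ^ (j + 1))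
        \<longrightarrow> S f)"

end

(* Write g = f^j and h = f^(j+1).  At a point x with f x \<noteq> 0 let p and q be the Taylor polynomials of g and h
   along a line, of degree below N = j (j+1) (k+1), at a scale at which their coefficients are at most C^N.
   Then q^j - p^(j+1) vanishes to order N, so q/p is an approximate j-th root of p.  With E = z^b, b = j (k+1),
   put F = q cnj(p) / (|p|^2 + |E|^2); it agrees with f to high order at 0, and its dbar-derivative is
   q E cnj(W) / (|p|^2 + |E|^2)^2 with the Wronskian W = p' E - p E'.  On the other hand
   4 |W|^2 / (|p|^2 + |E|^2)^2 is the Laplacian of log (|p|^2 + |E|^2), whose integral over the unit disc is
   bounded independently of p(0).  By Cauchy-Schwarz the k-th Fourier coefficient of F on a circle changes by
   at most C^N between radius 0 and radius 1, which bounds the k-th directional derivative of f at x uniformly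
   in x; moderate growth turns C^N at the chosen scale into C^k M_k.

   It remains to cross the zero set of f.  The Taylor polynomial T of f at x satisfies T^j = g + O(t^n) and
   T^(j+1) = h + O(t^n), also at points where f vanishes, hence T = f + O(t^(n/(j+1))).  These uniform Taylor
   estimates, valid for x in a dense open set, imply smoothness by a converse of Taylor's theorem. *)

theory Submission
  imports Defs "HOL-Complex_Analysis.Complex_Analysis"
begin

section \<open>Approximate roots of polynomials\<close>

text \<open>The obstacle is that \<open>f x\<close> may be nonzero but arbitrarily small. Dividing
  the series of h by that of g yields every derivative of f, but with powers of \<open>f x\<close>
  in the denominator, and such bounds degenerate at the zero set. The zeros of p may lie anywhere in
  the disc, q/p has poles there, and no Cauchy estimate applies. Adding |E|^2 to the denominator
  removes the poles at the price of holomorphy. The order b must do two things: E has to be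
  negligible at the origin, so that the k-th coefficient is untouched, and |E|^(j+1) has to match
  the order N of q^j - p^(j+1), so that |q E| / (|p|^2 + |E|^2) is O(|z|^(k+1)) whatever the size of
  p. The Laplacian integral is read off at its two ends: on the unit circle, where |E| = 1 keeps the
  denominator at least 1, and at the origin, where the boundary term tends to 0 because p(0) is
  nonzero; the rate of this convergence does not enter the result. In the coordinate w = log z the
  function E = exp(b w) has no zeros, so no denominator ever vanishes.\<close>

text \<open>In the coordinate \<open>w = log z\<close> circles become vertical segments, and the radial derivative of a circular mean
  is the mean of \<open>2 dbar \<phi>\<close>, because the angular derivative integrates to zero.\<close>

lemma has_vector_derivative_vertical_mean:
  fixes \<phi> :: "complex \<Rightarrow> complex"
  assumes der: "\<And>w. (\<phi> has_derivative D w) (at w)"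
    and cont1: "continuous_on UNIV (\<lambda>w. D w 1)"
    and conti: "continuous_on UNIV (\<lambda>w. D w \<i>)"
    and per: "\<And>s. \<phi> (Complex s (2 * pi)) = \<phi> (Complex s 0)"
  shows "((\<lambda>s. integral {0..2*pi} (\<lambda>\<theta>. \<phi> (Complex s \<theta>))) has_vector_derivative
      integral {0..2*pi} (\<lambda>\<theta>. D (Complex s \<theta>) 1 + \<i> * D (Complex s \<theta>) \<i>)) (at s)"
proof -
  have ds: "((\<lambda>s. \<phi> (Complex s \<theta>)) has_vector_derivative D (Complex s \<theta>) 1) (at s)" for s \<theta>
  proof -
    have "((\<lambda>s. Complex s \<theta>) has_vector_derivative 1) (at s)"
      unfolding has_vector_derivative_def Complex_eq
      by (auto intro!: derivative_eq_intros simp: scaleR_conv_of_real)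
    hence "((\<lambda>s. Complex s \<theta>) has_derivative (\<lambda>h. h *\<^sub>R 1)) (at s)"
      by (simp add: has_vector_derivative_def)
    from has_derivative_compose[OF this der]
    have "((\<lambda>s. \<phi> (Complex s \<theta>)) has_derivative (\<lambda>h. D (Complex s \<theta>) (h *\<^sub>R 1))) (at s)" .
    moreover have "linear (D w)" for w using der has_derivative_linear by blast
    ultimately show ?thesis
      by (simp add: has_vector_derivative_def linear_cmul[of "D (Complex s \<theta>)"])
  qed
  have dt: "((\<lambda>t. \<phi> (Complex s t)) has_vector_derivative D (Complex s \<theta>) \<i>) (at \<theta>)" for s \<theta>
  proof -
    have "((\<lambda>t. Complex s t) has_vector_derivative \<i>) (at \<theta>)"
      unfolding has_vector_derivative_def Complex_eq
      by (auto intro!: derivative_eq_intros simp: scaleR_conv_of_real)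
    hence "((\<lambda>t. Complex s t) has_derivative (\<lambda>h. h *\<^sub>R \<i>)) (at \<theta>)"
      by (simp add: has_vector_derivative_def)
    from has_derivative_compose[OF this der]
    have "((\<lambda>t. \<phi> (Complex s t)) has_derivative (\<lambda>h. D (Complex s \<theta>) (h *\<^sub>R \<i>))) (at \<theta>)" .
    moreover have "linear (D w)" for w using der has_derivative_linear by blast
    ultimately show ?thesis
      by (simp add: has_vector_derivative_def linear_cmul[of "D (Complex s \<theta>)"])
  qed
  have cC: "continuous_on UNIV (\<lambda>x::real \<times> real. Complex (fst x) (snd x))"
    unfolding Complex_eq by (intro continuous_intros)
  have c1: "continuous_on (UNIV \<times> cbox 0 (2*pi)) (\<lambda>(s, \<theta>). D (Complex s \<theta>) 1)"
    using continuous_on_compose2[OF cont1 cC] by (auto simp: split_beta intro: continuous_on_subset)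
  have cphi: "continuous_on UNIV \<phi>"
    by (meson der differentiableI differentiable_imp_continuous_on differentiable_at_imp_differentiable_on)
  have cS: "continuous_on X (\<lambda>t. Complex s t)" for s X
    unfolding Complex_eq by (intro continuous_intros)
  have c_in: "continuous_on X (\<lambda>t. f (Complex s t))" if "continuous_on UNIV f"
    for s X and f :: "complex \<Rightarrow> complex"
    by (rule continuous_on_compose2[OF that cS]) auto
  have "((\<lambda>s. integral (cbox 0 (2*pi)) (\<lambda>\<theta>. \<phi> (Complex s \<theta>))) has_vector_derivative
      integral (cbox 0 (2*pi)) (\<lambda>\<theta>. D (Complex s \<theta>) 1)) (at s within UNIV)"
    by (rule leibniz_rule_vector_derivative[OF _ _ c1])
      (auto intro!: ds integrable_continuous_interval c_in cphi)
  moreover have "((\<lambda>\<theta>. D (Complex s \<theta>) \<i>) has_integral \<phi> (Complex s (2*pi)) - \<phi> (Complex s 0)) {0..2*pi}"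
    by (rule fundamental_theorem_of_calculus) (auto intro: has_vector_derivative_at_within dt)
  hence 2: "((\<lambda>\<theta>. \<i> * D (Complex s \<theta>) \<i>) has_integral 0) {0..2*pi}"
    using has_integral_mult_right[of "\<lambda>\<theta>. D (Complex s \<theta>) \<i>" 0 "{0..2*pi}" \<i>] per by auto
  hence 3: "integral {0..2*pi} (\<lambda>\<theta>. \<i> * D (Complex s \<theta>) \<i>) = 0"
    by (rule integral_unique)
  have "integral {0..2*pi} (\<lambda>\<theta>. D (Complex s \<theta>) 1 + \<i> * D (Complex s \<theta>) \<i>)
      = integral {0..2*pi} (\<lambda>\<theta>. D (Complex s \<theta>) 1)"
    by (subst integral_add, unfold 3)
       (auto intro!: integrable_continuous_interval c_in cont1 continuous_intros conti)
  ultimately show ?thesis by simp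
qed

text \<open>One computation serves twice. With (U, Z) = (R, 0) it differentiates the mean of the
  approximate root; with (U, Z) = (2 P', 2 E') it differentiates the mean of twice the w-derivative
  of ln A, and the integrand becomes 4 |W|^2 / A^2 for the Wronskian W = P' E - P E'.\<close>

lemma has_vector_derivative_vertical_mean_pair:
  fixes P P' E E' U U' Z Z' :: "complex \<Rightarrow> complex"
  defines "A \<equiv> \<lambda>w. P w * cnj (P w) + E w * cnj (E w)"
  assumes dP: "\<And>w. (P has_field_derivative P' w) (at w)"
    and dE: "\<And>w. (E has_field_derivative E' w) (at w)"
    and dU: "\<And>w. (U has_field_derivative U' w) (at w)"
    and dZ: "\<And>w. (Z has_field_derivative Z' w) (at w)"
    and cP: "continuous_on UNIV P'" and cE: "continuous_on UNIV E'"
    and cU: "continuous_on UNIV U'" and cZ: "continuous_on UNIV Z'"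
    and E0: "\<And>w. E w \<noteq> 0"
    and per: "\<And>f s. f \<in> {P, E, U, Z} \<Longrightarrow> f (Complex s (2*pi)) = f (Complex s 0)"
  shows "((\<lambda>s. integral {0..2*pi} (\<lambda>\<theta>. (\<lambda>w. (U w * cnj (P w) + Z w * cnj (E w)) / A w) (Complex s \<theta>)))
     has_vector_derivative
      integral {0..2*pi} (\<lambda>\<theta>. (\<lambda>w. 2 * (U w * E w - Z w * P w) * cnj (P' w * E w - P w * E' w) / (A w)\<^sup>2)
        (Complex s \<theta>))) (at s)"
proof -
  let ?chi = "\<lambda>w. (U w * cnj (P w) + Z w * cnj (E w)) / A w"
  define dN where "dN w h = U' w * h * cnj (P w) + U w * cnj (P' w * h)
     + (Z' w * h * cnj (E w) + Z w * cnj (E' w * h))" for w h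
  define dA where "dA w h = P' w * h * cnj (P w) + P w * cnj (P' w * h)
     + (E' w * h * cnj (E w) + E w * cnj (E' w * h))" for w h
  define D where "D w h = (dN w h * A w - (U w * cnj (P w) + Z w * cnj (E w)) * dA w h) / (A w)\<^sup>2" for w h
  have Aeq: "A w = of_real ((norm (P w))\<^sup>2 + (norm (E w))\<^sup>2)" for w
    by (simp only: A_def complex_norm_square of_real_add)
  have A0: "A w \<noteq> 0" for w
    unfolding Aeq of_real_eq_0_iff using E0[of w]
    by (metis add_nonneg_eq_0_iff norm_eq_zero power_eq_0_iff zero_le_power2)
  have hP: "(P has_derivative (\<lambda>h. P' w * h)) (at w)" for w
    using dP[of w] by (simp add: has_field_derivative_def)
  have hE: "(E has_derivative (\<lambda>h. E' w * h)) (at w)" for w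
    using dE[of w] by (simp add: has_field_derivative_def)
  have hU: "(U has_derivative (\<lambda>h. U' w * h)) (at w)" for w
    using dU[of w] by (simp add: has_field_derivative_def)
  have hZ: "(Z has_derivative (\<lambda>h. Z' w * h)) (at w)" for w
    using dZ[of w] by (simp add: has_field_derivative_def)
  have hA: "(A has_derivative dA w) (at w)" for w
    unfolding A_def dA_def
    by (rule derivative_eq_intros hP hE bounded_linear.has_derivative[OF bounded_linear_cnj] refl)+
       (auto simp: fun_eq_iff algebra_simps)
  have hN: "((\<lambda>w. U w * cnj (P w) + Z w * cnj (E w)) has_derivative dN w) (at w)" for w
    unfolding dN_def
    by (rule derivative_eq_intros hP hE hU hZ bounded_linear.has_derivative[OF bounded_linear_cnj] refl)+
       (auto simp: fun_eq_iff algebra_simps)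
  have der: "(?chi has_derivative D w) (at w)" for w
    by (rule has_derivative_eq_rhs[OF has_derivative_divide[OF hN hA A0]])
       (auto simp: fun_eq_iff D_def field_simps power2_eq_square A0)
  have c: "continuous_on UNIV P" "continuous_on UNIV E" "continuous_on UNIV U" "continuous_on UNIV Z"
    using dP dE dU dZ by (auto intro!: DERIV_isCont continuous_at_imp_continuous_on)
  have cA: "continuous_on UNIV A" unfolding A_def by (intro continuous_intros c)
  have cD: "continuous_on UNIV (\<lambda>w. D w h)" for h
    unfolding D_def dN_def dA_def by (intro continuous_intros c cP cE cU cZ cA) (auto simp: A0)
  \<comment> \<open>For holomorphic factors the combination \<open>D w 1 + \<i> * D w \<i>\<close>
    vanishes, so only the conjugated factors are differentiated, each with a factor 2. The numerator
    of the quotient rule then factors by a Lagrange identity for the vectors (U, Z) and (P,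
    E).\<close>
  have dbar: "D w 1 + \<i> * D w \<i> = 2 * (U w * E w - Z w * P w) * cnj (P' w * E w - P w
      * E' w) / (A w)\<^sup>2" for w
  proof -
    have "D w 1 + \<i> * D w \<i> = ((dN w 1 + \<i> * dN w \<i>) * A w
        - (U w * cnj (P w) + Z w * cnj (E w)) * (dA w 1 + \<i> * dA w \<i>)) / (A w)\<^sup>2"
      by (simp add: D_def field_simps A0)
    also have "dN w 1 + \<i> * dN w \<i> = 2 * (U w * cnj (P' w) + Z w * cnj (E' w))"
      by (simp add: dN_def algebra_simps)
    also have "dA w 1 + \<i> * dA w \<i> = 2 * (P w * cnj (P' w) + E w * cnj (E' w))"
      by (simp add: dA_def algebra_simps)
    also have "2 * (U w * cnj (P' w) + Z w * cnj (E' w)) * A w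
       - (U w * cnj (P w) + Z w * cnj (E w)) * (2 * (P w * cnj (P' w) + E w * cnj (E' w)))
       = 2 * (U w * E w - Z w * P w) * cnj (P' w * E w - P w * E' w)"
      by (simp add: A_def algebra_simps)
    finally show ?thesis .
  qed
  have "?chi (Complex s (2*pi)) = ?chi (Complex s 0)" for s
    using per[of P s] per[of E s] per[of U s] per[of Z s] by (simp add: A_def)
  from has_vector_derivative_vertical_mean[OF der cD cD this]
  show ?thesis by (simp only: dbar)
qed

section \<open>Polynomials on the unit disc and their Fourier coefficients\<close>

lemma poly_bounded_cball:
  fixes p :: "complex poly"
  obtains K where "K \<ge> 0" "\<And>z. norm z \<le> 1 \<Longrightarrow> norm (poly p z) \<le> K"
proof -
  have "compact (poly p ` cball 0 1)"
    by (intro compact_continuous_image continuous_intros) auto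
  then obtain K where "\<forall>y\<in>poly p ` cball 0 1. norm y \<le> K"
    using compact_imp_bounded bounded_iff by blast
  then have "norm z \<le> 1 \<Longrightarrow> norm (poly p z) \<le> K" for z by auto
  moreover from this[of 0] have "K \<ge> 0" using norm_ge_zero[of "poly p 0"] by (smt (verit) norm_zero)
  ultimately show ?thesis using that by blast
qed

lemma poly_max_modulus_cball:
  fixes p :: "complex poly"
  assumes "\<And>z. norm z = 1 \<Longrightarrow> norm (poly p z) \<le> B" and "norm z \<le> 1"
  shows "norm (poly p z) \<le> B"
  by (rule maximum_modulus_frontier[of "poly p" "cball 0 1"])
     (use assms in \<open>auto intro!: holomorphic_intros continuous_intros\<close>)

text \<open>A Schwarz lemma: dividing by z^n does not change the modulus on the unit circle, and the
  maximum principle applies to the quotient.\<close>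

lemma poly_div_monom_bound:
  fixes p :: "complex poly"
  assumes "\<And>i. i < n \<Longrightarrow> coeff p i = 0"
    and "\<And>z. norm z = 1 \<Longrightarrow> norm (poly p z) \<le> B" and "norm z \<le> 1"
  shows "norm (poly p z) \<le> B * norm z ^ n"
proof -
  have "monom 1 n dvd p" using assms(1) by (simp add: monom_1_dvd_iff')
  then obtain r where r: "p = monom 1 n * r" by (auto simp: dvd_def)
  have "norm (poly r z) \<le> B"
  proof (rule poly_max_modulus_cball)
    fix z :: complex assume "norm z = 1"
    thus "norm (poly r z) \<le> B" using assms(2)[of z] by (simp add: r poly_monom norm_mult norm_power)
  qed fact
  thus ?thesis using mult_left_mono[of "norm (poly r z)" B "norm z ^ n"]
    by (simp add: r poly_monom norm_mult norm_power mult.commute)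
qed

lemma integral_norm_le_const:
  fixes f :: "real \<Rightarrow> complex"
  assumes "continuous_on {0..2*pi} f" "\<And>t. t \<in> {0..2*pi} \<Longrightarrow> norm (f t) \<le> K"
  shows "norm (integral {0..2*pi} f) \<le> 2 * pi * K"
  using integral_norm_bound_integral[of f "{0..2*pi}" "\<lambda>_. K"] assms
  by (simp add: integrable_continuous_interval)

lemma integral_exp_int_period:
  fixes m :: int
  assumes "m \<noteq> 0"
  shows "((\<lambda>t::real. exp (\<i> * of_int m * of_real t)) has_integral 0) {0..2*pi}"
proof -
  have "((\<lambda>t. exp (\<i> * of_int m * of_real t)) has_integral
     exp (\<i> * of_int m * of_real (2*pi)) / (\<i> * of_int m) - exp (\<i> * of_int m * of_real 0) / (\<i>
         * of_int m)) {0..2*pi}"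
  proof (rule fundamental_theorem_of_calculus)
    fix x assume "x \<in> {0..2*pi}"
    have "((\<lambda>z. exp (\<i> * of_int m * z) / (\<i> * of_int m))
        has_field_derivative exp (\<i> * of_int m * of_real x)) (at (of_real x))"
      using assms by (auto intro!: derivative_eq_intros)
    thus "((\<lambda>t. exp (\<i> * of_int m * of_real t) / (\<i> * of_int m)) has_vector_derivative
        exp (\<i> * of_int m * of_real x)) (at x within {0..2*pi})"
      by (rule has_vector_derivative_real_field)
  qed auto
  moreover have "exp (\<i> * of_int m * of_real (2*pi)) = 1"
    by (rule exp_eq_1[THEN iffD2]) (auto intro: exI[of _ m])
  ultimately show ?thesis by simp
qed

text \<open>The weight is the full exp(-k w) and not only its angular part, so the radius exp s
  cancels and the value does not depend on s.\<close>

lemma integral_poly_coeff: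
  fixes T :: "complex poly"
  assumes "degree T \<le> k"
  shows "((\<lambda>t::real. poly T (exp (Complex s t)) * exp (- (of_nat k * Complex s t))) has_integral
     2 * pi * coeff T k) {0..2*pi}"
proof -
  have 1: "((\<lambda>t::real. coeff T i * exp (Complex s t) ^ i * exp (- (of_nat k * Complex s t))) has_integral
     (if i = k then 2 * pi * coeff T k else 0)) {0..2*pi}" for i
  proof -
    have eq: "exp (Complex s t) ^ i * exp (- (of_nat k * Complex s t))
       = exp ((of_nat i - of_nat k) * of_real s) * exp (\<i> * of_int (int i - int k) * of_real t)" for t
      unfolding exp_of_nat_mult[symmetric] exp_add[symmetric] Complex_eq by (simp add: algebra_simps)
    show ?thesis
    proof (cases "i = k")
      case True
      have "((\<lambda>t::real. coeff T k) has_integral (2*pi - 0) *\<^sub>R coeff T k) {0..2*pi}"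
        using has_integral_const_real[of "coeff T k" 0 "2*pi"] by simp
      then show ?thesis using True eq by (simp add: mult.assoc scaleR_conv_of_real)
    next
      case False
      from has_integral_mult_right[OF integral_exp_int_period[of "int i - int k"], of "coeff T i
          * exp ((of_nat i - of_nat k) * of_real s)"]
      show ?thesis using False by (simp add: mult.assoc eq)
    qed
  qed
  have "((\<lambda>t::real. \<Sum>i\<le>k. coeff T i * exp (Complex s t) ^ i * exp (- (of_nat k * Complex s t))) has_integral
     (\<Sum>i\<le>k. if i = k then 2 * pi * coeff T k else 0)) {0..2*pi}"
    by (intro has_integral_sum 1) auto
  moreover have "poly T z = (\<Sum>i\<le>k. coeff T i * z ^ i)" for z
    unfolding poly_altdef using assms by (intro sum.mono_neutral_left) (auto simp: coeff_eq_0)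
  ultimately show ?thesis by (simp add: sum_distrib_right)
qed

section \<open>The coefficient bound for an approximate root\<close>

text \<open>Used with x = |p|, y = |q|, z = |E| and w = |z|^(k+1). With a = sqrt A both x and z are
  at most a, so y^j is at most 2 D a^(j+1), and (y z / A)^j is at most 2 D (z/a)^(j-1) z. All
  dependence on x disappears, which is why small values of p do no harm.\<close>

lemma two_term_quotient_bound:
  fixes x y z A :: real
  assumes nn: "x \<ge> 0" "y \<ge> 0" "z > 0" and A: "A = x\<^sup>2 + z\<^sup>2" and j: "j \<ge> 1" and D: "D \<ge> 1"
    and y: "y ^ j \<le> x ^ Suc j + D * z ^ Suc j" and w: "w \<ge> 0" "z = w ^ j"
  shows "y * z / A \<le> 2 * D * w"
proof -
  define a where "a = sqrt A"
  have Apos: "A > 0" using nn A by (auto intro: add_nonneg_pos)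
  have a: "a > 0" "a\<^sup>2 = A" using Apos by (auto simp: a_def)
  have xa: "x \<le> a" "z \<le> a" unfolding a_def A by (auto intro!: real_le_rsqrt)
  have "y ^ j \<le> a ^ Suc j + D * a ^ Suc j"
    using y xa nn D power_mono[OF xa(1) nn(1), of "Suc j"] mult_left_mono[OF power_mono[OF xa(2), of
        "Suc j"], of D] by linarith
  also have "\<dots> = (1 + D) * a ^ Suc j" by (simp only: algebra_simps)
  also have "\<dots> \<le> (2 * D) * a ^ Suc j"
    using D a by (intro mult_right_mono) auto
  finally have "y ^ j \<le> (2 * D) * a ^ Suc j" .
  hence "(y * z / A) ^ j \<le> (2 * D) * a ^ Suc j * z ^ j / A ^ j"
    using nn Apos by (simp add: power_divide power_mult_distrib divide_right_mono mult_right_mono)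
  also have "\<dots> = (2 * D) * (z / a) ^ (j - 1) * z"
    using a j by (cases j) (auto simp: field_simps power_divide power2_eq_square a(2)[symmetric]
        power_mult_distrib)
  also have "\<dots> \<le> (2 * D) * 1 * z"
    using D nn a xa by (intro mult_right_mono mult_left_mono power_le_one) auto
  also have "\<dots> \<le> (2 * D) ^ j * w ^ j"
    using D w nn power_increasing[of 1 j "2 * D"] j by (intro mult_mono) auto
  finally have "(y * z / A) ^ j \<le> (2 * D * w) ^ j" by (simp add: power_mult_distrib)
  thus ?thesis
    using j D w by (subst (asm) power_mono_iff) (auto intro!: divide_nonneg_pos simp: nn Apos less_imp_le)
qed

text \<open>Separates the Laplacian density |W|^2 / |A|^2 from a term controlled by
  \<open>two_term_quotient_bound\<close>. Since the splitting is pointwise, the two parts can be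
  integrated independently.\<close>

lemma norm_amgm_quotient:
  fixes R E W A :: complex
  assumes "A \<noteq> 0"
  shows "norm (2 * (R * E) * cnj W / A\<^sup>2) \<le> (norm W / norm A)\<^sup>2 + (norm R * norm E / norm A)\<^sup>2"
proof -
  have "norm (2 * (R * E) * cnj W / A\<^sup>2) = 2 * (norm W / norm A) * (norm R * norm E / norm A)"
    by (simp add: norm_mult norm_divide norm_power power2_eq_square field_simps)
  also have "\<dots> \<le> (norm W / norm A)\<^sup>2 + (norm R * norm E / norm A)\<^sup>2"
    by (rule sum_squares_bound)
  finally show ?thesis .
qed

text \<open>B comes from the Fourier coefficient on the unit circle, B^2 + b from the Laplacian
  integral, and 2 D^2 from the tail of the remaining term. The size of p(0) affects only how fast
  the means converge at radius 0, hence an error term that is removed by a limit.\<close>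

proposition approximate_root_coeff_bound:
  fixes p q T :: "complex poly"
  assumes j: "j \<ge> 1" and b: "b = j * Suc k" and D: "D \<ge> 1" and B: "B \<ge> 0"
    and degT: "degree T \<le> k" and dvd: "monom 1 (Suc k) dvd q - p * T" and p0: "poly p 0 \<noteq> 0"
    and pq: "\<And>z. norm z \<le> 1 \<Longrightarrow> norm (poly q z) ^ j \<le> norm (poly p z) ^ Suc j + D * norm z ^ (b * Suc j)"
    and Bp: "\<And>z. norm z = 1 \<Longrightarrow> norm (poly p z) \<le> B"
    and Bq: "\<And>z. norm z = 1 \<Longrightarrow> norm (poly q z) \<le> B"
    and Bp': "\<And>z. norm z = 1 \<Longrightarrow> norm (poly (pderiv p) z) \<le> B"
  shows "norm (coeff T k) \<le> B + B\<^sup>2 + b + 2 * D\<^sup>2"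
proof -
  define P where "P w = poly p (exp w)" for w
  define P' where "P' w = poly (pderiv p) (exp w) * exp w" for w
  define P'' where "P'' w = (poly (pderiv (pderiv p)) (exp w) * exp w) * exp w + poly (pderiv p) (exp w)
      * exp w" for w
  define E :: "complex \<Rightarrow> complex" where "E w = exp (of_nat b * w)" for w
  define R where "R w = poly q (exp w) * exp (- (of_nat k * w))" for w
  define R' where "R' w = poly (pderiv q) (exp w) * exp w * exp (- (of_nat k * w)) - of_nat k * R w" for w
  define A where "A w = P w * cnj (P w) + E w * cnj (E w)" for w
  define W where "W w = P' w * E w - P w * (of_nat b * E w)" for w
  \<comment> \<open>\<open>\<phi>\<close> is \<open>F z^(-k)\<close>; \<open>\<psi>\<close> is twice the \<open>w\<close>-derivative of \<open>ln A\<close>, so \<open>n\<close> is increasing.\<close>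
  define \<phi> where "\<phi> w = (R w * cnj (P w) + 0 * cnj (E w)) / A w" for w
  define \<psi> where "\<psi> w = (2 * P' w * cnj (P w) + 2 * (of_nat b * E w) * cnj (E w)) / A w" for w
  define c where "c s = integral {0..2*pi} (\<lambda>\<theta>. \<phi> (Complex s \<theta>))" for s
  define n where "n s = integral {0..2*pi} (\<lambda>\<theta>. \<psi> (Complex s \<theta>))" for s
  define c' where "c' s = integral {0..2*pi} (\<lambda>\<theta>. (\<lambda>w. 2 * (R w * E w)
      * cnj (W w) / (A w)\<^sup>2) (Complex s \<theta>))" for s
  define n' where "n' s = integral {0..2*pi} (\<lambda>\<theta>. (\<lambda>w. 4 * (W w
      * cnj (W w)) / (A w)\<^sup>2) (Complex s \<theta>))" for s

  have E0: "E w \<noteq> 0" for w by (simp add: E_def)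
  have Aeq: "A w = of_real ((norm (P w))\<^sup>2 + (norm (E w))\<^sup>2)" for w
    by (simp only: A_def complex_norm_square of_real_add)
  have nA: "norm (A w) = (norm (P w))\<^sup>2 + (norm (E w))\<^sup>2" for w
    unfolding Aeq norm_of_real by (rule abs_of_nonneg) auto
  have A0: "A w \<noteq> 0" for w
    unfolding Aeq of_real_eq_0_iff using E0[of w]
    by (metis add_nonneg_eq_0_iff norm_eq_zero power_eq_0_iff zero_le_power2)
  have dP: "(P has_field_derivative P' w) (at w)" for w
    unfolding P_def P'_def by (auto intro!: derivative_eq_intros)
  have dP': "(P' has_field_derivative P'' w) (at w)" for w
    unfolding P''_def P'_def by (auto intro!: derivative_eq_intros)
  have dE: "(E has_field_derivative of_nat b * E w) (at w)" for w
    unfolding E_def by (auto intro!: derivative_eq_intros)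
  have dR: "(R has_field_derivative R' w) (at w)" for w
    unfolding R_def R'_def by (auto intro!: derivative_eq_intros simp: algebra_simps)
  have cP: "continuous_on UNIV P" "continuous_on UNIV P'" "continuous_on UNIV P''"
    unfolding P_def P'_def P''_def by (intro continuous_intros)+
  have cE: "continuous_on UNIV E" unfolding E_def by (intro continuous_intros)
  have cR: "continuous_on UNIV R" unfolding R_def by (intro continuous_intros)
  have cR': "continuous_on UNIV R'" unfolding R'_def by (intro continuous_intros cR)
  have cA: "continuous_on UNIV A" unfolding A_def by (intro continuous_intros cP cE)
  have cW: "continuous_on UNIV W" unfolding W_def by (intro continuous_intros cP cE)
  have per_exp: "exp (of_nat m * Complex s (2*pi)) = exp (of_nat m * Complex s 0)"
     "exp (- (of_nat m * Complex s (2*pi))) = exp (- (of_nat m * Complex s 0))" for m s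
  proof -
    have "exp (of_nat m * Complex s (2*pi)) = exp (of_nat m * Complex s 0 + 2 * of_int (int m) * pi * \<i>)"
      by (simp add: Complex_eq algebra_simps)
    also have "\<dots> = exp (of_nat m * Complex s 0)"
      unfolding exp_add using exp_eq_1[of "2 * of_int (int m) * pi * \<i>"]
      by (simp, metis of_int_of_nat_eq)
    finally show "exp (of_nat m * Complex s (2*pi)) = exp (of_nat m * Complex s 0)" .
    thus "exp (- (of_nat m * Complex s (2*pi))) = exp (- (of_nat m * Complex s 0))"
      by (simp add: exp_minus)
  qed
  have per1: "exp (Complex s (2*pi)) = exp (Complex s 0)" for s
    using per_exp(1)[of 1 s] by simp
  have per: "P (Complex s (2*pi)) = P (Complex s 0)" "P' (Complex s (2*pi)) = P' (Complex s 0)"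
     "E (Complex s (2*pi)) = E (Complex s 0)" "R (Complex s (2*pi)) = R (Complex s 0)" for s
    by (simp_all add: P_def P'_def E_def R_def per1 per_exp)
  \<comment> \<open>The vanishing summand \<open>0 * cnj (E w)\<close> in \<open>\<phi>\<close> puts
    it in the form of \<open>has_vector_derivative_vertical_mean_pair\<close>.\<close>
  have dc: "(c has_vector_derivative c' s) (at s)" for s
  proof -
    have "(c has_vector_derivative integral {0..2*pi}
         (\<lambda>\<theta>. (\<lambda>w. 2 * (R w * E w - 0 * P w) * cnj (P' w * E w - P w * (of_nat b * E w)) / (A w)\<^sup>2)
           (Complex s \<theta>))) (at s)"
      unfolding c_def[abs_def] \<phi>_def A_def
      by (rule has_vector_derivative_vertical_mean_pair[where U' = R' and Z' = "\<lambda>w. 0"])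
        (auto intro!: dP dE dR continuous_intros cP cE cR' simp: E0 per)
    thus ?thesis by (simp add: c'_def W_def)
  qed
  have dn: "(n has_vector_derivative n' s) (at s)" for s
  proof -
    have "(n has_vector_derivative integral {0..2*pi}
         (\<lambda>\<theta>. (\<lambda>w. 2 * (2 * P' w * E w - 2 * (of_nat b * E w) * P w) * cnj (P' w * E w - P w * (of_nat b
             * E w)) / (A w)\<^sup>2)
           (Complex s \<theta>))) (at s)"
      unfolding n_def[abs_def] \<psi>_def A_def
      by (rule has_vector_derivative_vertical_mean_pair[where U' = "\<lambda>w. 2 * P'' w"
          and Z' = "\<lambda>w. 2 * (of_nat b * (of_nat b * E w))"])
        (auto intro!: derivative_eq_intros dP dE dP' continuous_intros cP cE simp: E0 per)
    thus ?thesis by (simp add: n'_def W_def algebra_simps)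
  qed
  have cS: "continuous_on X (\<lambda>t. Complex s t)" for s X
    unfolding Complex_eq by (intro continuous_intros)
  have c_in: "continuous_on X (\<lambda>t. f (Complex s t))" if "continuous_on UNIV f"
    for s X and f :: "complex \<Rightarrow> complex"
    by (rule continuous_on_compose2[OF that cS]) auto
  have c\<phi>: "continuous_on UNIV \<phi>" unfolding \<phi>_def by (intro continuous_intros cR cP cE cA) (auto simp: A0)
  have c\<psi>: "continuous_on UNIV \<psi>" unfolding \<psi>_def by (intro continuous_intros cR cP cE cA) (auto simp: A0)
  have nz: "norm (exp (Complex s t)) = exp s" for s t by (simp add: norm_exp_eq_Re)
  have nE: "norm (E (Complex s t)) = exp s ^ b" for s t
    by (simp add: E_def exp_of_nat_mult norm_power nz)

  \<comment> \<open>A quarter of \<open>n'\<close> is the integral of |W|^2 / |A|^2; the other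
    summand is 2 pi times the square of 2 D exp s.\<close>
  have bnd: "norm (c' s) \<le> Re (n' s) / 4 + 8 * pi * D\<^sup>2 * exp (2 * s)" if "s \<le> 0" for s
  proof -
    let ?g = "\<lambda>\<theta>. Re (4 * (W (Complex s \<theta>) * cnj (W (Complex s \<theta>))) / (A (Complex s \<theta>))\<^sup>2) / 4 + 4 * D\<^sup>2
        * exp (2 * s)"
    let ?f = "\<lambda>w. 2 * (R w * E w) * cnj (W w) / (A w)\<^sup>2"
    let ?h = "\<lambda>w. 4 * (W w * cnj (W w)) / (A w)\<^sup>2"
    have ch: "continuous_on UNIV ?h" by (intro continuous_intros cW cA) (auto simp: A0)
    have cf: "continuous_on UNIV ?f" by (intro continuous_intros cW cA cR cE) (auto simp: A0)
    have ih: "(\<lambda>\<theta>. ?h (Complex s \<theta>)) integrable_on {0..2*pi}"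
      using c_in[OF ch] by (rule integrable_continuous_interval)
    have le: "norm (?f (Complex s \<theta>)) \<le> ?g \<theta>" for \<theta>
    proof -
      let ?w = "Complex s \<theta>"
      let ?z = "exp ?w"
      have "norm ?z \<le> 1" using that nz by simp
      from pq[OF this] have "norm (poly q ?z) ^ j \<le> norm (P ?w) ^ Suc j + D * (exp s ^ b) ^ Suc j"
        by (simp add: P_def nz power_mult[symmetric] power_add[symmetric])
      \<comment> \<open>This is where b = j (k+1) is used. The resulting exponent k+1 exceeds k by
        one, so after multiplication by exp(-k s) a factor exp s is left, whose square is integrable
        towards s = -infinity.\<close>
      moreover have wb: "exp s ^ b = (exp s ^ Suc k) ^ j"
        by (simp only: b mult.commute[of j] power_mult)
      ultimately have "norm (poly q ?z) * exp s ^ b / norm (A ?w) \<le> 2 * D * exp s ^ Suc k"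
        by (intro two_term_quotient_bound[OF norm_ge_zero norm_ge_zero _ _ j D _ _ wb])
          (simp_all add: nA nE)
      hence "exp (- (real k * s)) * (norm (poly q ?z) * exp s ^ b / norm (A ?w))
          \<le> exp (- (real k * s)) * (2 * D * exp s ^ Suc k)"
        by (rule mult_left_mono) auto
      also have "exp (- (real k * s)) * (2 * D * exp s ^ Suc k) = 2 * D * exp s"
        by (simp add: exp_minus exp_of_nat_mult)
      also have "exp (- (real k * s)) * (norm (poly q ?z) * exp s ^ b / norm (A ?w))
          = norm (R ?w) * norm (E ?w) / norm (A ?w)"
        by (simp add: R_def norm_mult nE norm_exp_eq_Re)
      finally have "(norm (R ?w) * norm (E ?w) / norm (A ?w))\<^sup>2 \<le> (2 * D * exp s)\<^sup>2"
        by (rule power_mono) auto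
      also have "(2 * D * exp s)\<^sup>2 = 4 * D\<^sup>2 * exp (2 * s)"
        by (simp add: power_mult_distrib exp_double)
      finally have Y: "(norm (R ?w) * norm (E ?w) / norm (A ?w))\<^sup>2 \<le> 4 * D\<^sup>2 * exp (2 * s)" .
      have "?h ?w = of_real (4 * (norm (W ?w) / norm (A ?w))\<^sup>2)"
      proof -
        have "A ?w = of_real (norm (A ?w))" unfolding nA by (rule Aeq)
        thus ?thesis by (simp add: complex_norm_square[symmetric] power_divide)
      qed
      hence "Re (?h ?w) / 4 = (norm (W ?w) / norm (A ?w))\<^sup>2" by simp
      with norm_amgm_quotient[OF A0, of "R ?w" "E ?w" "W ?w" ?w] Y show ?thesis by linarith
    qed
    have ig: "(?g has_integral Re (n' s) / 4 + 2 * pi * (4 * D\<^sup>2 * exp (2 * s))) {0..2*pi}"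
    proof (intro has_integral_add has_integral_divide)
      show "((\<lambda>\<theta>. Re (?h (Complex s \<theta>))) has_integral Re (n' s)) {0..2*pi}"
        unfolding n'_def by (rule has_integral_Re) (rule integrable_integral[OF ih])
      show "((\<lambda>x. 4 * D\<^sup>2 * exp (2 * s)) has_integral 2 * pi * (4 * D\<^sup>2 * exp (2 * s))) {0..2 * pi}"
        using has_integral_const_real[of "4 * D\<^sup>2 * exp (2 * s)" 0 "2*pi"] by simp
    qed
    have "norm (c' s) \<le> integral {0..2*pi} ?g"
      unfolding c'_def
      by (rule integral_norm_bound_integral) (use le c_in[OF cf] ig in \<open>auto intro:
          integrable_continuous_interval\<close>)
    also have "\<dots> = Re (n' s) / 4 + 2 * pi * (4 * D\<^sup>2 * exp (2 * s))" using ig by (rule integral_unique)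
    finally show ?thesis by simp
  qed

  \<comment> \<open>The bound on \<open>c'\<close> has the explicit antiderivative n/4 + 4 pi D^2
    exp(2 s), so the mean value inequality replaces any double integral.\<close>
  have diff: "norm (c 0 - c s) \<le> Re (n 0) / 4 - Re (n s) / 4 + 4 * pi * D\<^sup>2" if "s < 0" for s
  proof -
    have "norm (c 0 - c s) \<le> (Re (n 0) / 4 + 4 * pi * D\<^sup>2 * exp (2 * 0)) - (Re (n s) / 4 + 4 * pi * D\<^sup>2
        * exp (2 * s))"
    proof (rule differentiable_bound_general[OF that])
      have 2: "((\<lambda>s. Re (n s) / 4 + 4 * pi * D\<^sup>2 * exp (2 * s))
          has_vector_derivative Re (n' x) / 4 + 8 * pi * D\<^sup>2 * exp (2 * x)) (at x)" for x
      proof -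
        have "((\<lambda>s. Re (n s)) has_vector_derivative Re (n' x)) (at x)"
          using bounded_linear.has_vector_derivative[OF bounded_linear_Re dn] .
        hence "((\<lambda>s. Re (n s)) has_real_derivative Re (n' x)) (at x)"
          by (simp add: has_real_derivative_iff_has_vector_derivative)
        moreover have "((\<lambda>s. f s / 4 + 4 * pi * D\<^sup>2 * exp (2 * s))
            has_real_derivative d / 4 + 8 * pi * D\<^sup>2 * exp (2 * x)) (at x)"
          if "(f has_real_derivative d) (at x)" for f d
          using that by (auto intro!: derivative_eq_intros)
        ultimately have "((\<lambda>s. Re (n s) / 4 + 4 * pi * D\<^sup>2 * exp (2 * s))
            has_real_derivative Re (n' x) / 4 + 8 * pi * D\<^sup>2 * exp (2 * x)) (at x)"
          by blast
        thus ?thesis by (simp add: has_real_derivative_iff_has_vector_derivative)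
      qed
      show "continuous_on {s..0} (\<lambda>s. Re (n s) / 4 + 4 * pi * D\<^sup>2 * exp (2 * s))"
        using 2 by (meson continuous_at_imp_continuous_on has_vector_derivative_continuous)
      show "continuous_on {s..0} c"
        using dc by (meson continuous_at_imp_continuous_on has_vector_derivative_continuous)
      show "((\<lambda>s. Re (n s) / 4 + 4 * pi * D\<^sup>2 * exp (2 * s))
          has_vector_derivative Re (n' x) / 4 + 8 * pi * D\<^sup>2 * exp (2 * x)) (at x)" for x
        by (rule 2)
      show "(c has_vector_derivative c' x) (at x)" for x by (rule dc)
      show "norm (c' x) \<le> Re (n' x) / 4 + 8 * pi * D\<^sup>2 * exp (2 * x)" if "x < 0" for x
        using bnd that by simp
    qed
    moreover have "4 * pi * D\<^sup>2 * exp (2 * s) \<ge> 0" by simp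
    ultimately show ?thesis unfolding mult_zero_right exp_zero mult_1_right by linarith
  qed

  \<comment> \<open>On the unit circle |E| = 1 bounds A from below, so both boundary terms are
    estimated without a lower bound for p.\<close>
  have unit: "norm (P w) \<le> B" "norm (R w) \<le> B" "norm (P' w) \<le> B" "norm (E w) = 1" "norm (A w) \<ge> 1"
    if "w = Complex 0 t" for w t
  proof -
    have z: "norm (exp w) = 1" using nz[of 0 t] that by simp
    show "norm (P w) \<le> B" "norm (P' w) \<le> B" using Bp[OF z] Bp'[OF z] z
        by (auto simp: P_def P'_def norm_mult)
    have x1: "norm (exp (- (of_nat k * w))) = 1" using that by (simp add: norm_exp_eq_Re)
    show "norm (R w) \<le> B" using Bq[OF z] by (simp only: R_def norm_mult x1 mult_1_right)
    show 1: "norm (E w) = 1" using nE[of 0 t] that by simp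
    show "norm (A w) \<ge> 1" unfolding nA 1 by simp
  qed
  have c0: "norm (c 0) \<le> 2 * pi * B"
    unfolding c_def
  proof (rule integral_norm_le_const[OF c_in[OF c\<phi>]])
    fix t
    let ?w = "Complex 0 t"
    note u = unit[OF refl, of t]
    have "norm (P ?w) \<le> norm (A ?w)"
      unfolding nA u(4) using sum_squares_bound[of "norm (P ?w)" 1] by (smt (verit) norm_ge_zero one_power2)
    hence "norm (P ?w) / norm (A ?w) \<le> 1" using u(5) by (simp add: divide_le_eq)
    hence "norm (R ?w) * (norm (P ?w) / norm (A ?w)) \<le> B * 1"
      using u B by (intro mult_mono) auto
    thus "norm (\<phi> ?w) \<le> B" by (simp add: \<phi>_def norm_mult norm_divide)
  qed
  have n0: "norm (n 0) \<le> 2 * pi * (2 * (B\<^sup>2 + b))"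
    unfolding n_def
  proof (rule integral_norm_le_const[OF c_in[OF c\<psi>]])
    fix t
    let ?w = "Complex 0 t"
    note u = unit[OF refl, of t]
    have "norm (2 * P' ?w * cnj (P ?w) + 2 * (of_nat b * E ?w) * cnj (E ?w))
        \<le> 2 * (norm (P' ?w) * norm (P ?w)) + 2 * b"
      by (rule order_trans[OF norm_triangle_ineq]) (simp add: norm_mult u)
    also have "norm (P' ?w) * norm (P ?w) \<le> B * B" using u B by (intro mult_mono) auto
    finally have N: "norm (2 * P' ?w * cnj (P ?w) + 2 * (of_nat b * E ?w) * cnj (E ?w)) \<le> 2 * (B\<^sup>2 + b)"
      by (simp add: power2_eq_square)
    have "norm (\<psi> ?w) \<le> (2 * (B\<^sup>2 + b)) / 1"
      unfolding \<psi>_def norm_divide using N u(5) by (intro frac_le) auto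
    thus "norm (\<psi> ?w) \<le> 2 * (B\<^sup>2 + b)" by simp
  qed

  \<comment> \<open>Behaviour at the origin. K and s0 depend on p(0), but K occurs only with the
    factor exp s, which tends to 0.\<close>
  have "\<exists>K s0. \<forall>s\<le>s0. norm (c s - 2 * pi * coeff T k) \<le> 2 * pi * (K * exp s) \<and> norm (n s)
      \<le> 2 * pi * (K * exp s)"
  proof -
    obtain r where r: "q - p * T = monom 1 (Suc k) * r" using dvd by (auto simp: dvd_def)
    obtain Kp where Kp: "Kp \<ge> 0" "\<And>z. norm z \<le> 1 \<Longrightarrow> norm (poly p z) \<le> Kp" using poly_bounded_cball by blast
    obtain Kd where Kd: "Kd \<ge> 0" "\<And>z. norm z \<le> 1
        \<Longrightarrow> norm (poly (pderiv p) z) \<le> Kd" using poly_bounded_cball by blast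
    obtain Kr where Kr: "Kr \<ge> 0" "\<And>z. norm z \<le> 1 \<Longrightarrow> norm (poly r z) \<le> Kr" using poly_bounded_cball by blast
    obtain KT where KT: "KT \<ge> 0" "\<And>z. norm z \<le> 1 \<Longrightarrow> norm (poly T z) \<le> KT" using poly_bounded_cball by blast
    \<comment> \<open>By continuity |p| is at least a near the origin, hence A is at least a^2
      there.\<close>
    define a where "a = norm (poly p 0) / 2"
    have a: "a > 0" using p0 by (simp add: a_def)
    have "isCont (poly p) 0" by simp
    then obtain \<delta> where \<delta>: "\<delta> > 0" "\<And>z. norm z < \<delta> \<Longrightarrow> norm (poly p z - poly p 0) < a"
      unfolding continuous_at_eps_delta using a by (auto simp: dist_norm)
    define s0 where "s0 = min 0 (ln (\<delta> / 2))"
    define K where "K = (Kp * Kr + KT + 2 * (Kd * Kp) + 2 * b) / a\<^sup>2"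
    have small: "exp s < \<delta>" "exp s \<le> 1" if "s \<le> s0" for s
    proof -
      have "exp s \<le> \<delta> / 2" using that \<delta>(1) by (simp add: s0_def ln_ge_iff)
      thus "exp s < \<delta>" using \<delta>(1) by simp
      show "exp s \<le> 1" using that by (simp add: s0_def)
    qed
    have Alow: "norm (A (Complex s t)) \<ge> a\<^sup>2" if "s \<le> s0" for s t
    proof -
      have "norm (poly p (exp (Complex s t)) - poly p 0) < a" using \<delta>(2) nz small[OF that] by simp
      moreover have "norm (poly p 0) = 2 * a" by (simp add: a_def)
      ultimately have "norm (P (Complex s t)) \<ge> a"
        unfolding P_def using norm_triangle_ineq2[of "poly p 0" "poly p (exp (Complex s t))"]
        by (simp add: norm_minus_commute)
      hence "(norm (P (Complex s t)))\<^sup>2 \<ge> a\<^sup>2" using a by (intro power_mono) auto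
      thus ?thesis by (simp add: nA add_increasing2)
    qed
    have kb: "Suc k \<le> 2 * b" "1 \<le> b" unfolding b using j by (cases j; simp)+
    have 1: "norm (\<phi> (Complex s t) - poly T (exp (Complex s t)) * exp (- (of_nat k * Complex s t)))
        \<le> K * exp s"
      if s: "s \<le> s0" for s t
    proof -
      let ?w = "Complex s t" let ?z = "exp ?w" let ?x = "exp (- (of_nat k * ?w))"
      have zz: "norm ?z \<le> 1" using nz small[OF s] by simp
      have q: "poly q ?z = poly p ?z * poly T ?z + ?z ^ Suc k * poly r ?z"
        using r by (metis (no_types, lifting) add.commute diff_eq_eq poly_add poly_monom poly_mult mult_1)
      \<comment> \<open>Insert q = p T + z^(k+1) r: the terms |P|^2 T cancel. Both remaining terms
        have order at least k+1 in z, the second because 2 b is at least k+1, so one factor exp s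
        survives the multiplication by z^(-k).\<close>
      have "\<phi> ?w - poly T ?z * ?x = (cnj (P ?w) * (?z ^ Suc k * poly r ?z) - E ?w * cnj (E ?w)
          * poly T ?z) * ?x / A ?w"
        using A0[of ?w] by (simp add: \<phi>_def R_def q field_simps A_def P_def)
      hence "norm (\<phi> ?w - poly T ?z * ?x)
         \<le> (norm (P ?w) * (exp s ^ Suc k * norm (poly r ?z)) + exp s ^ (2 * b) * norm (poly T ?z))
             * norm ?x / norm (A ?w)"
        by (auto simp: norm_mult norm_divide nz norm_power nE power_even_eq power2_eq_square
            intro!: divide_right_mono mult_right_mono order_trans[OF norm_triangle_ineq4])
      also have "\<dots> \<le> (Kp * (exp s ^ Suc k * Kr) + exp s ^ Suc k * KT) * norm ?x / a\<^sup>2"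
        using Kp Kr KT zz a Alow[OF s] small[OF s] kb
        by (intro frac_le mult_right_mono add_mono mult_mono power_decreasing) (auto simp: P_def)
      also have "norm ?x = exp (- (real k * s))" by (simp add: norm_exp_eq_Re)
      also have "(Kp * (exp s ^ Suc k * Kr) + exp s ^ Suc k * KT) * exp (- (real k * s)) / a\<^sup>2
         = (Kp * Kr + KT) / a\<^sup>2 * exp s"
      proof -
        have "exp (- (real k * s)) = 1 / exp s ^ k" by (simp add: exp_minus exp_of_nat_mult divide_inverse)
        thus ?thesis by (simp add: field_simps)
      qed
      also have "\<dots> \<le> K * exp s"
        unfolding K_def using a Kd Kp by (intro mult_right_mono divide_right_mono) auto
      finally show ?thesis .
    qed
    have 2: "norm (\<psi> (Complex s t)) \<le> K * exp s" if s: "s \<le> s0" for s t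
    proof -
      let ?w = "Complex s t" let ?z = "exp ?w"
      have zz: "norm ?z \<le> 1" using nz small[OF s] by simp
      have e1: "norm (2 * P' ?w * cnj (P ?w)) = 2 * (norm (poly (pderiv p) ?z) * exp s * norm (P ?w))"
        by (simp add: norm_mult P'_def nz)
      have e2: "norm (2 * (of_nat b * E ?w) * cnj (E ?w)) = 2 * (b * exp s ^ (2 * b))"
        by (simp add: norm_mult nE power_even_eq power2_eq_square)
      have "norm (\<psi> ?w) \<le> (2 * (norm (poly (pderiv p) ?z) * exp s * norm (P ?w)) + 2 * (b * exp s ^ (2
          * b))) / norm (A ?w)"
        unfolding \<psi>_def norm_divide e1[symmetric] e2[symmetric]
        by (intro divide_right_mono norm_triangle_ineq norm_ge_zero)
      also have "\<dots> \<le> (2 * (Kd * exp s * Kp) + 2 * (b * exp s ^ 1)) / a\<^sup>2"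
        using Kp Kd zz a Alow[OF s] small[OF s] kb
        by (intro frac_le add_mono mult_mono mult_left_mono power_decreasing) (auto simp: P_def)
      also have "\<dots> = (2 * (Kd * Kp) + 2 * b) / a\<^sup>2 * exp s" by (simp add: field_simps)
      also have "\<dots> \<le> K * exp s"
        unfolding K_def using a Kr Kp KT by (intro mult_right_mono divide_right_mono) auto
      finally show ?thesis .
    qed
    have "norm (c s - 2 * pi * coeff T k) \<le> 2 * pi * (K * exp s) \<and> norm (n s) \<le> 2 * pi * (K * exp s)"
        if s: "s \<le> s0" for s
    proof
      let ?h = "\<lambda>t. \<phi> (Complex s t) - poly T (exp (Complex s t)) * exp (- (of_nat k * Complex s t))"
      have cT: "continuous_on UNIV (\<lambda>w. poly T (exp w) * exp (- (of_nat k * w)))"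
          by (intro continuous_intros)
      have "(?h has_integral c s - 2 * pi * coeff T k) {0..2*pi}"
        unfolding c_def
        by (intro has_integral_diff integral_poly_coeff[OF degT] integrable_integral
            integrable_continuous_interval c_in c\<phi>)
      hence "c s - 2 * pi * coeff T k = integral {0..2*pi} ?h" by (simp add: integral_unique)
      also have "norm \<dots> \<le> 2 * pi * (K * exp s)"
        by (rule integral_norm_le_const) (rule continuous_on_diff[OF c_in[OF c\<phi>] c_in[OF cT]], rule 1[OF s])
      finally show "norm (c s - 2 * pi * coeff T k) \<le> 2 * pi * (K * exp s)" .
      show "norm (n s) \<le> 2 * pi * (K * exp s)"
        unfolding n_def by (rule integral_norm_le_const) (rule c_in[OF c\<psi>], rule 2[OF s])
    qed
    thus ?thesis by blast
  qed
  then obtain K s0 where K: "\<And>s. s \<le> s0 \<Longrightarrow> norm (c s - 2 * pi * coeff T k) \<le> 2 * pi * (K * exp s)"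
     "\<And>s. s \<le> s0 \<Longrightarrow> norm (n s) \<le> 2 * pi * (K * exp s)" by blast

  have fin: "norm (coeff T k) \<le> B + B\<^sup>2 + b + 2 * D\<^sup>2 + 2 * K * exp s" if s: "s \<le> min s0 (-1)" for s
  proof -
    have s': "s \<le> s0" "s < 0" using s by auto
    have "norm (2 * pi * coeff T k) \<le> norm (c 0) + norm (c 0 - c s) + norm (c s - 2 * pi * coeff T k)"
      by norm
    also have "\<dots> \<le> 2 * pi * B + (Re (n 0) / 4 - Re (n s) / 4 + 4 * pi * D\<^sup>2) + 2 * pi * (K * exp s)"
      using c0 diff[OF s'(2)] K(1)[OF s'(1)] by simp
    also have "\<dots> \<le> 2 * pi * B + (2 * pi * (2 * (B\<^sup>2 + b)) / 4 + 2 * pi * (K * exp s) / 4 + 4 * pi * D\<^sup>2)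
        + 2 * pi * (K * exp s)"
      using n0 K(2)[OF s'(1)] abs_Re_le_cmod[of "n 0"] abs_Re_le_cmod[of "n s"]
      unfolding abs_le_iff by linarith
    also have "\<dots> = 2 * pi * (B + (B\<^sup>2 + b) / 2 + 2 * D\<^sup>2 + (5/4) * (K * exp s))" by (simp add: field_simps)
    finally have "norm (coeff T k) \<le> B + (B\<^sup>2 + b) / 2 + 2 * D\<^sup>2 + (5/4) * (K * exp s)"
      by (simp add: norm_mult)
    \<comment> \<open>The sign of K is recovered from its being part of an upper bound for a norm.
      It is needed to enlarge 5/4 to 2; the 5/4 consists of 1 from the error of c and 1/4 from that
      of n.\<close>
    moreover have "K * exp s \<ge> 0"
    proof (rule ccontr)
      assume "\<not> K * exp s \<ge> 0"
      hence "2 * pi * (K * exp s) < 0" using mult_pos_neg[of "2 * pi" "K * exp s"] by simp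
      with K(2)[OF s'(1)] norm_ge_zero[of "n s"] show False by linarith
    qed
    moreover have "(B\<^sup>2 + b) / 2 \<le> B\<^sup>2 + b" by (simp add: add_nonneg_nonneg)
    ultimately show ?thesis by linarith
  qed
  \<comment> \<open>Letting s tend to -infinity removes the only term that depends on p(0).\<close>
  have "((\<lambda>s. B + B\<^sup>2 + b + 2 * D\<^sup>2 + 2 * K * exp s) \<longlongrightarrow> B + B\<^sup>2 + b + 2 * D\<^sup>2 + 2 * K * 0) at_bot"
    by (intro tendsto_intros exp_at_bot)
  moreover have "\<forall>\<^sub>F s in at_bot. norm (coeff T k) \<le> B + B\<^sup>2 + b + 2 * D\<^sup>2 + 2 * K * exp s"
    unfolding eventually_at_bot_linorder using fin by blast
  ultimately show ?thesis
    by (intro tendsto_lowerbound[where F = "at_bot :: real filter"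
        and f = "\<lambda>s. B + B\<^sup>2 + b + 2 * D\<^sup>2 + 2 * K * exp s"]) auto
qed

section \<open>Iterated partial derivatives\<close>

lemma frechet_derivative_cong_open:
  assumes "open U" "x \<in> U" "\<And>y. y \<in> U \<Longrightarrow> f y = g y"
  shows "frechet_derivative f (at x) = frechet_derivative g (at x)"
proof -
  have "(f has_derivative D) (at x) \<longleftrightarrow> (g has_derivative D) (at x)" for D
    using has_derivative_transform_within_open[of f D x UNIV U g]
      has_derivative_transform_within_open[of g D x UNIV U f] assms by auto
  thus ?thesis by (simp add: frechet_derivative_def)
qed

lemma pderivs_cong_open:
  assumes "open U" "x \<in> U" "\<And>y. y \<in> U \<Longrightarrow> f y = g y"
  shows "pderivs bs f x = pderivs bs g x"
  using assms(2)
proof (induction bs arbitrary: x)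
  case (Cons b bs)
  show ?case using frechet_derivative_cong_open[OF assms(1) Cons.prems Cons.IH] by simp
qed (use assms in auto)

lemma pderivs_append: "pderivs (bs @ cs) f = pderivs bs (pderivs cs f)"
  by (induction bs) auto

lemma pderivs_single_eq:
  assumes "(f has_derivative D) (at x)"
  shows "pderivs [b] f x = D b"
  using frechet_derivative_at[OF assms] by simp

text \<open>The recursion takes the first derivative off instead of the last. The product and
  quotient rules express first derivatives through functions of one order less, so closure
  properties follow by induction on n.\<close>

fun times_differentiable_on :: "nat \<Rightarrow> (real^'n) set \<Rightarrow> (real^'n \<Rightarrow> complex) \<Rightarrow> bool" where
  "times_differentiable_on 0 U f \<longleftrightarrow> f differentiable_on U"
| "times_differentiable_on (Suc n) U f \<longleftrightarrow>
     f differentiable_on U \<and> (\<forall>b\<in>Basis. times_differentiable_on n U (pderivs [b] f))"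

lemma smooth_on_iff_times_differentiable_on:
  fixes f :: "real^'n \<Rightarrow> complex"
  shows "smooth_on U f \<longleftrightarrow> (\<forall>n. times_differentiable_on n U f)"
proof -
  have 1: "times_differentiable_on n U f \<longleftrightarrow>
      (\<forall>bs. set bs \<subseteq> Basis \<and> length bs \<le> n \<longrightarrow> pderivs bs f differentiable_on U)"
    for n and f :: "real^'n \<Rightarrow> complex"
  proof (induction n arbitrary: f)
    case (Suc n)
    show ?case
    proof
      assume L: "times_differentiable_on (Suc n) U f"
      show "\<forall>bs. set bs \<subseteq> Basis \<and> length bs \<le> Suc n \<longrightarrow> pderivs bs f differentiable_on U"
      proof (intro allI impI)
        fix bs :: "(real^'n) list" assume bs: "set bs \<subseteq> Basis \<and> length bs \<le> Suc n"
        show "pderivs bs f differentiable_on U"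
        \<comment> \<open>\<open>pderivs\<close> applies the last entry of the list first, so the
          list is split at its end.\<close>
        proof (cases bs rule: rev_cases)
          case (snoc cs b)
          with L bs Suc.IH[of "pderivs [b] f"] show ?thesis
              by (auto simp: pderivs_append simp del: pderivs.simps(2))
        qed (use L in auto)
      qed
    next
      assume R: "\<forall>bs. set bs \<subseteq> Basis \<and> length bs \<le> Suc n \<longrightarrow> pderivs bs f differentiable_on U"
      have "times_differentiable_on n U (pderivs [b] f)" if "b \<in> Basis" for b
        unfolding Suc.IH using R that by (auto simp: pderivs_append[symmetric] simp del: pderivs.simps(2))
      with R[rule_format, of "[]"] show "times_differentiable_on (Suc n) U f" by simp
    qed
  qed auto
  show ?thesis unfolding smooth_on_def 1 by auto
qed

lemma times_differentiable_on_SucD: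
  "times_differentiable_on (Suc n) U f \<Longrightarrow> times_differentiable_on n U f"
  by (induction n arbitrary: f) auto

lemma times_differentiable_on_imp_differentiable:
  "times_differentiable_on n U f \<Longrightarrow> open U \<Longrightarrow> x \<in> U \<Longrightarrow> f differentiable (at x)"
  by (cases n) (auto simp: differentiable_on_eq_differentiable_at)

lemma differentiable_on_cong_open:
  assumes "open U" "\<And>y. y \<in> U \<Longrightarrow> f y = g y" "f differentiable_on U"
  shows "g differentiable_on U"
  unfolding differentiable_on_eq_differentiable_at[OF assms(1)] differentiable_def
proof
  fix x assume x: "x \<in> U"
  then obtain D where "(f has_derivative D) (at x)"
    using assms(3) unfolding differentiable_on_eq_differentiable_at[OF assms(1)] differentiable_def by blast
  with x show "\<exists>D. (g has_derivative D) (at x)"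
    using has_derivative_transform_within_open[of f D x UNIV U g] assms(1,2) by auto
qed

lemma times_differentiable_on_cong:
  assumes "open U" "\<And>y. y \<in> U \<Longrightarrow> f y = g y" "times_differentiable_on n U f"
  shows "times_differentiable_on n U g"
  using assms(2,3)
proof (induction n arbitrary: f g)
  case (Suc n)
  have "times_differentiable_on n U (pderivs [b] g)" if "b \<in> Basis" for b
    by (rule Suc.IH[of "pderivs [b] f"])
       (use Suc.prems that pderivs_cong_open[OF assms(1), of _ f g "[b]"] in \<open>auto simp del: pderivs.simps\<close>)
  with Suc.prems differentiable_on_cong_open[OF assms(1) Suc.prems(1)] show ?case by auto
qed (use differentiable_on_cong_open[OF assms(1)] in auto)

lemma times_differentiable_on_const:
  assumes "open U" shows "times_differentiable_on n U (\<lambda>x. c)"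
proof (induction n arbitrary: c)
  case (Suc n)
  have "times_differentiable_on n U (pderivs [b] (\<lambda>x. c))" for b
    by (rule times_differentiable_on_cong[OF assms _ Suc[of 0]]) (simp add: frechet_derivative_const)
  thus ?case by simp
qed simp

lemma times_differentiable_on_add:
  assumes "open U" "times_differentiable_on n U f" "times_differentiable_on n U g"
  shows "times_differentiable_on n U (\<lambda>x. f x + g x)"
  using assms(2,3)
proof (induction n arbitrary: f g)
  case (Suc n)
  have "times_differentiable_on n U (pderivs [b] (\<lambda>x. f x + g x))" if "b \<in> Basis" for b
  proof (rule times_differentiable_on_cong[OF assms(1) _ Suc.IH[of "pderivs [b] f" "pderivs [b] g"]])
    fix y assume "y \<in> U"
    hence "f differentiable (at y)" "g differentiable (at y)"
      using Suc.prems times_differentiable_on_imp_differentiable assms(1) by blast+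
    thus "pderivs [b] f y + pderivs [b] g y = pderivs [b] (\<lambda>x. f x + g x) y"
      using pderivs_single_eq[OF has_derivative_add[OF frechet_derivative_works[THEN iffD1]
          frechet_derivative_works[THEN iffD1]], of f y g b]
      by simp
  qed (use Suc.prems that in auto)
  with Suc.prems show ?case by (auto intro: differentiable_on_add)
qed (auto intro: differentiable_on_add)

lemma times_differentiable_on_mult:
  assumes "open U" "times_differentiable_on n U f" "times_differentiable_on n U g"
  shows "times_differentiable_on n U (\<lambda>x. f x * g x)"
  using assms(2,3)
proof (induction n arbitrary: f g)
  case (Suc n)
  have d: "times_differentiable_on n U f" "times_differentiable_on n U g"
    using Suc.prems times_differentiable_on_SucD by blast+
  have "times_differentiable_on n U (pderivs [b] (\<lambda>x. f x * g x))" if b: "b \<in> Basis" for b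
  proof (rule times_differentiable_on_cong[OF assms(1)])
    show "times_differentiable_on n U (\<lambda>x. f x * pderivs [b] g x + pderivs [b] f x * g x)"
      using Suc.prems b d by (intro times_differentiable_on_add[OF assms(1)] Suc.IH) (auto simp del:
          pderivs.simps)
    fix y assume "y \<in> U"
    hence "f differentiable (at y)" "g differentiable (at y)"
      using Suc.prems times_differentiable_on_imp_differentiable assms(1) by blast+
    thus "f y * pderivs [b] g y + pderivs [b] f y * g y = pderivs [b] (\<lambda>x. f x * g x) y"
      using pderivs_single_eq[OF has_derivative_mult[OF frechet_derivative_works[THEN iffD1]
          frechet_derivative_works[THEN iffD1]], of f y g b]
      by simp
  qed
  with Suc.prems show ?case by (auto intro: differentiable_on_mult)
qed (auto intro: differentiable_on_mult)

lemma times_differentiable_on_inverse: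
  assumes "open U" "times_differentiable_on n U f" "\<And>x. x \<in> U \<Longrightarrow> f x \<noteq> 0"
  shows "times_differentiable_on n U (\<lambda>x. inverse (f x))"
  using assms(2)
proof (induction n)
  case 0
  then show ?case using assms(1,3) by (auto simp: differentiable_on_eq_differentiable_at)
next
  case (Suc n)
  have d: "times_differentiable_on n U f" using Suc.prems times_differentiable_on_SucD by blast
  have dd: "f differentiable (at y)" if "y \<in> U" for y
    using that Suc.prems times_differentiable_on_imp_differentiable assms(1) by blast
  have "times_differentiable_on n U (pderivs [b] (\<lambda>x. inverse (f x)))" if b: "b \<in> Basis" for b
  proof (rule times_differentiable_on_cong[OF assms(1)])
    show "times_differentiable_on n U (\<lambda>x. (-1) * (inverse (f x) * pderivs [b] f x * inverse (f x)))"
      using Suc.prems b d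
      by (intro times_differentiable_on_mult[OF assms(1)] Suc.IH times_differentiable_on_const[OF assms(1)])
         (auto simp del: pderivs.simps)
    fix y assume y: "y \<in> U"
    have "(f has_derivative frechet_derivative f (at y)) (at y)"
      using dd[OF y] by (simp add: frechet_derivative_works)
    from pderivs_single_eq[OF Deriv.has_derivative_inverse[OF assms(3)[OF y] this], of b]
    show "(-1) * (inverse (f y) * pderivs [b] f y * inverse (f y)) = pderivs [b] (\<lambda>x. inverse (f x)) y"
      by simp
  qed
  moreover have "(\<lambda>x. inverse (f x)) differentiable_on U"
    using dd assms(1,3) by (auto simp: differentiable_on_eq_differentiable_at)
  ultimately show ?case by auto
qed

section \<open>Closure properties of smooth functions, and derivatives in arbitrary
  directions\<close>

lemma smooth_on_cong:
  assumes "open U" "\<And>y. y \<in> U \<Longrightarrow> f y = g y" "smooth_on U f"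
  shows "smooth_on U g"
  using assms(3) times_differentiable_on_cong[OF assms(1), of f g, OF assms(2)]
  unfolding smooth_on_iff_times_differentiable_on by blast

lemma smooth_on_const: "open U \<Longrightarrow> smooth_on U (\<lambda>x. c)"
  by (simp add: smooth_on_iff_times_differentiable_on times_differentiable_on_const)

lemma smooth_on_add: "open U \<Longrightarrow> smooth_on U f \<Longrightarrow> smooth_on U g \<Longrightarrow> smooth_on U (\<lambda>x. f x + g x)"
  by (simp add: smooth_on_iff_times_differentiable_on times_differentiable_on_add)

lemma smooth_on_mult: "open U \<Longrightarrow> smooth_on U f \<Longrightarrow> smooth_on U g \<Longrightarrow> smooth_on U (\<lambda>x. f x * g x)"
  by (simp add: smooth_on_iff_times_differentiable_on times_differentiable_on_mult)

lemma smooth_on_inverse: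
  "open U \<Longrightarrow> smooth_on U f \<Longrightarrow> (\<And>x. x \<in> U \<Longrightarrow> f x \<noteq> 0) \<Longrightarrow> smooth_on U (\<lambda>x. inverse (f x))"
  by (simp add: smooth_on_iff_times_differentiable_on times_differentiable_on_inverse)

lemma smooth_on_sum:
  "open U \<Longrightarrow> (\<And>i. i \<in> I \<Longrightarrow> smooth_on U (f i)) \<Longrightarrow> smooth_on U (\<lambda>x. \<Sum>i\<in>I. f i x)"
  by (induction I rule: infinite_finite_induct) (auto intro: smooth_on_const smooth_on_add)

lemma smooth_on_subset: "smooth_on U f \<Longrightarrow> V \<subseteq> U \<Longrightarrow> smooth_on V f"
  unfolding smooth_on_def using differentiable_on_subset by blast

lemma smooth_on_Un:
  assumes "open U" "open V" "smooth_on U f" "smooth_on V f"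
  shows "smooth_on (U \<union> V) f"
  using assms unfolding smooth_on_def
  by (auto simp: differentiable_on_eq_differentiable_at open_Un)

lemma smooth_on_differentiable: "smooth_on U f \<Longrightarrow> open U \<Longrightarrow> x \<in> U \<Longrightarrow> f differentiable (at x)"
  using smooth_on_iff_times_differentiable_on[of U f] times_differentiable_on_imp_differentiable[of 0 U
      f x] by blast

lemma smooth_on_pderiv_Basis: "smooth_on U f \<Longrightarrow> b \<in> Basis \<Longrightarrow> smooth_on U (pderivs [b] f)"
  unfolding smooth_on_iff_times_differentiable_on by (meson times_differentiable_on.simps(2))

lemma pderivs_single_linear:
  assumes "f differentiable (at x)"
  shows "linear (\<lambda>v. pderivs [v] f x)"
  using has_derivative_linear[OF assms[unfolded frechet_derivative_works]] by simp

lemma pderivs_single_Basis_expansion: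
  fixes v :: "real^'n"
  assumes "f differentiable (at x)"
  shows "pderivs [v] f x = (\<Sum>b\<in>Basis. (v \<bullet> b) *\<^sub>R pderivs [b] f x)"
proof -
  interpret linear "\<lambda>v. pderivs [v] f x" by (rule pderivs_single_linear[OF assms])
  have "pderivs [v] f x = pderivs [\<Sum>b\<in>Basis. (v \<bullet> b) *\<^sub>R b] f x" by (simp add: euclidean_representation)
  also have "\<dots> = (\<Sum>b\<in>Basis. (v \<bullet> b) *\<^sub>R pderivs [b] f x)" by (simp only: sum scale)
  finally show ?thesis .
qed

text \<open>Directions other than basis vectors are needed because the Taylor expansions run along
  lines. They reduce to basis directions by linearity of the derivative.\<close>

lemma smooth_on_pderivs:
  assumes "open U" "smooth_on U f" shows "smooth_on U (pderivs vs f)"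
proof (induction vs)
  case (Cons v vs)
  have "smooth_on U (\<lambda>x. \<Sum>b\<in>Basis. of_real (v \<bullet> b) * pderivs [b] (pderivs vs f) x)"
    by (intro smooth_on_sum smooth_on_mult smooth_on_const smooth_on_pderiv_Basis Cons assms)
  thus ?case
  proof (rule smooth_on_cong[OF assms(1), rotated])
    fix x assume "x \<in> U"
    show "(\<Sum>b\<in>Basis. of_real (v \<bullet> b) * pderivs [b] (pderivs vs f) x) = pderivs (v # vs) f x"
      using pderivs_single_Basis_expansion[OF smooth_on_differentiable[OF Cons assms(1) \<open>x \<in> U\<close>], of v]
      by (simp add: scaleR_conv_of_real)
  qed
qed (simp add: assms)

lemma has_vector_derivative_along_line:
  fixes f :: "real^'n \<Rightarrow> complex"
  assumes "f differentiable (at (y + s *\<^sub>R u))"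
  shows "((\<lambda>s. f (y + s *\<^sub>R u)) has_vector_derivative pderivs [u] f (y + s *\<^sub>R u)) (at s within S)"
proof -
  let ?D = "frechet_derivative f (at (y + s *\<^sub>R u))"
  have "((\<lambda>s. y + s *\<^sub>R u) has_derivative (\<lambda>h. h *\<^sub>R u)) (at s within S)"
    by (auto intro!: derivative_eq_intros)
  from has_derivative_compose[OF this assms[unfolded frechet_derivative_works]]
  have "((\<lambda>s. f (y + s *\<^sub>R u)) has_derivative (\<lambda>h. ?D (h *\<^sub>R u))) (at s within S)" .
  moreover have "?D (h *\<^sub>R u) = h *\<^sub>R ?D u" for h
    using linear_cmul[OF pderivs_single_linear[OF assms]] by simp
  ultimately show ?thesis by (simp add: has_vector_derivative_def)
qed

section \<open>Symmetry of iterated derivatives\<close>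

text \<open>The second difference is symmetric in u and v, the derivative on the other side is not
  visibly so; comparing the two orders gives the symmetry. This is Young's form of the argument: the
  first derivative is differentiable at the single point x.\<close>

lemma second_difference_approx:
  fixes f :: "real^'n \<Rightarrow> complex"
  assumes U: "open U" "x \<in> U" and f: "\<And>y. y \<in> U \<Longrightarrow> f differentiable (at y)"
    and df: "pderivs [u] f differentiable (at x)" and \<epsilon>: "\<epsilon> > 0"
  shows "\<exists>\<delta>>0. \<forall>h. 0 < h \<and> h < \<delta> \<longrightarrow>
    norm (f (x + h *\<^sub>R u + h *\<^sub>R v) - f (x + h *\<^sub>R u) - f (x + h *\<^sub>R v) + f x - (h
        * h) *\<^sub>R pderivs [v, u] f x) \<le> \<epsilon> * (h * h)"
proof -
  define N where "N = norm u + norm v + 1"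
  have N: "N > 0" by (simp add: N_def add_nonneg_pos)
  define L where "L w = pderivs [w, u] f x" for w
  have L: "(pderivs [u] f has_derivative L) (at x)"
    using df unfolding L_def frechet_derivative_works by simp
  \<comment> \<open>The linear approximation is used at two points, each at distance at most h N
    from x.\<close>
  define e where "e = \<epsilon> / (2 * N)"
  have e: "e > 0" using \<epsilon> N by (simp add: e_def)
  obtain d where d: "d > 0" "\<And>y. norm (y - x) < d
      \<Longrightarrow> norm (pderivs [u] f y - pderivs [u] f x - L (y - x)) \<le> e * norm (y - x)"
    using L e unfolding has_derivative_at_alt by blast
  obtain d2 where d2: "d2 > 0" "ball x d2 \<subseteq> U" using U open_contains_ball by blast
  define \<delta> where "\<delta> = min d d2 / N"
  have \<delta>: "\<delta> > 0" using d d2 N by (simp add: \<delta>_def)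
  interpret L: linear L using L has_derivative_linear by blast
  show ?thesis
  proof (intro exI[of _ \<delta>] conjI allI impI)
    fix h assume h: "0 < h \<and> h < \<delta>"
    have hN: "h * N < d" "h * N < d2" using h N by (auto simp: \<delta>_def field_simps)
    have sm: "norm (s *\<^sub>R u + t *\<^sub>R v) \<le> h * N" if "0 \<le> s" "s \<le> h" "0 \<le> t" "t \<le> h" for s t
    proof -
      have "norm (s *\<^sub>R u + t *\<^sub>R v) \<le> s * norm u + t * norm v"
        using that norm_triangle_ineq[of "s *\<^sub>R u" "t *\<^sub>R v"] by simp
      also have "\<dots> \<le> h * norm u + h * norm v" using that by (intro add_mono mult_right_mono) auto
      also have "\<dots> \<le> h * N" using h by (simp add: N_def algebra_simps)
      finally show ?thesis .
    qed
    \<comment> \<open>The expected main term is subtracted beforehand, so that the increment of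
      \<open>\<phi>\<close> over [0, h] is the whole error and its derivative is small.\<close>
    define \<phi> where "\<phi> s = f ((x + h *\<^sub>R v) + s *\<^sub>R u) - f (x + s *\<^sub>R u) - (s * h) *\<^sub>R L v" for s
    have inU: "x + h *\<^sub>R v + s *\<^sub>R u \<in> U" "x + s *\<^sub>R u \<in> U" if "0 \<le> s" "s \<le> h" for s
      using sm[OF that, of h] sm[OF that, of 0] h hN d2 that
      by (auto intro!: subsetD[OF d2(2)] simp: dist_norm norm_minus_commute add.commute add.left_commute)
    have "norm (\<phi> h - \<phi> 0) \<le> e * (2 * (h * N)) * norm (h - 0)"
    proof (rule differentiable_bound[where S = "{0..h}"
        and f' = "\<lambda>s k. k *\<^sub>R (pderivs [u] f (x + h *\<^sub>R v + s *\<^sub>R u) - pderivs [u] f (x + s *\<^sub>R u)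
            - h *\<^sub>R L v)"])
      fix s assume s: "s \<in> {0..h}"
      have 1: "((\<lambda>s. f (x + h *\<^sub>R v + s *\<^sub>R u))
          has_vector_derivative pderivs [u] f (x + h *\<^sub>R v + s *\<^sub>R u)) (at s within {0..h})"
        using s by (intro has_vector_derivative_along_line f inU) auto
      have 2: "((\<lambda>s. f (x + s *\<^sub>R u)) has_vector_derivative pderivs [u] f (x + s *\<^sub>R u)) (at s
          within {0..h})"
        using s by (intro has_vector_derivative_along_line f inU) auto
      have 3: "((\<lambda>s. (s * h) *\<^sub>R L v) has_vector_derivative h *\<^sub>R L v) (at s within {0..h})"
        unfolding has_vector_derivative_def by (auto intro!: derivative_eq_intros simp: fun_eq_iff)
      show "(\<phi> has_derivative (\<lambda>k. k *\<^sub>R (pderivs [u] f (x + h *\<^sub>R v + s *\<^sub>R u) - pderivs [u] f (x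
          + s *\<^sub>R u) - h *\<^sub>R L v))) (at s within {0..h})"
        using has_vector_derivative_diff[OF has_vector_derivative_diff[OF 1 2] 3]
        unfolding has_vector_derivative_def \<phi>_def[abs_def] .
      have s': "0 \<le> s" "s \<le> h" using s by auto
      have a: "norm (pderivs [u] f (x + h *\<^sub>R v + s *\<^sub>R u) - pderivs [u] f x - L (s *\<^sub>R u + h *\<^sub>R v))
          \<le> e * (h * N)"
        using d(2)[of "x + h *\<^sub>R v + s *\<^sub>R u"] sm[OF s', of h] hN h e
        by (auto simp: add.commute add.left_commute intro: order_trans mult_left_mono simp del:
            pderivs.simps)
      have b: "norm (pderivs [u] f (x + s *\<^sub>R u) - pderivs [u] f x - L (s *\<^sub>R u)) \<le> e * (h * N)"
        using d(2)[of "x + s *\<^sub>R u"] sm[OF s', of 0] hN h e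
        by (auto intro: order_trans mult_left_mono simp del: pderivs.simps)
      have "norm (pderivs [u] f (x + h *\<^sub>R v + s *\<^sub>R u) - pderivs [u] f (x + s *\<^sub>R u) - h *\<^sub>R L v)
          \<le> e * (h * N) + e * (h * N)"
        by (rule order_trans[OF eq_refl norm_triangle_le_diff[OF add_mono[OF a b]]])
           (simp add: L.add L.scale algebra_simps del: pderivs.simps)
      hence "norm (pderivs [u] f (x + h *\<^sub>R v + s *\<^sub>R u) - pderivs [u] f (x + s *\<^sub>R u) - h *\<^sub>R L v)
          \<le> e * (2 * (h * N))"
        by (simp add: mult_ac del: pderivs.simps)
      thus "onorm (\<lambda>k. k *\<^sub>R (pderivs [u] f (x + h *\<^sub>R v + s *\<^sub>R u) - pderivs [u] f (x + s *\<^sub>R u)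
          - h *\<^sub>R L v)) \<le> e * (2 * (h * N))"
        by (intro onorm_le) (simp add: mult.commute mult_left_mono del: pderivs.simps)
    qed (use h in auto)
    also have "\<dots> = \<epsilon> * (h * h)" using N h by (simp add: e_def)
    finally show "norm (f (x + h *\<^sub>R u + h *\<^sub>R v) - f (x + h *\<^sub>R u) - f (x + h *\<^sub>R v) + f x - (h
        * h) *\<^sub>R pderivs [v, u] f x) \<le> \<epsilon> * (h * h)"
      by (simp add: \<phi>_def L_def algebra_simps del: pderivs.simps)
  qed (rule \<delta>)
qed

lemma pderivs_swap2:
  fixes f :: "real^'n \<Rightarrow> complex"
  assumes U: "open U" "x \<in> U" and f: "smooth_on U f"
  shows "pderivs [u, v] f x = pderivs [v, u] f x"
proof (rule ccontr)
  assume ne: "\<not> ?thesis"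
  \<comment> \<open>A third of the supposed gap: the two approximations together err by at most 2 e
    h^2, while the gap would be 3 e h^2.\<close>
  define e where "e = norm (pderivs [u, v] f x - pderivs [v, u] f x) / 3"
  have e: "e > 0" using ne by (simp add: e_def del: pderivs.simps)
  have d: "f differentiable (at y)" if "y \<in> U" for y using smooth_on_differentiable[OF f U(1) that] .
  have dd: "pderivs [w] f differentiable (at x)" for w
    using smooth_on_differentiable[OF smooth_on_pderivs[OF U(1) f] U] .
  obtain d1 where d1: "d1 > 0" "\<And>h. 0 < h \<and> h < d1 \<Longrightarrow>
    norm (f (x + h *\<^sub>R u + h *\<^sub>R v) - f (x + h *\<^sub>R u) - f (x + h *\<^sub>R v) + f x - (h
        * h) *\<^sub>R pderivs [v, u] f x) \<le> e * (h * h)"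
    using second_difference_approx[OF U d dd e, of u v] by blast
  obtain d2 where d2: "d2 > 0" "\<And>h. 0 < h \<and> h < d2 \<Longrightarrow>
    norm (f (x + h *\<^sub>R v + h *\<^sub>R u) - f (x + h *\<^sub>R v) - f (x + h *\<^sub>R u) + f x - (h
        * h) *\<^sub>R pderivs [u, v] f x) \<le> e * (h * h)"
    using second_difference_approx[OF U d dd e, of v u] by blast
  define h where "h = min d1 d2 / 2"
  have h: "0 < h \<and> h < d1" "0 < h \<and> h < d2" using d1 d2 by (auto simp: h_def)
  have c: "x + h *\<^sub>R v + h *\<^sub>R u = x + h *\<^sub>R u + h *\<^sub>R v" by simp
  have "norm ((h * h) *\<^sub>R (pderivs [u, v] f x - pderivs [v, u] f x)) \<le> e * (h * h) + e * (h * h)"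
    by (rule order_trans[OF eq_refl norm_triangle_le_diff[OF add_mono[OF d1(2)[OF h(1)] d2(2)[OF h(2)]]]])
       (simp add: c algebra_simps del: pderivs.simps)
  hence "(3 * e) * (h * h) \<le> (2 * e) * (h * h)" using h by (simp add: e_def mult.commute del: pderivs.simps)
  hence "3 * e \<le> 2 * e" using h by (simp add: mult_le_cancel_right)
  thus False using e by simp
qed

lemma pderivs_move_front:
  fixes f :: "real^'n \<Rightarrow> complex"
  assumes U: "open U" and f: "smooth_on U f" and "x \<in> U"
  shows "pderivs (vs @ v # ws) f x = pderivs (v # vs @ ws) f x"
  using assms(3)
proof (induction vs arbitrary: x)
  case (Cons a vs)
  have "pderivs ((a # vs) @ v # ws) f x = pderivs [a] (pderivs (v # vs @ ws) f) x"
    using pderivs_cong_open[OF U Cons.prems Cons.IH, where bs = "[a]"] by simp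
  also have "\<dots> = pderivs [a, v] (pderivs (vs @ ws) f) x" by simp
  also have "\<dots> = pderivs [v, a] (pderivs (vs @ ws) f) x"
    by (rule pderivs_swap2[OF U Cons.prems smooth_on_pderivs[OF U f]])
  finally show ?case by simp
qed simp

lemma pderivs_perm:
  fixes f :: "real^'n \<Rightarrow> complex"
  assumes U: "open U" and f: "smooth_on U f" and "x \<in> U" "mset vs = mset ws"
  shows "pderivs vs f x = pderivs ws f x"
  using assms(3,4)
proof (induction vs arbitrary: ws x)
  case (Cons v vs)
  have "v \<in> set ws" using Cons.prems by (metis list.set_intros(1) set_mset_mset)
  then obtain as bs where ws: "ws = as @ v # bs" by (meson split_list)
  have m: "mset vs = mset (as @ bs)" using Cons.prems ws by simp
  have "pderivs (v # vs) f x = pderivs [v] (pderivs (as @ bs) f) x"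
    using pderivs_cong_open[OF U Cons.prems(1) Cons.IH[OF _ m], where bs = "[v]"] by simp
  thus ?case unfolding ws pderivs_move_front[OF U f Cons.prems(1)] by simp
qed simp

section \<open>Symmetric multilinear forms\<close>

lemma power_div_fact_le_exp:
  fixes x :: real assumes "x \<ge> 0" shows "x ^ n / fact n \<le> exp x"
proof -
  have s: "(\<lambda>n. x ^ n /\<^sub>R fact n) sums exp x" by (rule exp_converges)
  have "(\<Sum>i\<in>{n}. x ^ i /\<^sub>R fact i) \<le> (\<Sum>i. x ^ i /\<^sub>R fact i)"
    using assms by (intro sum_le_suminf sums_summable[OF s]) auto
  thus ?thesis using sums_unique[OF s] by (simp add: divide_inverse mult.commute)
qed

text \<open>Models all derivatives of one function at one point. Lists of every length are allowed
  at once, because binomial expansions and differences mix slots; linearity in the first slot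
  spreads to the others through \<open>perm\<close>.\<close>

locale symmetric_form =
  fixes L :: "'v::real_normed_vector list \<Rightarrow> complex"
  assumes perm: "mset vs = mset ws \<Longrightarrow> L vs = L ws"
    and add: "L ((u + v) # vs) = L (u # vs) + L (v # vs)"
    and scale: "L ((c *\<^sub>R u) # vs) = of_real c * L (u # vs)"
begin

lemma sum: "finite I \<Longrightarrow> L ((\<Sum>i\<in>I. c i *\<^sub>R b i) # vs) = (\<Sum>i\<in>I. of_real (c i) * L (b i # vs))"
proof (induction I rule: finite_induct)
  case empty
  show ?case using scale[of 0 0 vs] by simp
qed (simp add: add scale)

lemma replicate_scale: "L (replicate m (c *\<^sub>R v) @ ws) = of_real c ^ m * L (replicate m v @ ws)"
proof (induction m arbitrary: ws)
  case (Suc m)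
  have "L (replicate (Suc m) (c *\<^sub>R v) @ ws) = of_real c * L (v # replicate m (c *\<^sub>R v) @ ws)"
      by (simp add: scale)
  also have "L (v # replicate m (c *\<^sub>R v) @ ws) = L (replicate m (c *\<^sub>R v) @ v # ws)" by (rule perm) simp
  also have "\<dots> = of_real c ^ m * L (replicate m v @ v # ws)" by (rule Suc)
  also have "L (replicate m v @ v # ws) = L (replicate (Suc m) v @ ws)" by (rule perm) simp
  finally show ?case by simp
qed simp

lemma replicate_add:
  "L (replicate m (u + v) @ ws) = (\<Sum>i\<le>m. of_nat (m choose i) * L (replicate i u @ replicate (m
      - i) v @ ws))"
proof (induction m arbitrary: ws)
  case (Suc m)
  let ?X = "\<lambda>i j. L (replicate i u @ replicate j v @ ws)"
  have "L (replicate (Suc m) (u + v) @ ws) = L (u # replicate m (u + v) @ ws) + L (v # replicate m (u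
      + v) @ ws)"
    by (simp add: add)
  also have "L (u # replicate m (u + v) @ ws) = L (replicate m (u + v) @ u # ws)" by (rule perm) simp
  also have "\<dots> = (\<Sum>i\<le>m. of_nat (m choose i) * ?X (Suc i) (m - i))"
    unfolding Suc by (intro sum.cong refl arg_cong2[where f = "(*)"] perm) auto
  also have "L (v # replicate m (u + v) @ ws) = L (replicate m (u + v) @ v # ws)" by (rule perm) simp
  also have "\<dots> = (\<Sum>i\<le>m. of_nat (m choose i) * ?X i (Suc m - i))"
    unfolding Suc
  proof (intro sum.cong refl arg_cong2[where f = "(*)"] perm)
    fix i assume "i \<in> {..m}"
    thus "mset (replicate i u @ replicate (m - i) v @ v # ws)
        = mset (replicate i u @ replicate (Suc m - i) v @ ws)"
      by (simp add: Suc_diff_le)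
  qed
  also have "(\<Sum>i\<le>m. of_nat (m choose i) * ?X i (Suc m - i))
      = ?X 0 (Suc m) + (\<Sum>i\<le>m. of_nat (m choose Suc i) * ?X (Suc i) (m - i))"
  proof -
    have "(\<Sum>i\<le>m. of_nat (m choose i) * ?X i (Suc m - i))
        = (\<Sum>i\<le>Suc m. of_nat (m choose i) * ?X i (Suc m - i))"
      by (intro sum.mono_neutral_left) (auto simp: not_le)
    also have "\<dots> = ?X 0 (Suc m) + (\<Sum>i\<le>m. of_nat (m choose Suc i) * ?X (Suc i) (m - i))"
      by (subst sum.atMost_Suc_shift) simp
    finally show ?thesis .
  qed
  also have "(\<Sum>i\<le>m. of_nat (m choose i) * ?X (Suc i) (m - i)) + (?X 0 (Suc m)
      + (\<Sum>i\<le>m. of_nat (m choose Suc i) * ?X (Suc i) (m - i)))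
     = ?X 0 (Suc m) + (\<Sum>i\<le>m. of_nat (Suc m choose Suc i) * ?X (Suc i) (m - i))"
    by (simp add: sum.distrib[symmetric] algebra_simps)
  also have "\<dots> = (\<Sum>i\<le>Suc m. of_nat (Suc m choose i) * ?X i (Suc m - i))"
    by (subst sum.atMost_Suc_shift) simp
  finally show ?case .
qed simp

end

section \<open>Polarization by finite differences\<close>

fun mixed_difference :: "'v::ab_group_add list \<Rightarrow> ('v \<Rightarrow> complex) \<Rightarrow> 'v \<Rightarrow> complex" where
  "mixed_difference [] P u = P u"
| "mixed_difference (b # bs) P u = mixed_difference bs (\<lambda>v. P (v + b) - P v) u"

lemma mixed_difference_sum:
  "mixed_difference bs (\<lambda>v. \<Sum>i\<in>I. c i * P i v) u = (\<Sum>i\<in>I. c i * mixed_difference bs (P i) u)"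
proof (induction bs arbitrary: P)
  case (Cons b bs)
  have "mixed_difference (b # bs) (\<lambda>v. \<Sum>i\<in>I. c i * P i v) u
      = mixed_difference bs (\<lambda>v. \<Sum>i\<in>I. c i * (P i (v + b) - P i v)) u"
    by (simp add: sum_subtractf right_diff_distrib)
  also have "\<dots> = (\<Sum>i\<in>I. c i * mixed_difference (b # bs) (P i) u)" by (subst Cons) simp
  finally show ?case .
qed simp

lemma mixed_difference_bound:
  fixes P :: "'v::real_normed_vector \<Rightarrow> complex"
  assumes "\<And>v. norm v \<le> norm u + length bs \<Longrightarrow> norm (P v) \<le> K" "\<And>b. b \<in> set bs \<Longrightarrow> norm b \<le> 1"
  shows "norm (mixed_difference bs P u) \<le> 2 ^ length bs * K"
  using assms
proof (induction bs arbitrary: P K)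
  case (Cons b bs)
  have "norm (mixed_difference bs (\<lambda>v. P (v + b) - P v) u) \<le> 2 ^ length bs * (2 * K)"
  proof (rule Cons.IH)
    fix v :: 'v assume v: "norm v \<le> norm u + length bs"
    have "norm (v + b) \<le> norm u + length (b # bs)"
      using v Cons.prems(2)[of b] norm_triangle_ineq[of v b] by simp
    hence "norm (P (v + b)) \<le> K" "norm (P v) \<le> K" using Cons.prems(1) v by auto
    thus "norm (P (v + b) - P v) \<le> 2 * K" using norm_triangle_ineq4[of "P (v + b)" "P v"] by linarith
  qed (use Cons.prems in auto)
  thus ?case by (simp add: mult.assoc)
qed auto

context symmetric_form
begin

text \<open>A difference lowers the degree in v by at least one. The lower terms of the binomial
  expansion then meet more differences than their degree, which is why lists longer than m are
  covered as well.\<close>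

lemma mixed_difference_power:
  "length bs \<ge> m \<Longrightarrow> mixed_difference bs (\<lambda>v. L (replicate m v @ cs)) u
     = (if length bs = m then fact m * L (bs @ cs) else 0)"
proof (induction m arbitrary: bs cs rule: less_induct)
  case (less m)
  show ?case
  proof (cases bs)
    case Nil
    thus ?thesis using less.prems by simp
  next
    case (Cons b bs')
    have *: "L (replicate m (v + b) @ cs) - L (replicate m v @ cs)
        = (\<Sum>i<m. of_nat (m choose i) * L (replicate i v @ replicate (m - i) b @ cs))" for v
      by (simp add: replicate_add lessThan_Suc_atMost[symmetric])
    have "mixed_difference bs (\<lambda>v. L (replicate m v @ cs)) u
       = (\<Sum>i<m. of_nat (m choose i) * mixed_difference bs' (\<lambda>v. L (replicate i v @ replicate (m
           - i) b @ cs)) u)"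
      by (simp add: Cons * mixed_difference_sum)
    also have "\<dots> = (\<Sum>i<m. of_nat (m choose i) * (if length bs'
        = i then fact i * L (bs' @ replicate (m - i) b @ cs) else 0))"
      using less.prems Cons by (intro sum.cong refl arg_cong2[where f = "(*)"] less.IH) auto
    also have "\<dots> = (if length bs = m then fact m * L (bs @ cs) else 0)"
    proof (cases "length bs = m")
      case True
      then obtain k where k: "m = Suc k" "length bs' = k" using Cons by auto
      have "(\<Sum>i<m. of_nat (m choose i) * (if length bs'
          = i then fact i * L (bs' @ replicate (m - i) b @ cs) else 0))
          = (\<Sum>i<m. if i = k then of_nat (m choose k) * (fact k * L (bs' @ replicate (m
              - k) b @ cs)) else 0)"
        using k by (intro sum.cong) auto
      also have "\<dots> = of_nat (m choose k) * (fact k * L (bs' @ [b] @ cs))" using k by simp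
      also have "L (bs' @ [b] @ cs) = L (bs @ cs)" by (rule perm) (simp add: Cons)
      finally show ?thesis using True k by (simp add: mult.assoc)
    next
      case False
      thus ?thesis using Cons less.prems by (auto intro!: sum.neutral)
    qed
    finally show ?thesis .
  qed
qed

text \<open>The mixed difference at 0 equals m! times the form and has 2^m terms, evaluated at
  vectors of norm at most m. Homogeneity costs m^m, and m^m / m! is at most e^m.\<close>

lemma polarization_bound:
  assumes K: "\<And>v. norm v \<le> 1 \<Longrightarrow> norm (L (replicate (length bs) v)) \<le> K"
    and bs: "\<And>b. b \<in> set bs \<Longrightarrow> norm b \<le> 1"
  shows "norm (L bs) \<le> (2 * exp 1) ^ length bs * K"
proof -
  let ?m = "length bs"
  have "norm (L (replicate ?m 0)) \<le> K" by (rule K) simp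
  hence K0: "K \<ge> 0" by (rule order_trans[OF norm_ge_zero])
  have "norm (mixed_difference bs (\<lambda>v. L (replicate ?m v @ [])) 0) \<le> 2 ^ ?m * (real ?m ^ ?m * K)"
  proof (rule mixed_difference_bound)
    fix v :: 'v assume v: "norm v \<le> norm (0::'v) + ?m"
    show "norm (L (replicate ?m v @ [])) \<le> real ?m ^ ?m * K"
    proof (cases "?m = 0")
      case True thus ?thesis using K[of 0] by simp
    next
      case False
      let ?w = "(1 / ?m) *\<^sub>R v"
      have "norm (L (replicate ?m (real ?m *\<^sub>R ?w) @ [])) = real ?m ^ ?m * norm (L (replicate ?m ?w @ []))"
        by (subst replicate_scale) (simp add: norm_mult norm_power)
      moreover have "norm ?w \<le> 1" using v False by (simp add: divide_le_eq)
      moreover have "real ?m *\<^sub>R ?w = v" using False by simp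
      ultimately show ?thesis using K[of ?w] by (simp add: mult_left_mono)
    qed
  qed (use bs in auto)
  hence "norm (fact ?m * L bs) \<le> 2 ^ ?m * (real ?m ^ ?m * K)"
    by (subst (asm) mixed_difference_power) auto
  hence *: "fact ?m * norm (L bs) \<le> 2 ^ ?m * (real ?m ^ ?m * K)" by (simp add: norm_mult)
  have "norm (L bs) \<le> 2 ^ ?m * (real ?m ^ ?m / fact ?m) * K"
    using * by (simp add: field_simps)
  also have "\<dots> \<le> 2 ^ ?m * exp (real ?m) * K"
    using K0 by (intro mult_right_mono mult_left_mono power_div_fact_le_exp) auto
  also have "exp (real ?m) = exp 1 ^ ?m" by (simp add: exp_of_nat_mult[symmetric])
  finally show ?thesis by (simp add: power_mult_distrib)
qed

end

lemma pderivs_symmetric_form: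
  fixes f :: "real^'n \<Rightarrow> complex"
  assumes U: "open U" and f: "smooth_on U f" and x: "x \<in> U"
  shows "symmetric_form (\<lambda>vs. pderivs vs f x)"
proof
  fix u v :: "real^'n" and vs c
  have "pderivs vs f differentiable (at x)"
    using smooth_on_differentiable[OF smooth_on_pderivs[OF U f] U x] .
  then interpret linear "\<lambda>v. pderivs [v] (pderivs vs f) x" by (rule pderivs_single_linear)
  show "pderivs ((u + v) # vs) f x = pderivs (u # vs) f x + pderivs (v # vs) f x"
    using add[of u v] by simp
  show "pderivs ((c *\<^sub>R u) # vs) f x = of_real c * pderivs (u # vs) f x"
    using scale[of c u] by (simp add: scaleR_conv_of_real)
qed (rule pderivs_perm[OF U f x])

text \<open>Slots are expanded one at a time; \<open>bs\<close> collects those already replaced by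
  basis vectors, and d bounds the sum of the absolute coordinates.\<close>

lemma (in symmetric_form) Basis_bound:
  fixes K d :: real
  assumes "\<And>bs. set bs \<subseteq> B \<Longrightarrow> length bs = m \<Longrightarrow> norm (L bs) \<le> K" and "finite B"
    and rep: "\<And>v. v \<in> set vs \<Longrightarrow> \<exists>c. v = (\<Sum>b\<in>B. c b *\<^sub>R b) \<and> (\<Sum>b\<in>B. \<bar>c b\<bar>) \<le> d"
    and "length (vs @ bs) = m" "set bs \<subseteq> B" and d: "d \<ge> 0" "K \<ge> 0"
  shows "norm (L (vs @ bs)) \<le> d ^ length vs * K"
  using assms(3-5)
proof (induction vs arbitrary: bs)
  case Nil
  thus ?case using assms(1) by simp
next
  case (Cons v vs)
  obtain c where c: "v = (\<Sum>b\<in>B. c b *\<^sub>R b)" "(\<Sum>b\<in>B. \<bar>c b\<bar>) \<le> d" using Cons.prems(1)[of v] by auto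
  have 1: "norm (L (b # vs @ bs)) \<le> d ^ length vs * K" if "b \<in> B" for b
  proof -
    have "L (b # vs @ bs) = L (vs @ b # bs)" by (rule perm) simp
    thus ?thesis using Cons.IH[of "b # bs"] Cons.prems that by simp
  qed
  have "norm (L ((v # vs) @ bs)) \<le> (\<Sum>b\<in>B. \<bar>c b\<bar> * (d ^ length vs * K))"
    unfolding c(1) append_Cons sum[OF assms(2)]
    by (rule sum_norm_le) (auto simp: norm_mult intro!: mult_left_mono 1)
  also have "\<dots> = (\<Sum>b\<in>B. \<bar>c b\<bar>) * (d ^ length vs * K)" by (simp add: sum_distrib_right)
  also have "\<dots> \<le> d * (d ^ length vs * K)"
    using c(2) d by (intro mult_right_mono) auto
  finally show ?case by simp
qed

section \<open>Weight sequences of moderate growth\<close>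

locale log_convex_weight =
  fixes M \<mu> :: "nat \<Rightarrow> real"
  assumes mono: "mono \<mu>" and mu0: "\<mu> 0 = 1" and M: "\<And>k. M k = (\<Prod>i\<in>{1..k}. \<mu> i)"
begin

lemma mu_ge1: "\<mu> k \<ge> 1"
  using monoD[OF mono, of 0 k] mu0 by simp

lemma mu_nonneg: "\<mu> k \<ge> 0"
  using mu_ge1[of k] by simp

lemma M_0: "M 0 = 1" by (simp add: M)

lemma M_Suc: "M (Suc k) = M k * \<mu> (Suc k)"
  by (simp add: M mult.commute)

lemma M_pos: "M k > 0"
  unfolding M using mu_ge1 by (intro prod_pos) (smt (verit))

lemma M_ge1: "M k \<ge> 1"
  by (induction k) (auto simp: M_0 M_Suc mu_ge1 mult_ge1_I)

text \<open>This singles out 1/\<open>\<mu> N\<close> as the length scale on which the derivatives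
  up to order N stop growing like M.\<close>

lemma M_le_power: "i \<le> N \<Longrightarrow> M i \<le> \<mu> N ^ i"
proof (induction i)
  case (Suc i)
  have "\<mu> (Suc i) \<le> \<mu> N" using Suc.prems monoD[OF mono] by blast
  then have "M i * \<mu> (Suc i) \<le> \<mu> N ^ i * \<mu> N"
    using Suc mu_ge1 M_pos by (intro mult_mono) (auto intro: less_imp_le order_trans[OF zero_le_one])
  thus ?case by (simp add: M_Suc mult.commute)
qed (simp add: M_0)

lemma power_le_M_ratio: "\<mu> N ^ n * M N \<le> M (N + n)"
proof (induction n)
  case (Suc n)
  have "\<mu> N \<le> \<mu> (Suc (N + n))" using monoD[OF mono] by simp
  then have "(\<mu> N ^ n * M N) * \<mu> N \<le> M (N + n) * \<mu> (Suc (N + n))"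
    using Suc mu_ge1 M_pos by (intro mult_mono) (auto intro: less_imp_le order_trans[OF zero_le_one])
  thus ?case by (simp add: M_Suc mult_ac)
qed simp

lemma moderate_growth_iterate:
  assumes C: "C \<ge> 1" and mg: "\<And>j k. M (j + k) \<le> C ^ (j + k) * M j * M k"
  shows "M (K * n) \<le> C ^ (K * K * n) * M n ^ K"
proof (induction K)
  case (Suc K)
  have "M (Suc K * n) \<le> C ^ (n + K * n) * M n * M (K * n)" using mg[of n "K * n"] by simp
  also have "\<dots> \<le> C ^ (n + K * n) * M n * (C ^ (K * K * n) * M n ^ K)"
    using C M_pos by (intro mult_left_mono Suc mult_nonneg_nonneg) (auto intro: less_imp_le)
  also have "\<dots> = C ^ (n + K * n + K * K * n) * M n ^ Suc K" by (simp add: power_add)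
  also have "\<dots> \<le> C ^ (Suc K * Suc K * n) * M n ^ Suc K"
    using C M_pos by (intro mult_right_mono power_increasing) (auto intro: less_imp_le simp: algebra_simps)
  finally show ?case .
qed (simp add: M_0)

text \<open>Undoes the rescaling by \<open>\<mu> N\<close>. From \<open>power_le_M_ratio\<close> and
  moderate growth, \<mu>_N^N M_N \<le> M_(2N) \<le> C^(2N) M_N^2, so \<mu>_N^N is at most C^(2N)
  M_N. With N = K n, \<open>moderate_growth_iterate\<close> makes both sides K-th powers, and one
  last use of moderate growth passes from n = k+1 to k.\<close>

lemma moderate_growth_mu_power:
  assumes C: "C \<ge> 1" and mg: "\<And>j k. M (j + k) \<le> C ^ (j + k) * M j * M k" and K: "K \<ge> 1"
  shows "\<mu> (K * Suc k) ^ k \<le> (C ^ (3 + K) * M 1) ^ Suc k * M k"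
proof -
  let ?n = "Suc k" let ?N = "K * Suc k"
  have "\<mu> ?N ^ ?N * M ?N \<le> C ^ (?N + ?N) * M ?N * M ?N"
    using power_le_M_ratio[of ?N ?N] mg[of ?N ?N] by linarith
  hence "\<mu> ?N ^ ?N \<le> C ^ (?N + ?N) * M ?N" using M_pos[of ?N] by simp
  also have "\<dots> \<le> C ^ (?N + ?N) * (C ^ (K * K * ?n) * M ?n ^ K)"
    using C by (intro mult_left_mono moderate_growth_iterate[OF C mg]) auto
  also have "\<dots> = (C ^ ((2 + K) * ?n) * M ?n) ^ K"
    by (simp add: power_mult_distrib power_mult[symmetric] power_add[symmetric] algebra_simps)
  finally have "(\<mu> ?N ^ ?n) ^ K \<le> (C ^ ((2 + K) * ?n) * M ?n) ^ K"
    by (simp only: power_mult[symmetric] mult.commute[of K "Suc k"])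
  hence 1: "\<mu> ?N ^ ?n \<le> C ^ ((2 + K) * ?n) * M ?n"
    using K C M_pos[of ?n] by (subst (asm) power_mono_iff) (auto intro!: mult_nonneg_nonneg
        zero_le_power mu_nonneg)
  have "\<mu> ?N ^ k \<le> \<mu> ?N ^ ?n" using mu_ge1 by (intro power_increasing) auto
  also note 1
  also have "C ^ ((2 + K) * ?n) * M ?n \<le> C ^ ((2 + K) * ?n) * (C ^ ?n * M 1 * M k)"
    using mg[of 1 k] C by (intro mult_left_mono) auto
  also have "\<dots> = C ^ ((2 + K) * ?n + ?n) * M 1 * M k" by (simp only: power_add mult.assoc)
  also have "\<dots> = C ^ ((3 + K) * ?n) * M 1 * M k"
  proof -
    have "(2 + K) * ?n + ?n = (3 + K) * ?n" by (simp add: algebra_simps)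
    thus ?thesis by (simp only:)
  qed
  also have "\<dots> \<le> C ^ ((3 + K) * ?n) * M 1 ^ ?n * M k"
    using C M_ge1[of 1] M_pos[of k] power_increasing[of 1 ?n "M 1"]
    by (intro mult_right_mono mult_left_mono) auto
  also have "\<dots> = (C ^ (3 + K) * M 1) ^ Suc k * M k" by (simp only: power_mult_distrib power_mult)
  finally show ?thesis .
qed

end

section \<open>Recovering a number from two powers, and a linear coefficient from values\<close>

text \<open>Two consecutive powers determine a number as their quotient, so no branch of a root is
  chosen. If |z| exceeds 2 t, the difference is divided by z^j; otherwise both numbers are O(t). The
  hypothesis with exponent j+1 is the loss paid for the second case.\<close>

lemma two_powers_hoelder:
  fixes z w :: complex
  assumes t: "t \<ge> 0" and a: "norm (z ^ j - w ^ j) \<le> t ^ Suc j"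
      and b: "norm (z ^ Suc j - w ^ Suc j) \<le> t ^ Suc j"
  shows "norm (z - w) \<le> (5 + norm w) * t"
proof (cases "norm z \<le> 2 * t")
  case True
  have "norm w ^ Suc j \<le> norm z ^ Suc j + norm (z ^ Suc j - w ^ Suc j)"
    using norm_triangle_ineq2[of "w ^ Suc j" "z ^ Suc j"]
        by (simp add: norm_power norm_minus_commute norm_mult)
  also have "\<dots> \<le> (2 * t) ^ Suc j + t ^ Suc j" using True b by (intro add_mono power_mono) auto
  also have "\<dots> = (2 ^ Suc j + 1) * t ^ Suc j" by (simp only: power_mult_distrib distrib_right mult_1)
  also have "\<dots> \<le> 3 ^ Suc j * t ^ Suc j"
  proof (rule mult_right_mono)
    show "(2::real) ^ Suc j + 1 \<le> 3 ^ Suc j"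
    proof (induction j)
      case (Suc j)
      have "(0::real) \<le> 3 ^ j" by simp
      with Suc show ?case unfolding power_Suc by linarith
    qed simp
  qed (use t in auto)
  also have "\<dots> = (3 * t) ^ Suc j" by (simp only: power_mult_distrib)
  finally have "norm w \<le> 3 * t" using t by (subst (asm) power_mono_iff) auto
  moreover have "norm (z - w) \<le> norm z + norm w" by (rule norm_triangle_ineq4)
  moreover have "norm w * t \<ge> 0" using t by simp
  ultimately show ?thesis using True by (simp add: algebra_simps)
next
  case False
  hence z: "norm z > t" "norm z > 0" using t by auto
  have "(z - w) * z ^ j = (z ^ Suc j - w ^ Suc j) - w * (z ^ j - w ^ j)" by (simp add: algebra_simps)
  hence "norm (z - w) * norm z ^ j \<le> norm (z ^ Suc j - w ^ Suc j) + norm w * norm (z ^ j - w ^ j)"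
    by (metis norm_mult norm_power norm_triangle_ineq4)
  also have "\<dots> \<le> t ^ Suc j + norm w * t ^ Suc j" using a b by (intro add_mono mult_left_mono) auto
  also have "\<dots> = ((1 + norm w) * t) * t ^ j" by (simp add: algebra_simps)
  also have "\<dots> \<le> ((1 + norm w) * t) * norm z ^ j"
    using z t by (intro mult_left_mono power_mono) auto
  finally have "norm (z - w) \<le> (1 + norm w) * t" using z by (subst (asm) mult_le_cancel_right) auto
  also have "\<dots> \<le> (5 + norm w) * t" using t by (intro mult_right_mono) auto
  finally show ?thesis .
qed

text \<open>Passing from \<open>p\<close> to \<open>p - 2^(k+1) p(X/2)\<close> kills the top coefficient and changes the linear one by a factor of
  modulus at least 1.\<close>

lemma poly_linear_coeff_bound:
  "\<exists>C\<ge>0. \<forall>p::complex poly. \<forall>B. degree p \<le> k \<longrightarrow> (\<forall>t::real. \<bar>t\<bar> \<le> 1 \<longrightarrow> norm (poly p (of_real t)) \<le> B)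
     \<longrightarrow> norm (coeff p 1) \<le> C * B"
proof (induction k)
  case 0
  show ?case
  proof (intro exI[of _ 1] conjI allI impI)
    fix p :: "complex poly" and B :: real
    assume p: "degree p \<le> 0" and B: "\<forall>t::real. \<bar>t\<bar> \<le> 1 \<longrightarrow> norm (poly p (of_real t)) \<le> B"
    have "B \<ge> 0" using B[rule_format, of 0] norm_ge_zero order_trans by (metis abs_zero zero_le_one)
    thus "norm (coeff p 1) \<le> 1 * B" using p by (simp add: coeff_eq_0)
  qed auto
next
  case (Suc k)
  then obtain C where C: "C \<ge> 0" "\<And>p::complex poly. \<And>B. degree p \<le> k \<Longrightarrow> (\<forall>t::real. \<bar>t\<bar> \<le> 1
      \<longrightarrow> norm (poly p (of_real t)) \<le> B)
     \<Longrightarrow> norm (coeff p 1) \<le> C * B" by blast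
  show ?case
  \<comment> \<open>In degree one the linear coefficient is the top one and would be killed too; it
    is read off as p(1) - p(0).\<close>
  proof (cases "k = 0")
    case True
    show ?thesis
    proof (intro exI[of _ 2] conjI allI impI)
      fix p :: "complex poly" and B :: real
      assume p: "degree p \<le> Suc k" and B: "\<forall>t::real. \<bar>t\<bar> \<le> 1 \<longrightarrow> norm (poly p (of_real t)) \<le> B"
      have "poly p x = (\<Sum>i\<le>1. coeff p i * x ^ i)" for x
        unfolding poly_altdef using p True by (intro sum.mono_neutral_left) (auto simp: coeff_eq_0)
      hence "coeff p 1 = poly p (of_real 1) - poly p (of_real 0)" by simp
      also have "norm \<dots> \<le> B + B"
        using B[rule_format, of 1] B[rule_format, of 0] by (intro order_trans[OF norm_triangle_ineq4]) auto
      finally show "norm (coeff p 1) \<le> 2 * B" by simp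
    qed auto
  next
    case False
    show ?thesis
    proof (intro exI[of _ "C * (1 + 2 ^ Suc k)"] conjI allI impI)
      fix p :: "complex poly" and B :: real
      assume p: "degree p \<le> Suc k" and B: "\<forall>t::real. \<bar>t\<bar> \<le> 1 \<longrightarrow> norm (poly p (of_real t)) \<le> B"
      define q where "q = p - smult (2 ^ Suc k) (pcompose p [:0, 1/2:])"
      have cq: "coeff q i = coeff p i * (1 - 2 ^ Suc k * (1/2) ^ i)" for i
        by (simp add: q_def coeff_pcompose_linear algebra_simps)
      have "coeff q i = 0" if "i > k" for i
        using p that by (cases "i = Suc k") (auto simp: cq coeff_eq_0 power_divide)
      hence "degree q \<le> k" by (intro degree_le) auto
      moreover have "norm (poly q (of_real t)) \<le> (1 + 2 ^ Suc k) * B" if "\<bar>t\<bar> \<le> 1" for t :: real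
      proof -
        have "poly q (of_real t) = poly p (of_real t) - 2 ^ Suc k * poly p (of_real (t / 2))"
          by (simp add: q_def poly_pcompose)
        also have "norm \<dots> \<le> B + 2 ^ Suc k * B"
          using B[rule_format, of t] B[rule_format, of "t / 2"] that
          by (intro order_trans[OF norm_triangle_ineq4] add_mono) (auto simp: norm_mult norm_power)
        finally show ?thesis by (simp add: algebra_simps)
      qed
      ultimately have "norm (coeff q 1) \<le> C * ((1 + 2 ^ Suc k) * B)" using C(2) by blast
      moreover have "norm (coeff p 1) \<le> norm (coeff q 1)"
      proof -
        have "coeff q 1 = coeff p 1 * of_real (1 - 2 ^ k)" by (simp add: cq)
        moreover have "(2::real) ^ k \<ge> 2" using False power_increasing[of 1 k "2::real"] by simp
        hence "1 \<le> \<bar>1 - (2::real) ^ k\<bar>" by simp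
        ultimately show ?thesis by (simp only: norm_mult norm_of_real) (simp add: mult_left_le_imp_le
            mult_le_cancel_left1)
      qed
      ultimately show "norm (coeff p 1) \<le> C * (1 + 2 ^ Suc k) * B" by (simp add: mult.assoc)
    qed (use C in auto)
  qed
qed

section \<open>A converse of Taylor's theorem\<close>

text \<open>Differentiating a Taylor polynomial in direction b gives the Taylor polynomial of the
  derivative, one order lower. Expressed through coefficients, this lets a bound for values control
  derivatives.\<close>

lemma (in symmetric_form) taylor_linear_coeff:
  "\<exists>p :: complex poly. degree p \<le> k \<and>
    (\<forall>t. poly p (of_real t) = (\<Sum>m<Suc k. L (replicate m (t *\<^sub>R b + v)) / fact m)) \<and>
    coeff p 1 = (\<Sum>m<k. L (replicate m v @ [b]) / fact m)"
proof -
  define p where "p = (\<Sum>m<Suc k. \<Sum>i\<le>m. monom (of_nat (m choose i) * L (replicate i b @ replicate (m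
      - i) v) / fact m) i)"
  have 1: "degree p \<le> k" unfolding p_def
    by (intro degree_sum_le) (auto intro: order_trans[OF degree_monom_le])
  have 2: "poly p (of_real t) = (\<Sum>m<Suc k. L (replicate m (t *\<^sub>R b + v)) / fact m)" for t
  proof -
    have "L (replicate m (t *\<^sub>R b + v)) / fact m
       = (\<Sum>i\<le>m. poly (monom (of_nat (m choose i) * L (replicate i b @ replicate (m
           - i) v) / fact m) i) (of_real t))" for m
      using replicate_add[of m "t *\<^sub>R b" v "[]"]
      by (simp add: replicate_scale poly_monom sum_divide_distrib mult_ac)
    thus ?thesis by (simp only: p_def poly_sum)
  qed
  have "coeff p 1 = (\<Sum>m<Suc k. if m \<ge> 1 then of_nat m * L (b # replicate (m - 1) v) / fact m else 0)"
    unfolding p_def coeff_sum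
  proof (rule sum.cong)
    fix m
    show "(\<Sum>i\<le>m. coeff (monom (of_nat (m choose i) * L (replicate i b @ replicate (m - i) v) / fact m) i) 1)
        = (if m \<ge> 1 then of_nat m * L (b # replicate (m - 1) v) / fact m else 0)"
      by (simp add: coeff_monom)
  qed simp
  also have "\<dots> = (\<Sum>m<k. of_nat (Suc m) * L (b # replicate m v) / fact (Suc m))"
    by (subst sum.lessThan_Suc_shift) simp
  also have "\<dots> = (\<Sum>m<k. L (replicate m v @ [b]) / fact m)"
  proof (rule sum.cong)
    fix m
    have "L (b # replicate m v) = L (replicate m v @ [b])" by (rule perm) simp
    thus "of_nat (Suc m) * L (b # replicate m v) / fact (Suc m) = L (replicate m v @ [b]) / fact m"
      by (simp add: field_simps del: of_nat_Suc)
  qed simp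
  finally show ?thesis using 1 2 by blast
qed

lemma continuous_on_form_replicate:
  fixes L :: "'v::euclidean_space list \<Rightarrow> complex"
  assumes "symmetric_form L"
  shows "continuous_on UNIV (\<lambda>v. L (replicate m v @ ws))"
proof (induction m arbitrary: ws)
  case (Suc m)
  interpret symmetric_form L by fact
  have "L (replicate (Suc m) v @ ws) = (\<Sum>b\<in>Basis. of_real (v \<bullet> b) * L (replicate m v @ b # ws))" for v
  proof -
    have "L (replicate (Suc m) v @ ws) = L ((\<Sum>b\<in>Basis. (v \<bullet> b) *\<^sub>R b) # replicate m v @ ws)"
      by (simp add: euclidean_representation)
    also have "\<dots> = (\<Sum>b\<in>Basis. of_real (v \<bullet> b) * L (b # replicate m v @ ws))"
      by (rule sum) simp
    finally have "L (replicate (Suc m) v @ ws) = (\<Sum>b\<in>Basis. of_real (v \<bullet> b) * L (b # replicate m v @ ws))" .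
    moreover have "L (b # replicate m v @ ws) = L (replicate m v @ b # ws)" for b by (rule perm) simp
    ultimately show ?thesis by (simp only:)
  qed
  thus ?case by (simp only:) (intro continuous_intros Suc)
qed simp

text \<open>\<open>k\<close> counts terms: the degree is below k, and the matching remainder has
  order k.\<close>

definition taylor :: "(real^'n \<Rightarrow> complex) \<Rightarrow> real^'n \<Rightarrow> nat \<Rightarrow> real^'n \<Rightarrow> complex" where
  "taylor F x k v = (\<Sum>i<k. pderivs (replicate i v) F x / fact i)"

lemma continuous_on_taylor:
  fixes F :: "real^'n \<Rightarrow> complex"
  assumes "open W" "smooth_on W F" "x \<in> W"
  shows "continuous_on UNIV (taylor F x k)"
  unfolding taylor_def[abs_def]
  using continuous_on_form_replicate[OF pderivs_symmetric_form[OF assms], of _ "[]"]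
  by (intro continuous_intros) auto

lemma taylor_Suc_0:
  fixes F :: "real^'n \<Rightarrow> complex"
  assumes "open W" "smooth_on W F" "x \<in> W"
  shows "taylor F x (Suc k) 0 = F x"
proof -
  interpret symmetric_form "\<lambda>vs. pderivs vs F x" by (rule pderivs_symmetric_form[OF assms])
  have "pderivs (replicate (Suc i) 0) F x = 0" for i using scale[of 0 0 "replicate i 0"] by simp
  thus ?thesis unfolding taylor_def by (subst sum.lessThan_Suc_shift) (simp del: replicate_Suc)
qed

text \<open>Both points range over W, the set where derivatives are under control. The condition is
  uniform only on smaller balls and at small distances, since passing to a derivative needs room to
  move away from y; this form is stable under that passage.\<close>

definition taylor_approx :: "(real^'n) set \<Rightarrow> real \<Rightarrow> (real^'n \<Rightarrow> complex) \<Rightarrow> bool" where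
  "taylor_approx W r F \<longleftrightarrow> (\<forall>s<r. \<forall>k. \<exists>C \<delta>. C \<ge> 0 \<and> \<delta> > 0 \<and> (\<forall>x\<in>W \<inter> ball 0 s. \<forall>y\<in>W \<inter> ball 0 s.
     norm (y - x) < \<delta> \<longrightarrow> norm (F y - taylor F x (Suc k) (y - x)) \<le> C * norm (y - x) ^ Suc k))"

lemma taylor_approxD:
  assumes "taylor_approx W r F" "s < r"
  obtains C \<delta> where "C \<ge> 0" "\<delta> > 0" "\<And>x y. x \<in> W \<Longrightarrow> x \<in> ball 0 s \<Longrightarrow> y \<in> W \<Longrightarrow> y \<in> ball 0 s \<Longrightarrow> norm (y - x) < \<delta> \<Longrightarrow>
    norm (F y - taylor F x (Suc k) (y - x)) \<le> C * norm (y - x) ^ Suc k"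
  using assms unfolding taylor_approx_def by (metis Int_iff)

text \<open>The Taylor polynomials at \<open>x\<close> and \<open>y\<close> are close near \<open>y\<close>; comparing their linear coefficients in the
  direction \<open>b\<close> gives the Taylor estimate for the derivative.\<close>

lemma taylor_approx_pderivs_single:
  fixes F :: "real^'n \<Rightarrow> complex"
  assumes W: "open W" "ball 0 r \<subseteq> closure W" and F: "smooth_on W F" and b: "norm b \<le> 1"
    and ap: "taylor_approx W r F"
  shows "taylor_approx W r (pderivs [b] F)"
  unfolding taylor_approx_def
proof (intro allI impI)
  fix s' k assume s': "s' < r"
  define s where "s = (s' + r) / 2"
  have s: "s' < s" "s < r" using s' by (auto simp: s_def)
  obtain C \<delta> where C: "C \<ge> 0" "\<delta> > 0" "\<And>x y. x \<in> W \<Longrightarrow> x \<in> ball 0 s \<Longrightarrow> y \<in> W \<Longrightarrow> y \<in> ball 0 s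
      \<Longrightarrow> norm (y - x) < \<delta> \<Longrightarrow>
    norm (F y - taylor F x (Suc (Suc k)) (y - x)) \<le> C * norm (y - x) ^ Suc (Suc k)"
    using taylor_approxD[OF ap s(2)] by metis
  obtain E where E: "E \<ge> 0" "\<And>p::complex poly. \<And>B. degree p \<le> Suc k \<Longrightarrow> (\<forall>t::real. \<bar>t\<bar> \<le> 1
      \<longrightarrow> norm (poly p (of_real t)) \<le> B)
     \<Longrightarrow> norm (coeff p 1) \<le> E * B" using poly_linear_coeff_bound[of "Suc k"] by blast
  \<comment> \<open>The test points have distance at most \<open>\<rho>\<close> from y and at most 2
    \<open>\<rho>\<close> from x. The next line makes 2 \<open>\<rho>\<close> smaller than
    \<open>\<delta>\<close> and keeps the test points inside the ball of radius s.\<close>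
  define C' where "C' = C * (1 + 2 ^ Suc (Suc k))"
  define \<delta>' where "\<delta>' = min (\<delta> / 2) (s - s')"
  have main: "norm (pderivs [b] F y - taylor (pderivs [b] F) x (Suc k) (y - x))
      \<le> E * C' * norm (y - x) ^ Suc k"
    if x: "x \<in> W" "x \<in> ball 0 s'" and y: "y \<in> W" "y \<in> ball 0 s'" and xy: "norm (y - x) < \<delta>'" for x y
  proof (cases "y = x")
    case True
    thus ?thesis using taylor_Suc_0[OF W(1) smooth_on_pderivs[OF W(1) F, of "[b]"] x(1)] E C
      by (simp add: C'_def del: pderivs.simps)
  next
    case False
    define \<rho> where "\<rho> = norm (y - x)"
    have \<rho>: "\<rho> > 0" "\<rho> < \<delta> / 2" "\<rho> < s - s'" using False xy by (auto simp: \<rho>_def \<delta>'_def)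
    interpret X: symmetric_form "\<lambda>vs. pderivs vs F x" by (rule pderivs_symmetric_form[OF W(1) F x(1)])
    interpret Y: symmetric_form "\<lambda>vs. pderivs vs F y" by (rule pderivs_symmetric_form[OF W(1) F y(1)])
    obtain p where p0: "degree p \<le> Suc k"
        "\<And>t. poly p (of_real t) = (\<Sum>m<Suc (Suc k). pderivs (replicate m (t *\<^sub>R b + (y - x))) F x / fact m)"
        "coeff p 1 = (\<Sum>m<Suc k. pderivs (replicate m (y - x) @ [b]) F x / fact m)"
      using X.taylor_linear_coeff[of "Suc k" b "y - x"] by blast
    have p: "degree p \<le> Suc k" "\<And>t. poly p (of_real t) = taylor F x (Suc (Suc k)) (t *\<^sub>R b + (y - x))"
        "coeff p 1 = taylor (pderivs [b] F) x (Suc k) (y - x)"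
      unfolding taylor_def pderivs_append[symmetric] by (fact p0)+
    obtain q where q0: "degree q \<le> Suc k"
        "\<And>t. poly q (of_real t) = (\<Sum>m<Suc (Suc k). pderivs (replicate m (t *\<^sub>R b + (0))) F y / fact m)"
        "coeff q 1 = (\<Sum>m<Suc k. pderivs (replicate m (0) @ [b]) F y / fact m)"
      using Y.taylor_linear_coeff[of "Suc k" b "0"] by blast
    have q: "degree q \<le> Suc k" "\<And>t. poly q (of_real t) = taylor F y (Suc (Suc k)) (t *\<^sub>R b + (0))"
        "coeff q 1 = taylor (pderivs [b] F) y (Suc k) (0)"
      unfolding taylor_def pderivs_append[symmetric] by (fact q0)+
    have bd: "norm (poly p (of_real t) - poly q (of_real t)) \<le> C' * \<rho> ^ Suc (Suc k)" if t: "\<bar>t\<bar> \<le> \<rho>" for t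
    proof -
      define z where "z = y + t *\<^sub>R b"
      have nt: "norm (t *\<^sub>R b) \<le> \<rho>" using t b mult_mono[of "\<bar>t\<bar>" \<rho> "norm b" 1] \<rho> by simp
      have zy: "norm (z - y) \<le> \<rho>" using nt by (simp add: z_def)
      have zx: "norm (z - x) \<le> 2 * \<rho>"
        using nt norm_triangle_ineq[of "y - x" "t *\<^sub>R b"] by (simp add: z_def \<rho>_def algebra_simps)
      have "norm z < s" using norm_triangle_ineq[of y "t *\<^sub>R b"] nt y(2) \<rho> by (simp add: z_def)
      hence zs: "z \<in> ball 0 s" by simp
      moreover have "z \<in> closure W"
      proof (rule subsetD[OF W(2)])
        show "z \<in> ball 0 r" using zs s by simp
      qed
      ultimately have "z \<in> closure (ball 0 s \<inter> W)"
        using open_Int_closure_subset[of "ball 0 s" W] by auto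
      then obtain Z where Z: "\<And>n. Z n \<in> ball 0 s \<inter> W" "Z \<longlonglongrightarrow> z" by (auto simp: closure_sequential)
      have cT: "(\<lambda>n. taylor F u (Suc (Suc k)) (Z n - u)) \<longlonglongrightarrow> taylor F u (Suc (Suc k)) (z - u)"
          if "u \<in> W" for u
        using continuous_on_taylor[OF W(1) F that, of "Suc (Suc k)"]
        by (intro isCont_tendsto_compose[where g = "taylor F u (Suc (Suc k))"] tendsto_intros Z(2))
           (simp add: continuous_on_eq_continuous_at)
      have ev: "\<forall>\<^sub>F n in sequentially. norm (taylor F x (Suc (Suc k)) (Z n - x)
          - taylor F y (Suc (Suc k)) (Z n - y))
         \<le> C * norm (Z n - x) ^ Suc (Suc k) + C * norm (Z n - y) ^ Suc (Suc k)"
      proof -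
        have e: "\<forall>\<^sub>F n in sequentially. norm (Z n - u) < \<delta>" if "norm (z - u) < \<delta>" for u
          by (rule order_tendstoD(2)[OF _ that]) (intro tendsto_intros Z(2))
        have "\<forall>\<^sub>F n in sequentially. norm (Z n - x) < \<delta> \<and> norm (Z n - y) < \<delta>"
          using zx zy \<rho> by (intro eventually_conj e) auto
        thus ?thesis
        proof eventually_elim
          case (elim n)
          have "x \<in> ball 0 s" "y \<in> ball 0 s" using x y s by auto
          hence "norm (F (Z n) - taylor F y (Suc (Suc k)) (Z n - y)) \<le> C * norm (Z n - y) ^ Suc (Suc k)"
            "norm (F (Z n) - taylor F x (Suc (Suc k)) (Z n - x)) \<le> C * norm (Z n - x) ^ Suc (Suc k)"
            using Z(1)[of n] elim x y by (auto intro!: C(3) simp del: power_Suc)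
          from norm_triangle_le_diff[OF add_mono[OF this(1) this(2)]] show ?case by (simp add: add.commute)
        qed
      qed
      have "norm (taylor F x (Suc (Suc k)) (z - x) - taylor F y (Suc (Suc k)) (z - y))
         \<le> C * norm (z - x) ^ Suc (Suc k) + C * norm (z - y) ^ Suc (Suc k)"
        by (rule tendsto_le[OF _ _ _ ev]) (intro tendsto_intros cT x(1) y(1) Z(2)
            trivial_limit_sequentially)+
      also have "\<dots> \<le> C * (2 * \<rho>) ^ Suc (Suc k) + C * \<rho> ^ Suc (Suc k)"
        using zx zy C \<rho> by (intro add_mono mult_left_mono power_mono) auto
      also have "\<dots> = C' * \<rho> ^ Suc (Suc k)" by (simp only: C'_def power_mult_distrib) (simp add:
          algebra_simps)
      finally show ?thesis by (simp add: p q z_def algebra_simps)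
    qed
    \<comment> \<open>Rescaling to [-1, 1] multiplies the linear coefficient by
      \<open>\<rho>\<close>; cancelling it lowers the order of the estimate by exactly one.\<close>
    have dg: "degree (pcompose (p - q) [:0, of_real \<rho>:]) \<le> Suc k"
      using degree_pcompose_le[of "p - q" "[:0, of_real \<rho>:]"] degree_diff_le[OF p(1) q(1)]
          by (auto split: if_splits)
    have "norm (coeff (pcompose (p - q) [:0, of_real \<rho>:]) 1) \<le> E * (C' * \<rho> ^ Suc (Suc k))"
    proof (rule E(2)[OF dg], intro allI impI)
      fix t :: real assume t: "\<bar>t\<bar> \<le> 1"
      have "\<bar>t * \<rho>\<bar> \<le> \<rho>" using t \<rho> by (simp add: abs_mult)
      from bd[OF this] show "norm (poly (pcompose (p - q) [:0, of_real \<rho>:]) (of_real t))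
          \<le> C' * \<rho> ^ Suc (Suc k)"
        by (simp add: poly_pcompose)
    qed
    also have "coeff (pcompose (p - q) [:0, of_real \<rho>:]) 1 = of_real \<rho> * (coeff p 1 - coeff q 1)"
      by (simp add: coeff_pcompose_linear)
    finally have "\<rho> * norm (coeff p 1 - coeff q 1) \<le> \<rho> * (E * C' * \<rho> ^ Suc k)"
      using \<rho> by (simp add: norm_mult mult_ac)
    hence "norm (coeff p 1 - coeff q 1) \<le> E * C' * \<rho> ^ Suc k" using \<rho> by simp
    moreover have "coeff q 1 = pderivs [b] F y"
      unfolding q(3) by (rule taylor_Suc_0[OF W(1) smooth_on_pderivs[OF W(1) F] y(1)])
    ultimately have "norm (taylor (pderivs [b] F) x (Suc k) (y - x) - pderivs [b] F y) \<le> E * C' * \<rho> ^ Suc k"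
      by (simp only: p(3))
    thus ?thesis by (simp only: norm_minus_commute[of "pderivs [b] F y"] \<rho>_def)
  qed
  show "\<exists>C \<delta>. C \<ge> 0 \<and> \<delta> > 0 \<and> (\<forall>x\<in>W \<inter> ball 0 s'. \<forall>y\<in>W \<inter> ball 0 s'.
     norm (y - x) < \<delta> \<longrightarrow> norm (pderivs [b] F y - taylor (pderivs [b] F) x (Suc k) (y - x))
         \<le> C * norm (y - x) ^ Suc k)"
    using main C E s by (intro exI[of _ "E * C'"] exI[of _ \<delta>']) (auto simp: \<delta>'_def C'_def simp del:
        pderivs.simps power_Suc)
qed

lemma has_derivative_of_quadratic_approx:
  fixes f :: "'a::real_normed_vector \<Rightarrow> 'b::real_normed_vector"
  assumes L: "bounded_linear L" and d: "\<delta> > 0"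
    and bd: "\<And>y. norm (y - x) < \<delta> \<Longrightarrow> norm (f y - f x - L (y - x)) \<le> C * norm (y - x) ^ 2"
  shows "(f has_derivative L) (at x)"
  unfolding has_derivative_at_alt
proof (intro conjI L allI impI)
  fix e :: real assume e: "e > 0"
  define d' where "d' = min \<delta> (e / (\<bar>C\<bar> + 1))"
  have "d' > 0" using d e by (auto simp: d'_def intro!: divide_pos_pos)
  moreover have "norm (f y - f x - L (y - x)) \<le> e * norm (y - x)" if y: "norm (y - x) < d'" for y
  proof -
    have "norm (f y - f x - L (y - x)) \<le> C * norm (y - x) ^ 2" using bd y by (simp add: d'_def)
    also have "\<dots> \<le> (\<bar>C\<bar> + 1) * norm (y - x) * norm (y - x)"
      by (simp add: power2_eq_square mult.assoc mult_right_mono)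
    also have "\<dots> \<le> e * norm (y - x)"
    proof (rule mult_right_mono)
      have "norm (y - x) \<le> e / (\<bar>C\<bar> + 1)" using y by (simp add: d'_def)
      thus "(\<bar>C\<bar> + 1) * norm (y - x) \<le> e" by (simp add: field_simps)
    qed simp
    finally show ?thesis .
  qed
  ultimately show "\<exists>d>0. \<forall>y. norm (y - x) < d \<longrightarrow> norm (f y - f x - L (y - x)) \<le> e * norm (y - x)" by blast
qed

lemma taylor_approx_pderivs:
  fixes F :: "real^'n \<Rightarrow> complex"
  assumes W: "open W" "ball 0 r \<subseteq> closure W" and F: "smooth_on W F"
    and ap: "taylor_approx W r F" and bs: "set bs \<subseteq> Basis"
  shows "taylor_approx W r (pderivs bs F)"
  using bs
proof (induction bs)
  case (Cons b bs)
  have "taylor_approx W r (pderivs [b] (pderivs bs F))"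
    using Cons by (intro taylor_approx_pderivs_single[OF W] smooth_on_pderivs[OF W(1) F]) auto
  thus ?case by simp
qed (use ap in simp)

lemma taylor_1: "taylor F x (Suc 0) v = F x"
  by (simp add: taylor_def)

lemma taylor_2: "taylor F x (Suc (Suc 0)) v = F x + pderivs [v] F x"
  by (simp add: taylor_def)

text \<open>The derivatives on W form a field of Whitney type on a dense set: they extend
  continuously, and the extension of each one is differentiable with the extensions of the next as
  its partial derivatives. Pointwise bounds pass to the limit, which is the second
  conclusion.\<close>

proposition smooth_on_ball_if_taylor_approx:
  fixes f :: "real^'n \<Rightarrow> complex"
  assumes W: "open W" "W \<subseteq> ball 0 r" "ball 0 r \<subseteq> closure W" and f: "smooth_on W f"
    and base: "\<And>k. \<exists>C\<ge>0. \<forall>x\<in>W. \<forall>y\<in>ball 0 r. norm (f y - taylor f x (Suc k) (y - x))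
        \<le> C * norm (y - x) ^ Suc k"
    and s: "s < r"
  shows "smooth_on (ball 0 s) f"
    and "\<And>bs K x. set bs \<subseteq> Basis \<Longrightarrow> (\<And>y. y \<in> W \<Longrightarrow> norm (pderivs bs f y) \<le> K) \<Longrightarrow> x \<in> ball 0 s
        \<Longrightarrow> norm (pderivs bs f x) \<le> K"
proof -
  define X where "X = W \<inter> ball 0 s"
  have XW: "X \<subseteq> W" by (auto simp: X_def)
  have "taylor_approx W r f"
    unfolding taylor_approx_def
  proof (intro allI impI)
    fix s k assume "s < r"
    obtain C where C: "C \<ge> 0" "\<forall>x\<in>W. \<forall>y\<in>ball 0 r. norm (f y - taylor f x (Suc k) (y - x))
        \<le> C * norm (y - x) ^ Suc k"
      using base by blast
    have "ball (0 :: real^'n) s \<subseteq> ball 0 r" using \<open>s < r\<close> by auto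
    with C W(2) show "\<exists>C \<delta>. C \<ge> 0 \<and> \<delta> > 0 \<and> (\<forall>x\<in>W \<inter> ball 0 s. \<forall>y\<in>W \<inter> ball 0 s.
     norm (y - x) < \<delta> \<longrightarrow> norm (f y - taylor f x (Suc k) (y - x)) \<le> C * norm (y - x) ^ Suc k)"
      by (intro exI[of _ C] exI[of _ 1]) auto
  qed
  hence ap: "taylor_approx W r (pderivs bs f)" if "set bs \<subseteq> Basis" for bs
    using taylor_approx_pderivs[OF W(1,3) f _ that] by blast
  have dense: "\<exists>Z. (\<forall>n. Z n \<in> X) \<and> Z \<longlonglongrightarrow> x" if "x \<in> ball 0 s" for x
  proof -
    have "x \<in> ball 0 s \<inter> closure W" using that s W(3) by auto
    hence "x \<in> closure X" using open_Int_closure_subset[of "ball 0 s" W] by (auto simp: X_def Int_commute)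
    thus ?thesis by (simp add: closure_sequential)
  qed
  \<comment> \<open>The one-term Taylor estimate is a Lipschitz bound at small distances, hence
    gives uniform continuity on X.\<close>
  have "\<exists>g. continuous_on (closure X) g \<and> (\<forall>x\<in>X. pderivs bs f x = g x)" if bs: "set bs \<subseteq> Basis" for bs
  proof -
    obtain C \<delta> where C: "C \<ge> 0" "\<delta> > 0" "\<And>x y. x \<in> W \<Longrightarrow> x \<in> ball 0 s \<Longrightarrow> y \<in> W \<Longrightarrow> y \<in> ball 0 s
        \<Longrightarrow> norm (y - x) < \<delta> \<Longrightarrow>
      norm (pderivs bs f y - taylor (pderivs bs f) x (Suc 0) (y - x)) \<le> C * norm (y - x) ^ Suc 0"
      using taylor_approxD[OF ap[OF bs] s, of 0] by blast
    have "uniformly_continuous_on X (pderivs bs f)"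
      unfolding uniformly_continuous_on_def
    proof (intro allI impI)
      fix e :: real assume e: "e > 0"
      define d where "d = min \<delta> (e / (C + 1))"
      have "d > 0" using e C by (simp add: d_def)
      moreover have "dist (pderivs bs f y) (pderivs bs f x) < e" if "x \<in> X" "y \<in> X" "dist y x < d" for x y
      proof -
        have "norm (pderivs bs f y - pderivs bs f x) \<le> C * norm (y - x)"
          using C(3)[of x y] that by (auto simp: X_def d_def dist_norm taylor_1)
        also have "\<dots> \<le> C * (e / (C + 1))" using that C
            by (intro mult_left_mono) (auto simp: d_def dist_norm)
        also have "\<dots> < e" using C e by (simp add: field_simps)
        finally show ?thesis by (simp add: dist_norm)
      qed
      ultimately show "\<exists>d>0. \<forall>x\<in>X. \<forall>x'\<in>X. dist x' x < d
          \<longrightarrow> dist (pderivs bs f x') (pderivs bs f x) < e" by blast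
    qed
    thus ?thesis
    proof (rule uniformly_continuous_on_extension_on_closure)
      fix g assume "uniformly_continuous_on (closure X) g" "\<And>x. x \<in> X \<Longrightarrow> pderivs bs f x = g x"
      thus ?thesis by (intro exI[of _ g] conjI ballI uniformly_continuous_imp_continuous)
    qed
  qed
  then obtain a where a: "\<And>bs. set bs \<subseteq> Basis \<Longrightarrow> continuous_on (closure X) (a bs)"
      "\<And>bs x. set bs \<subseteq> Basis \<Longrightarrow> x \<in> X \<Longrightarrow> pderivs bs f x = a bs x" by metis
  have lim: "(\<lambda>n. pderivs bs f (Z n)) \<longlonglongrightarrow> a bs x"
    if "set bs \<subseteq> Basis" "\<And>n. Z n \<in> X" "Z \<longlonglongrightarrow> x" for bs Z x
  proof -
    have "x \<in> closure X" using that(2,3) closure_sequential by blast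
    hence "(\<lambda>n. a bs (Z n)) \<longlonglongrightarrow> a bs x"
      using a(1)[OF that(1)] that(2,3) closure_subset[of X]
      by (auto simp: continuous_on_sequentially o_def)
    thus ?thesis using a(2)[OF that(1) that(2)] by simp
  qed
  \<comment> \<open>The two-term estimate holds along sequences in X tending to y and to x. Its
    limit is a quadratic remainder at points outside W too.\<close>
  have der: "(a bs has_derivative (\<lambda>v. \<Sum>b\<in>Basis. of_real (v \<bullet> b) * a (b # bs) x)) (at x)"
    if bs: "set bs \<subseteq> Basis" and x: "x \<in> ball 0 s" for bs x
  proof -
    obtain C \<delta> where C: "C \<ge> 0" "\<delta> > 0" "\<And>x y. x \<in> W \<Longrightarrow> x \<in> ball 0 s \<Longrightarrow> y \<in> W \<Longrightarrow> y \<in> ball 0 s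
        \<Longrightarrow> norm (y - x) < \<delta> \<Longrightarrow>
      norm (pderivs bs f y - taylor (pderivs bs f) x (Suc (Suc 0)) (y - x))
          \<le> C * norm (y - x) ^ Suc (Suc 0)"
      using taylor_approxD[OF ap[OF bs] s, of "Suc 0"] by blast
    let ?L = "\<lambda>v. \<Sum>b\<in>Basis. of_real (v \<bullet> b) * a (b # bs) x"
    show ?thesis
    proof (rule has_derivative_of_quadratic_approx[where \<delta> = "min \<delta> (s - norm x)" and C = C])
      show "bounded_linear ?L"
        by (intro bounded_linear_sum bounded_linear_mult_const bounded_linear_compose[OF
            bounded_linear_of_real] bounded_linear_inner_left)
      show "0 < min \<delta> (s - norm x)" using C x by simp
      fix y assume y: "norm (y - x) < min \<delta> (s - norm x)"
      have "norm y < s" using y norm_triangle_ineq[of x "y - x"] by simp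
      then obtain Y Z where Y: "\<And>n. Y n \<in> X" "Y \<longlonglongrightarrow> y" and Z: "\<And>n. Z n \<in> X" "Z \<longlonglongrightarrow> x"
        using dense[of y] dense[OF x] by auto
      have "\<forall>\<^sub>F n in sequentially. norm (Y n - Z n) < \<delta>"
        by (rule order_tendstoD(2)[where y = "norm (y
            - x)"]) (use y in \<open>auto intro!: tendsto_intros Y(2) Z(2)\<close>)
      hence ev: "\<forall>\<^sub>F n in sequentially. norm (pderivs bs f (Y n) - pderivs bs f (Z n) -
         (\<Sum>b\<in>Basis. of_real ((Y n - Z n) \<bullet> b) * pderivs (b # bs) f (Z n))) \<le> C * norm (Y n - Z n) ^ 2"
      proof eventually_elim
        case (elim n)
        have "pderivs bs f differentiable (at (Z n))"
          using Z(1) XW by (intro smooth_on_differentiable[OF smooth_on_pderivs[OF W(1) f] W(1)]) auto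
        from pderivs_single_Basis_expansion[OF this, of "Y n - Z n"]
        have "taylor (pderivs bs f) (Z n) (Suc (Suc 0)) (Y n - Z n)
           = pderivs bs f (Z n) + (\<Sum>b\<in>Basis. of_real ((Y n - Z n) \<bullet> b) * pderivs (b # bs) f (Z n))"
          by (simp add: taylor_2 scaleR_conv_of_real)
        thus ?case using C(3)[of "Z n" "Y n"] Y(1)[of n] Z(1)[of n] elim
          by (simp add: X_def diff_diff_add power2_eq_square del: pderivs.simps)
      qed
      have t3: "(\<lambda>n. pderivs (b # bs) f (Z n)) \<longlonglongrightarrow> a (b # bs) x" if "b \<in> Basis" for b
        using that bs by (intro lim[OF _ Z]) simp
      have l: "(\<lambda>n. norm (pderivs bs f (Y n) - pderivs bs f (Z n) -
         (\<Sum>b\<in>Basis. of_real ((Y n - Z n) \<bullet> b) * pderivs (b # bs) f (Z n))))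
             \<longlonglongrightarrow> norm (a bs y - a bs x - ?L (y - x))"
        by (intro tendsto_norm tendsto_diff tendsto_sum tendsto_mult tendsto_of_real tendsto_inner
            tendsto_const
             lim[OF bs Y] lim[OF bs Z] t3 Y(2) Z(2))
      have r: "(\<lambda>n. C * norm (Y n - Z n) ^ 2) \<longlonglongrightarrow> C * norm (y - x) ^ 2"
        by (intro tendsto_norm tendsto_diff tendsto_mult tendsto_power tendsto_const Y(2) Z(2))
      show "norm (a bs y - a bs x - ?L (y - x)) \<le> C * norm (y - x) ^ 2"
        by (rule tendsto_le[OF trivial_limit_sequentially r l ev])
    qed
  qed
  \<comment> \<open>Here \<open>base\<close> is used with y outside W: it forces f itself, and not
    merely its restriction to W, to agree with the continuous extension.\<close>
  have a0: "a [] x = f x" if x: "x \<in> ball 0 s" for x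
  proof -
    obtain Z where Z: "\<And>n. Z n \<in> X" "Z \<longlonglongrightarrow> x" using dense[OF x] by blast
    obtain C where C: "C \<ge> 0" "\<forall>x\<in>W. \<forall>y\<in>ball 0 r. norm (f y - taylor f x (Suc 0) (y - x))
        \<le> C * norm (y - x) ^ Suc 0"
      using base by blast
    have xr: "x \<in> ball 0 r" using x s by simp
    have le: "norm (f (Z n) - f x) \<le> C * norm (x - Z n)" for n
    proof -
      have "norm (f x - taylor f (Z n) (Suc 0) (x - Z n)) \<le> C * norm (x - Z n) ^ Suc 0"
        using C(2) Z(1)[of n] XW xr by blast
      thus ?thesis by (simp only: taylor_1 norm_minus_commute[of "f x"] power_Suc power_0 mult_1_right)
    qed
    have "(\<lambda>n. C * norm (x - Z n)) \<longlonglongrightarrow> C * norm (x - x)" by (intro tendsto_intros Z(2))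
    hence t: "(\<lambda>n. C * norm (x - Z n)) \<longlonglongrightarrow> 0" by simp
    have "(\<lambda>n. f (Z n) - f x) \<longlonglongrightarrow> 0"
      by (rule Lim_null_comparison[OF always_eventually t]) (use le in blast)
    hence "(\<lambda>n. f (Z n)) \<longlonglongrightarrow> f x" by (simp add: LIM_zero_iff)
    moreover have "(\<lambda>n. f (Z n)) \<longlonglongrightarrow> a [] x" using lim[of "[]" Z x] Z by simp
    ultimately show ?thesis using LIMSEQ_unique by blast
  qed
  have pd: "pderivs bs f x = a bs x" if "set bs \<subseteq> Basis" "x \<in> ball 0 s" for bs x
    using that
  proof (induction bs arbitrary: x)
    case (Cons b bs)
    have "pderivs (b # bs) f x = pderivs [b] (pderivs bs f) x" by simp
    also have "\<dots> = pderivs [b] (a bs) x"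
      by (rule pderivs_cong_open[of "ball 0 s"]) (use Cons in auto)
    also have "\<dots> = (\<Sum>b'\<in>Basis. of_real (b \<bullet> b') * a (b' # bs) x)"
      using Cons.prems by (intro pderivs_single_eq der) auto
    also have "\<dots> = (\<Sum>b'\<in>Basis. if b' = b then a (b # bs) x else 0)"
      using Cons.prems by (intro sum.cong) (auto simp: inner_Basis)
    also have "\<dots> = a (b # bs) x" using Cons.prems by simp
    finally show ?case .
  qed (use a0 in simp)
  show "smooth_on (ball 0 s) f"
    unfolding smooth_on_def
  proof (intro allI impI)
    fix bs :: "(real^'n) list" assume bs: "set bs \<subseteq> Basis"
    have "a bs differentiable_on ball 0 s"
      using der[OF bs] unfolding differentiable_on_eq_differentiable_at[OF open_ball] differentiable_def
          by blast
    thus "pderivs bs f differentiable_on ball 0 s"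
      by (rule differentiable_on_cong_open[OF open_ball, rotated]) (simp add: pd[OF bs])
  qed
  fix bs :: "(real^'n) list" and K and x :: "real^'n"
  assume bs: "set bs \<subseteq> Basis" and K: "\<And>y. y \<in> W \<Longrightarrow> norm (pderivs bs f y) \<le> K" and x: "x \<in> ball 0 s"
  obtain Z where Z: "\<And>n. Z n \<in> X" "Z \<longlonglongrightarrow> x" using dense[OF x] by blast
  have "norm (a bs x) \<le> K"
    by (rule tendsto_upperbound[OF tendsto_norm[OF lim[OF bs Z]] _ trivial_limit_sequentially])
       (intro always_eventually allI K subsetD[OF XW] Z(1))
  thus "norm (pderivs bs f x) \<le> K" using pd[OF bs x] by simp
qed

section \<open>Taylor series of powers\<close>

lemma pderivs_replicate_mult:
  fixes F G :: "real^'n \<Rightarrow> complex"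
  assumes W: "open W" and F: "smooth_on W F" and G: "smooth_on W G" and "x \<in> W"
  shows "pderivs (replicate m e) (\<lambda>x. F x * G x) x
     = (\<Sum>i\<le>m. of_nat (m choose i) * (pderivs (replicate i e) F x * pderivs (replicate (m - i) e) G x))"
  using assms(4)
proof (induction m arbitrary: x)
  case (Suc m)
  let ?F = "\<lambda>i. pderivs (replicate i e) F" let ?G = "\<lambda>i. pderivs (replicate i e) G"
  have dF: "(?F i has_derivative frechet_derivative (?F i) (at x)) (at x)" for i
    using smooth_on_differentiable[OF smooth_on_pderivs[OF W F] W Suc.prems]
        by (simp add: frechet_derivative_works)
  have dG: "(?G i has_derivative frechet_derivative (?G i) (at x)) (at x)" for i
    using smooth_on_differentiable[OF smooth_on_pderivs[OF W G] W Suc.prems]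
        by (simp add: frechet_derivative_works)
  have "pderivs (replicate (Suc m) e) (\<lambda>x. F x * G x) x
     = pderivs [e] (pderivs (replicate m e) (\<lambda>x. F x * G x)) x"
    by simp
  also have "\<dots> = pderivs [e] (\<lambda>x. \<Sum>i\<le>m. of_nat (m choose i) * (?F i x * ?G (m - i) x)) x"
    by (rule pderivs_cong_open[OF W Suc.prems Suc.IH])
  also have "\<dots> = (\<Sum>i\<le>m. of_nat (m choose i) * (?F i x * ?G (Suc (m - i)) x + ?F (Suc i) x * ?G (m - i) x))"
  proof -
    have "((\<lambda>x. \<Sum>i\<le>m. of_nat (m choose i) * (?F i x * ?G (m - i) x)) has_derivative
       (\<lambda>h. \<Sum>i\<le>m. of_nat (m choose i) * (?F i x * frechet_derivative (?G (m - i)) (at x) h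
           + frechet_derivative (?F i) (at x) h * ?G (m - i) x))) (at x)"
      by (intro has_derivative_sum has_derivative_mult_right has_derivative_mult dF dG)
    from pderivs_single_eq[OF this, of e] show ?thesis by simp
  qed
  also have "\<dots> = (\<Sum>i\<le>m. of_nat (m choose i) * (?F (Suc i) x * ?G (m - i) x))
      + (\<Sum>i\<le>m. of_nat (m choose i) * (?F i x * ?G (Suc m - i) x))"
    by (simp add: sum.distrib[symmetric] algebra_simps Suc_diff_le del: pderivs.simps cong: sum.cong_simp)
  also have "(\<Sum>i\<le>m. of_nat (m choose i) * (?F i x * ?G (Suc m - i) x))
      = ?F 0 x * ?G (Suc m) x + (\<Sum>i\<le>m. of_nat (m choose Suc i) * (?F (Suc i) x * ?G (m - i) x))"
  proof -
    have "(\<Sum>i\<le>m. of_nat (m choose i) * (?F i x * ?G (Suc m - i) x))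
        = (\<Sum>i\<le>Suc m. of_nat (m choose i) * (?F i x * ?G (Suc m - i) x))"
      by (intro sum.mono_neutral_left) (auto simp: not_le)
    also have "\<dots> = ?F 0 x * ?G (Suc m) x + (\<Sum>i\<le>m. of_nat (m choose Suc i) * (?F (Suc i) x * ?G (m - i) x))"
      by (subst sum.atMost_Suc_shift) simp
    finally show ?thesis .
  qed
  also have "(\<Sum>i\<le>m. of_nat (m choose i) * (?F (Suc i) x * ?G (m - i) x))
      + (?F 0 x * ?G (Suc m) x + (\<Sum>i\<le>m. of_nat (m choose Suc i) * (?F (Suc i) x * ?G (m - i) x)))
     = ?F 0 x * ?G (Suc m) x + (\<Sum>i\<le>m. of_nat (Suc m choose Suc i) * (?F (Suc i) x * ?G (m - i) x))"
    by (simp add: sum.distrib[symmetric] algebra_simps del: pderivs.simps replicate_Suc)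
  also have "\<dots> = (\<Sum>i\<le>Suc m. of_nat (Suc m choose i) * (?F i x * ?G (Suc m - i) x))"
    by (subst sum.atMost_Suc_shift) simp
  finally show ?case .
qed simp

definition taylor_fps :: "(real^'n \<Rightarrow> complex) \<Rightarrow> real^'n \<Rightarrow> real^'n \<Rightarrow> complex fps" where
  "taylor_fps F x e = Abs_fps (\<lambda>i. pderivs (replicate i e) F x / fact i)"

lemma taylor_fps_nth: "fps_nth (taylor_fps F x e) i = pderivs (replicate i e) F x / fact i"
  by (simp add: taylor_fps_def)

lemma taylor_fps_mult:
  fixes F G :: "real^'n \<Rightarrow> complex"
  assumes W: "open W" "smooth_on W F" "smooth_on W G" "x \<in> W"
  shows "taylor_fps (\<lambda>x. F x * G x) x e = taylor_fps F x e * taylor_fps G x e"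
proof (rule fps_ext)
  fix m
  have "of_nat (m choose i) * (a * b) / fact m = a / fact i * (b / fact (m - i))" if "i \<le> m" for i
      and a b :: complex
    using that by (simp add: binomial_fact field_simps)
  thus "fps_nth (taylor_fps (\<lambda>x. F x * G x) x e) m = fps_nth (taylor_fps F x e * taylor_fps G x e) m"
    by (simp add: taylor_fps_nth fps_mult_nth pderivs_replicate_mult[OF W] sum_divide_distrib
        atLeast0AtMost)
qed

lemma smooth_on_power:
  assumes "open U" "smooth_on U f" shows "smooth_on U (\<lambda>x. f x ^ j)"
  by (induction j) (auto intro: smooth_on_const smooth_on_mult assms)

lemma pderivs_zero_fun: "pderivs bs (\<lambda>x. 0::complex) = (\<lambda>x. 0)"
  by (induction bs) (auto simp: frechet_derivative_const)

lemma taylor_fps_power: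
  fixes F :: "real^'n \<Rightarrow> complex"
  assumes W: "open W" "smooth_on W F" "x \<in> W"
  shows "taylor_fps (\<lambda>x. F x ^ j) x e = taylor_fps F x e ^ j"
proof (induction j)
  case 0
  have "pderivs (replicate i e) (\<lambda>x. 1) x = (if i = 0 then 1 else 0)" for i
  proof (cases i)
    case (Suc k)
    have "pderivs (replicate k e @ [e]) (\<lambda>x. 1::complex) x = pderivs (replicate k e) (\<lambda>x. 0) x"
      unfolding pderivs_append by (rule pderivs_cong_open[OF W(1) W(3)]) (simp add:
          frechet_derivative_const)
    thus ?thesis using Suc by (simp add: pderivs_zero_fun replicate_append_same del: pderivs.simps)
  qed simp
  thus ?case by (intro fps_ext) (simp add: taylor_fps_nth)
next
  case (Suc j)
  thus ?case using taylor_fps_mult[OF W(1,2) smooth_on_power[OF W(1,2)] W(3)] by simp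
qed

section \<open>Truncated power series and the coefficient bound from two powers\<close>

definition fps_trunc_poly :: "nat \<Rightarrow> complex fps \<Rightarrow> complex poly" where
  "fps_trunc_poly N A = (\<Sum>i<N. monom (fps_nth A i) i)"

lemma coeff_fps_trunc_poly: "coeff (fps_trunc_poly N A) i = (if i < N then fps_nth A i else 0)"
  by (simp add: fps_trunc_poly_def coeff_sum coeff_monom)

lemma poly_fps_trunc_poly: "poly (fps_trunc_poly N A) z = (\<Sum>i<N. fps_nth A i * z ^ i)"
  by (simp add: fps_trunc_poly_def poly_sum poly_monom)

lemma fps_nth_mult_cong:
  assumes "\<And>i. i < N \<Longrightarrow> fps_nth A i = fps_nth A' i" "\<And>i. i < N \<Longrightarrow> fps_nth B i = fps_nth B' i" "i < N"
  shows "fps_nth (A * B) i = fps_nth (A' * B') i"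
  unfolding fps_mult_nth by (intro sum.cong refl arg_cong2[where f = "(*)"] assms) (use assms(3) in auto)

lemma fps_nth_power_cong:
  assumes "\<And>i. i < N \<Longrightarrow> fps_nth A i = fps_nth A' i" "i < N"
  shows "fps_nth (A ^ j) i = fps_nth (A' ^ j) i"
  using assms(2)
proof (induction j arbitrary: i)
  case (Suc j)
  show ?case unfolding power_Suc by (rule fps_nth_mult_cong[OF assms(1) Suc.IH Suc.prems])
qed simp

lemma fps_of_poly_trunc_nth: "i < N \<Longrightarrow> fps_nth (fps_of_poly (fps_trunc_poly N A)) i = fps_nth A i"
  by (simp add: coeff_fps_trunc_poly)

lemma norm_poly_le_coeff_sum:
  assumes "\<And>i. i < N \<Longrightarrow> norm (fps_nth A i) \<le> a i" and "norm z \<le> 1"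
  shows "norm (poly (fps_trunc_poly N A) z) \<le> (\<Sum>i<N. a i)"
  unfolding poly_fps_trunc_poly
proof (rule sum_norm_le)
  fix i assume "i \<in> {..<N}"
  hence "norm (fps_nth A i) * norm z ^ i \<le> a i * 1"
    using assms norm_ge_zero order_trans by (intro mult_mono power_le_one) (auto intro: order_trans[OF
        norm_ge_zero])
  thus "norm (fps_nth A i * z ^ i) \<le> a i" by (simp add: norm_mult norm_power)
qed

lemma pderiv_sum: "pderiv (\<Sum>i\<in>A. f i) = (\<Sum>i\<in>A. pderiv (f i))"
  by (induction A rule: infinite_finite_induct) (auto simp: pderiv_add)

lemma norm_poly_pderiv_le_coeff_sum:
  assumes "\<And>i. i < N \<Longrightarrow> norm (fps_nth A i) \<le> a i" and "norm z \<le> 1"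
  shows "norm (poly (pderiv (fps_trunc_poly N A)) z) \<le> N * (\<Sum>i<N. a i)"
proof -
  have "pderiv (fps_trunc_poly N A) = (\<Sum>i<N. monom (of_nat i * fps_nth A i) (i - 1))"
    by (simp add: fps_trunc_poly_def pderiv_sum pderiv_monom)
  hence "poly (pderiv (fps_trunc_poly N A)) z = (\<Sum>i<N. of_nat i * fps_nth A i * z ^ (i - 1))"
    by (simp add: poly_sum poly_monom)
  also have "norm \<dots> \<le> (\<Sum>i<N. N * a i)"
  proof (rule sum_norm_le)
    fix i assume i: "i \<in> {..<N}"
    have "a i \<ge> 0" using assms(1)[of i] i order_trans[OF norm_ge_zero] by blast
    hence "real i * norm (fps_nth A i) * norm z ^ (i - 1) \<le> real N * a i * 1"
      using assms i by (intro mult_mono power_le_one) auto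
    thus "norm (of_nat i * fps_nth A i * z ^ (i - 1)) \<le> N * a i" by (simp add: norm_mult norm_power)
  qed
  finally show ?thesis by (simp add: sum_distrib_left)
qed

text \<open>There is no lower bound on the constant coefficient of \<open>\<Phi>\<close> in this estimate; that it may be arbitrarily small is
  the reason why more than \<open>k\<close> coefficients of the powers are needed.\<close>

proposition fps_coeff_bound_of_powers:
  fixes \<Phi> :: "complex fps"
  assumes j: "j \<ge> 1" and \<Phi>0: "fps_nth \<Phi> 0 \<noteq> 0" and N: "N = j * Suc k * Suc j"
    and G: "\<And>i. i < N \<Longrightarrow> norm (fps_nth (\<Phi> ^ j) i) \<le> a i"
    and H: "\<And>i. i < N \<Longrightarrow> norm (fps_nth (\<Phi> ^ Suc j) i) \<le> a i"
    and S: "(\<Sum>i<N. a i) \<le> S" "S \<ge> 1"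
  shows "norm (fps_nth \<Phi> k) \<le> (20 * N\<^sup>2) * S ^ (2 * Suc j)"
proof -
  let ?b = "j * Suc k"
  define p where "p = fps_trunc_poly N (\<Phi> ^ j)"
  define q where "q = fps_trunc_poly N (\<Phi> ^ Suc j)"
  define T where "T = fps_trunc_poly (Suc k) \<Phi>"
  have Nk: "Suc k \<le> N" "?b \<le> N" unfolding N using j by (cases j; simp)+
  have N1: "real N \<ge> 1" using Nk by simp
  have np: "norm (poly p z) \<le> S" "norm (poly q z) \<le> S" "norm (poly (pderiv p) z) \<le> N * S"
      if "norm z \<le> 1" for z
  proof -
    have "norm (poly p z) \<le> (\<Sum>i<N. a i)" "norm (poly q z) \<le> (\<Sum>i<N. a i)"
      unfolding p_def q_def by (rule norm_poly_le_coeff_sum[OF _ that], rule G H, assumption)+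
    thus "norm (poly p z) \<le> S" "norm (poly q z) \<le> S" using S(1) by linarith+
    have "norm (poly (pderiv p) z) \<le> N * (\<Sum>i<N. a i)"
      unfolding p_def by (rule norm_poly_pderiv_le_coeff_sum[OF _ that], rule G)
    also have "\<dots> \<le> N * S" using S by (intro mult_left_mono) auto
    finally show "norm (poly (pderiv p) z) \<le> N * S" .
  qed
  \<comment> \<open>Before truncation both powers are \<open>\<Phi>\<close> to the exponent j (j+1),
    and truncation at N leaves the coefficients below N unchanged.\<close>
  have zero: "coeff (p ^ Suc j - q ^ j) i = 0" if "i < N" for i
  proof -
    have "coeff (p ^ Suc j) i = fps_nth (fps_of_poly p ^ Suc j) i"
        by (simp only: fps_of_poly_power[symmetric] fps_of_poly_nth)
    also have "\<dots> = fps_nth ((\<Phi> ^ j) ^ Suc j) i"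
      by (rule fps_nth_power_cong[OF _ that]) (simp only: p_def fps_of_poly_trunc_nth)
    also have "(\<Phi> ^ j) ^ Suc j = (\<Phi> ^ Suc j) ^ j" by (simp only: power_mult[symmetric] mult.commute)
    also have "fps_nth ((\<Phi> ^ Suc j) ^ j) i = fps_nth (fps_of_poly q ^ j) i"
      by (rule fps_nth_power_cong[OF _ that]) (simp only: q_def fps_of_poly_trunc_nth)
    also have "\<dots> = coeff (q ^ j) i" by (simp only: fps_of_poly_power[symmetric] fps_of_poly_nth)
    finally show ?thesis by simp
  qed
  \<comment> \<open>Bounds |p|^(j+1) + |q|^j on the unit circle; the Schwarz lemma turns this into
    an error D |z|^N with N = b (j+1), as \<open>approximate_root_coeff_bound\<close>
    requires.\<close>
  define D where "D = 2 * S ^ Suc j"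
  have SS: "S \<le> S ^ Suc j" "S ^ j \<le> S ^ Suc j"
      using S(2) power_increasing[of 1 "Suc j" S] power_increasing[of j "Suc j" S] by auto
  have D: "D \<ge> 1" using S(2) one_le_power[of S "Suc j"] unfolding D_def by linarith
  have bound: "norm (poly (p ^ Suc j - q ^ j) z) \<le> D" if "norm z = 1" for z
  proof -
    have "norm (poly p z) ^ Suc j \<le> S ^ Suc j" "norm (poly q z) ^ j \<le> S ^ j" using np that
        by (auto intro!: power_mono simp del: power_Suc)
    thus ?thesis unfolding D_def using SS norm_triangle_ineq4[of "poly p z ^ Suc j" "poly q z ^ j"]
      by (simp only: poly_diff poly_power norm_power)
  qed
  have pq: "norm (poly q z) ^ j \<le> norm (poly p z) ^ Suc j + D * norm z ^ (?b * Suc j)"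
      if z: "norm z \<le> 1" for z
  proof -
    have "norm (poly (p ^ Suc j - q ^ j) z) \<le> D * norm z ^ N"
      by (rule poly_div_monom_bound[OF zero bound z])
    thus ?thesis unfolding N using norm_triangle_ineq2[of "poly q z ^ j" "poly p z ^ Suc j"]
      by (simp only: poly_diff poly_power norm_power norm_minus_commute[of "poly p z ^ Suc j"])
  qed
  have dvd: "monom 1 (Suc k) dvd q - p * T"
    unfolding monom_1_dvd_iff'
  proof (intro allI impI)
    fix i assume i: "i < Suc k"
    have iN: "i < N" using i Nk by linarith
    have "coeff (p * T) i = fps_nth (fps_of_poly p * fps_of_poly T) i"
        by (simp only: fps_of_poly_mult[symmetric] fps_of_poly_nth)
    also have "\<dots> = fps_nth (\<Phi> ^ j * \<Phi>) i"
      by (rule fps_nth_mult_cong[OF _ _ i])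
        (use Nk in \<open>auto simp: p_def T_def coeff_fps_trunc_poly\<close>)
    also have "\<Phi> ^ j * \<Phi> = \<Phi> ^ Suc j" by simp
    also have "fps_nth (\<Phi> ^ Suc j) i = coeff q i" using iN
        by (simp only: q_def coeff_fps_trunc_poly if_True)
    finally show "coeff (q - p * T) i = 0" by simp
  qed
  have p0: "poly p 0 \<noteq> 0"
  proof -
    have "poly p 0 = fps_nth (\<Phi> ^ j) 0" using Nk by (simp add: p_def poly_0_coeff_0 coeff_fps_trunc_poly)
    thus ?thesis using \<Phi>0 by (simp add: fps_power_zeroth)
  qed
  have NS: "S \<le> N * S" using N1 S by (simp add: mult_le_cancel_right1)
  have dT: "degree T \<le> k" by (rule degree_le) (auto simp: T_def coeff_fps_trunc_poly)
  \<comment> \<open>B is taken as N S because the derivative of p costs a factor N.\<close>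
  have main: "norm (coeff T k) \<le> N * S + (N * S)\<^sup>2 + ?b + 2 * D\<^sup>2"
  proof (rule approximate_root_coeff_bound[OF j refl D _ dT dvd p0 pq])
    show "0 \<le> real N * S" using S by simp
    fix z :: complex assume "norm z = 1"
    hence z: "norm z \<le> 1" by simp
    show "norm (poly p z) \<le> N * S" "norm (poly q z) \<le> N * S" "norm (poly (pderiv p) z) \<le> N * S"
      using np[OF z] NS by linarith+
  qed
  \<comment> \<open>The four terms are at most 1, 1, 1 and 8 times ?Q; the constant 20 leaves
    slack.\<close>
  let ?Q = "real N ^ 2 * S ^ (2 * Suc j)"
  have NN: "real N \<le> real N ^ 2" "1 \<le> real N ^ 2" using N1 by (auto simp: power2_eq_square mult_ge1_I)
  have S2: "S \<le> S ^ (2 * Suc j)" "S\<^sup>2 \<le> S ^ (2 * Suc j)" "1 \<le> S ^ (2 * Suc j)"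
    using S(2) power_increasing[of 1 "2 * Suc j" S] power_increasing[of 2 "2
        * Suc j" S] one_le_power[of S "2 * Suc j"] by auto
  have "N * S \<le> ?Q" using NN S2 S(2) by (intro mult_mono) auto
  moreover have "(N * S)\<^sup>2 \<le> ?Q" unfolding power_mult_distrib using S2 by (intro mult_left_mono) auto
  moreover have "real ?b \<le> ?Q"
  proof -
    have "real ?b \<le> real N * 1" using Nk(2) by (simp only: mult_1_right of_nat_le_iff)
    also have "\<dots> \<le> ?Q" using NN S2 by (intro mult_mono) auto
    finally show ?thesis .
  qed
  moreover have "2 * D\<^sup>2 \<le> 8 * ?Q"
  proof -
    have "2 * D\<^sup>2 = 8 * (1 * S ^ (2 * Suc j))"
        by (simp only: D_def power_mult_distrib power_mult[symmetric] mult.commute[of 2 "Suc j"]) simp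
    also have "\<dots> \<le> 8 * ?Q" using NN S2 by (intro mult_left_mono mult_right_mono) auto
    finally show ?thesis .
  qed
  moreover have "?Q \<ge> 0" using S by simp
  ultimately have "norm (coeff T k) \<le> 20 * ?Q" using main by linarith
  thus ?thesis by (simp add: T_def coeff_fps_trunc_poly)
qed

section \<open>Expansions along lines and directional derivatives where f does not vanish\<close>

lemma poly_fps_trunc_taylor_fps:
  fixes F :: "real^'n \<Rightarrow> complex"
  assumes "open W" "smooth_on W F" "x \<in> W"
  shows "taylor F x k (t *\<^sub>R e) = poly (fps_trunc_poly k (taylor_fps F x e)) (of_real t)"
proof -
  interpret symmetric_form "\<lambda>vs. pderivs vs F x" by (rule pderivs_symmetric_form[OF assms])
  have "pderivs (replicate i (t *\<^sub>R e)) F x = of_real t ^ i * pderivs (replicate i e) F x" for i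
    using replicate_scale[of i t e "[]"] by simp
  thus ?thesis by (simp add: taylor_def poly_fps_trunc_poly taylor_fps_nth mult.commute)
qed

lemma taylor_remainder_bound:
  fixes F :: "real^'n \<Rightarrow> complex"
  assumes U: "open U" "convex U" and F: "smooth_on U F" and x: "x \<in> U" "x + \<rho> *\<^sub>R e \<in> U"
    and \<rho>: "\<rho> \<ge> 0" and m: "m \<ge> 1" and B: "\<And>z. z \<in> U \<Longrightarrow> norm (pderivs (replicate m e) F z) \<le> B"
  shows "norm (F (x + \<rho> *\<^sub>R e) - poly (fps_trunc_poly m (taylor_fps F x e)) (of_real \<rho>)) \<le> B * \<rho> ^ m"
proof -
  define Df where "Df i t = pderivs (replicate i e) F (x + t *\<^sub>R e)" for i t
  have B0: "B \<ge> 0" using B[OF x(1)] norm_ge_zero order_trans by blast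
  have inU: "x + t *\<^sub>R e \<in> U" if "0 \<le> t" "t \<le> \<rho>" for t
  proof (cases "\<rho> = 0")
    case False
    have "(1 - t / \<rho>) *\<^sub>R x + (t / \<rho>) *\<^sub>R (x + \<rho> *\<^sub>R e) \<in> U"
      using that False \<rho> x by (intro convexD[OF U(2)]) (auto simp: divide_le_eq)
    also have "(1 - t / \<rho>) *\<^sub>R x + (t / \<rho>) *\<^sub>R (x + \<rho> *\<^sub>R e) = x + t *\<^sub>R e"
      using False by (simp add: algebra_simps)
    finally show ?thesis .
  qed (use that x in auto)
  have "((\<lambda>t. ((\<rho> - t) ^ (m - 1) / fact (m - 1)) *\<^sub>R Df m t) has_integral
      Df 0 \<rho> - (\<Sum>i<m. ((\<rho> - 0) ^ i / fact i) *\<^sub>R Df i 0)) {0..\<rho>}"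
  proof (rule Taylor_has_integral)
    fix i t assume t: "i < m" "0 \<le> t" "t \<le> \<rho>"
    have "pderivs (replicate i e) F differentiable (at (x + t *\<^sub>R e))"
      using smooth_on_differentiable[OF smooth_on_pderivs[OF U(1) F] U(1) inU[OF t(2,3)]] .
    from has_vector_derivative_along_line[OF this]
    show "(Df i has_vector_derivative Df (Suc i) t) (at t within {0..\<rho>})"
      unfolding Df_def by simp
  qed (use m \<rho> in auto)
  hence "norm (Df 0 \<rho> - (\<Sum>i<m. ((\<rho> - 0) ^ i / fact i) *\<^sub>R Df i 0))
      \<le> (\<rho> ^ (m - 1) * B) * measure lborel {0..\<rho>}"
  proof (rule has_integral_bound_real[where S = "{}", rotated 2])
    fix t assume "t \<in> {0..\<rho>} - {}"
    hence t: "t \<in> {0..\<rho>}" by simp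
    \<comment> \<open>The factorial is given up; only the order in \<open>\<rho>\<close> matters for
      the remainder.\<close>
    have "(\<rho> - t) ^ (m - 1) / fact (m - 1) \<le> \<rho> ^ (m - 1) / 1"
      using t by (intro frac_le power_mono) auto
    hence "\<bar>(\<rho> - t) ^ (m - 1) / fact (m - 1)\<bar> * norm (Df m t) \<le> \<rho> ^ (m - 1) * B"
      using t B[OF inU[of t]] \<rho> by (intro mult_mono) (auto simp: Df_def)
    thus "norm (((\<rho> - t) ^ (m - 1) / fact (m - 1)) *\<^sub>R Df m t) \<le> \<rho> ^ (m - 1) * B" by simp
  qed (use \<rho> B0 in auto)
  also have "\<dots> = B * \<rho> ^ m" using \<rho> m by (cases m) (auto simp: mult_ac)
  also have "(\<Sum>i<m. ((\<rho> - 0) ^ i / fact i) *\<^sub>R Df i 0)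
      = poly (fps_trunc_poly m (taylor_fps F x e)) (of_real \<rho>)"
    by (simp add: poly_fps_trunc_poly taylor_fps_nth Df_def scaleR_conv_of_real mult_ac)
  finally show ?thesis by (simp add: Df_def)
qed

lemma sum_abs_inner_Basis_le: "(\<Sum>b\<in>Basis. \<bar>v \<bullet> b\<bar>) \<le> DIM('a) * norm (v :: 'a::euclidean_space)"
  using sum_bounded_above[of Basis "\<lambda>b. \<bar>v \<bullet> b\<bar>" "norm v"] by (simp add: Basis_le_norm)

text \<open>The absolute coordinates of a vector of norm at most 1 sum to at most the dimension,
  which is the cost per slot.\<close>

lemma pderivs_bound_unit_directions:
  fixes F :: "real^'n \<Rightarrow> complex"
  assumes "open W" "smooth_on W F" "x \<in> W" and K: "\<And>bs. set bs \<subseteq> Basis \<Longrightarrow> length bs = m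
      \<Longrightarrow> norm (pderivs bs F x) \<le> K"
    and e: "norm e \<le> 1" and "K \<ge> 0"
  shows "norm (pderivs (replicate m e) F x) \<le> real CARD('n) ^ m * K"
proof -
  interpret symmetric_form "\<lambda>vs. pderivs vs F x" by (rule pderivs_symmetric_form[OF assms(1-3)])
  have "norm (pderivs (replicate m e @ []) F x) \<le> real CARD('n) ^ length (replicate m e) * K"
  proof (rule Basis_bound[OF K finite_Basis])
    fix v assume "v \<in> set (replicate m e)"
    hence "v = e" by (simp split: if_splits)
    moreover have "real CARD('n) * norm e \<le> real CARD('n) * 1" using e by (intro mult_left_mono) auto
    moreover have "(\<Sum>b\<in>Basis. \<bar>e \<bullet> b\<bar>) \<le> real CARD('n) * norm e"
      using sum_abs_inner_Basis_le[of e] by simp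
    ultimately have "(\<Sum>b\<in>Basis. \<bar>v \<bullet> b\<bar>) \<le> real CARD('n)" by (simp only: mult_1_right)
    thus "\<exists>c. v = (\<Sum>b\<in>Basis. c b *\<^sub>R b) \<and> (\<Sum>b\<in>Basis. \<bar>c b\<bar>) \<le> real CARD('n)"
      by (intro exI[of _ "\<lambda>b. v \<bullet> b"]) (simp add: euclidean_representation)
  qed (use assms in auto)
  thus ?thesis by simp
qed

lemma sum_power_div_fact_le_exp: "x \<ge> 0 \<Longrightarrow> (\<Sum>i<N. x ^ i / fact i) \<le> exp (x::real)"
proof -
  assume x: "x \<ge> 0"
  have s: "(\<lambda>n. x ^ n /\<^sub>R fact n) sums exp x" by (rule exp_converges)
  have "(\<Sum>i<N. x ^ i /\<^sub>R fact i) \<le> (\<Sum>i. x ^ i /\<^sub>R fact i)"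
    using x by (intro sum_le_suminf sums_summable[OF s]) auto
  thus ?thesis using sums_unique[OF s] by (simp add: divide_inverse mult.commute)
qed

text \<open>The constants do not involve |f x|, so the estimate is uniform up to the zero set. It is
  obtained for each k separately, at a scale that depends on k.\<close>

lemma (in log_convex_weight) directional_derivative_bound:
  fixes f :: "real^'n \<Rightarrow> complex" and A C S :: real
  assumes C: "C \<ge> 1" and mg: "\<And>j k. M (j + k) \<le> C ^ (j + k) * M j * M k"
    and j: "j \<ge> 1" and A: "A \<ge> 1" and S: "S \<ge> 1"
  defines "K \<equiv> j * Suc j"
  defines "S' \<equiv> 4 * (C ^ (3 + K) * M 1) * exp (S * (2 * Suc j))"
  assumes W: "open W" and f: "smooth_on W f" and x: "x \<in> W" and fx: "f x \<noteq> 0" and e: "norm e \<le> 1"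
    and g: "\<And>i. norm (pderivs (replicate i e) (\<lambda>x. f x ^ j) x) \<le> A * S ^ i * M i"
    and h: "\<And>i. norm (pderivs (replicate i e) (\<lambda>x. f x ^ Suc j) x) \<le> A * S ^ i * M i"
  shows "norm (pderivs (replicate k e) f x) \<le> (20 * (real K)\<^sup>2 * A ^ (2 * Suc j) * S') * S' ^ k * M k"
proof -
  define n where "n = Suc k"
  define N where "N = K * n"
  \<comment> \<open>At the scale 1/\<open>\<mu> N\<close> the coefficients would still carry 1/i!,
    so there is room for a scale n times larger: their sum grows to exp(S n), which is geometric in
    k. In return the factor k! of the k-th derivative is absorbed, since k!/\<open>\<tau>\<close>^k
    is at most \<open>\<mu> N\<close>^k.\<close>
  define \<tau> where "\<tau> = n / \<mu> N"
  define a where "a i = A * ((S * n) ^ i / fact i)" for i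
  have K1: "K \<ge> 1" using j by (simp add: K_def)
  have \<mu>N: "\<mu> N > 0" using mu_ge1[of N] by linarith
  have \<tau>: "\<tau> > 0" using \<mu>N by (simp add: \<tau>_def n_def)
  have sc: "pderivs (replicate i (\<tau> *\<^sub>R e)) F x = of_real \<tau> ^ i * pderivs (replicate i e) F x"
      if "smooth_on W F" for i F
  proof -
    interpret symmetric_form "\<lambda>vs. pderivs vs F x" by (rule pderivs_symmetric_form[OF W that x])
    show ?thesis using replicate_scale[of i \<tau> e "[]"] by simp
  qed
  have coef: "norm (fps_nth (taylor_fps F x (\<tau> *\<^sub>R e)) i) \<le> a i"
    if "smooth_on W F" "norm (pderivs (replicate i e) F x) \<le> A * S ^ i * M i" "i < N" for F i
  proof -
    have "norm (fps_nth (taylor_fps F x (\<tau> *\<^sub>R e)) i) = \<tau> ^ i * norm (pderivs (replicate i e) F x) / fact i"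
      using \<tau> by (simp add: taylor_fps_nth sc[OF that(1)] norm_divide norm_mult norm_power)
    also have "\<dots> \<le> \<tau> ^ i * (A * S ^ i * \<mu> N ^ i) / fact i"
    proof (intro divide_right_mono mult_left_mono)
      have "A * S ^ i * M i \<le> A * S ^ i * \<mu> N ^ i"
        using M_le_power[of i N] that(3) A S by (intro mult_left_mono) auto
      thus "norm (pderivs (replicate i e) F x) \<le> A * S ^ i * \<mu> N ^ i" using that(2) by linarith
    qed (use \<tau> in auto)
    also have "\<dots> = A * (S * (\<tau> * \<mu> N)) ^ i / fact i" by (simp add: power_mult_distrib mult_ac)
    also have "\<tau> * \<mu> N = n" using \<mu>N by (simp add: \<tau>_def)
    finally show ?thesis by (simp add: a_def)
  qed
  have "norm (fps_nth (taylor_fps f x (\<tau> *\<^sub>R e)) k) \<le> (20 * (real N)\<^sup>2) * (A * exp (S * n)) ^ (2 * Suc j)"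
  proof (rule fps_coeff_bound_of_powers[OF j])
    show "fps_nth (taylor_fps f x (\<tau> *\<^sub>R e)) 0 \<noteq> 0" using fx by (simp add: taylor_fps_nth)
    show "N = j * Suc k * Suc j" by (simp add: N_def K_def n_def algebra_simps)
    show "norm (fps_nth (taylor_fps f x (\<tau> *\<^sub>R e) ^ j) i) \<le> a i" if "i < N" for i
      unfolding taylor_fps_power[OF W f x, symmetric]
      by (rule coef[OF smooth_on_power[OF W f] g that])
    show "norm (fps_nth (taylor_fps f x (\<tau> *\<^sub>R e) ^ Suc j) i) \<le> a i" if "i < N" for i
      unfolding taylor_fps_power[OF W f x, symmetric]
      by (rule coef[OF smooth_on_power[OF W f] h that])
    show "(\<Sum>i<N. a i) \<le> A * exp (S * n)"
      unfolding a_def sum_distrib_left[symmetric] using A S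
          by (intro mult_left_mono sum_power_div_fact_le_exp) auto
    have "1 * 1 \<le> A * exp (S * n)" using A S by (intro mult_mono) auto
    thus "1 \<le> A * exp (S * n)" by simp
  qed
  hence "\<tau> ^ k * norm (pderivs (replicate k e) f x) / fact k
      \<le> (20 * (real N)\<^sup>2) * (A * exp (S * n)) ^ (2 * Suc j)"
    using \<tau> by (simp add: taylor_fps_nth sc[OF f] norm_divide norm_mult norm_power del: power_Suc)
  hence 1: "norm (pderivs (replicate k e) f x)
      \<le> (fact k / \<tau> ^ k) * ((20 * (real N)\<^sup>2) * (A * exp (S * n)) ^ (2 * Suc j))"
    using \<tau> by (simp add: field_simps del: power_Suc)
  have F1: "fact k / \<tau> ^ k \<le> (C ^ (3 + K) * M 1) ^ n * M k"
  proof -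
    have "(fact k :: real) \<le> real n ^ k"
    proof -
      have "(fact k :: real) \<le> real (k ^ k)" by (rule fact_le_power)
      also have "\<dots> \<le> real n ^ k" by (simp add: n_def power_mono)
      finally show ?thesis .
    qed
    hence "fact k / \<tau> ^ k \<le> real n ^ k / \<tau> ^ k" using \<tau> by (intro divide_right_mono) auto
    also have "\<dots> = \<mu> N ^ k" using \<mu>N by (simp add: \<tau>_def power_divide n_def)
    also have "\<dots> \<le> (C ^ (3 + K) * M 1) ^ n * M k"
      unfolding N_def n_def by (rule moderate_growth_mu_power[OF C mg K1])
    finally show ?thesis .
  qed
  \<comment> \<open>Everything polynomial in n is made geometric: n^2 is at most 4^n, the origin of
    the 4 in \<open>S'\<close>.\<close>
  have F2: "20 * (real N)\<^sup>2 * (A * exp (S * n)) ^ (2 * Suc j)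
      \<le> (20 * (real K)\<^sup>2 * A ^ (2 * Suc j)) * (4 * exp (S * (2 * Suc j))) ^ n"
  proof -
    have "(real n)\<^sup>2 \<le> (2 ^ n)\<^sup>2" by (intro power_mono) (auto intro: less_imp_le)
    also have "\<dots> = (2\<^sup>2) ^ n" by (simp only: power_mult[symmetric] mult.commute[of n 2])
    also have "\<dots> = 4 ^ n" by simp
    finally have n4: "(real n)\<^sup>2 \<le> 4 ^ n" .
    have "20 * (real N)\<^sup>2 * (A * exp (S * n)) ^ (2 * Suc j)
        = (20 * (real K)\<^sup>2 * A ^ (2 * Suc j)) * ((real n)\<^sup>2 * exp (S * n) ^ (2 * Suc j))"
      unfolding N_def of_nat_mult of_nat_power power_mult_distrib by (simp only: mult_ac)
    also have "exp (S * n) ^ (2 * Suc j) = exp (S * (2 * Suc j)) ^ n"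
    proof -
      have "exp (S * n) ^ (2 * Suc j) = exp (real (2 * Suc j) * (S * n))"
          by (rule exp_of_nat_mult[symmetric])
      also have "real (2 * Suc j) * (S * n) = real n * (S * (2 * Suc j))" by (simp only: mult_ac)
      also have "exp \<dots> = exp (S * (2 * Suc j)) ^ n" by (rule exp_of_nat_mult)
      finally show ?thesis .
    qed
    also have "(real n)\<^sup>2 * exp (S * (2 * Suc j)) ^ n \<le> 4 ^ n * exp (S * (2 * Suc j)) ^ n"
      using n4 by (intro mult_right_mono) auto
    also have "\<dots> = (4 * exp (S * (2 * Suc j))) ^ n" by (simp only: power_mult_distrib)
    finally show ?thesis using A by (simp add: mult_left_mono)
  qed
  have "(fact k / \<tau> ^ k) * ((20 * (real N)\<^sup>2) * (A * exp (S * n)) ^ (2 * Suc j))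
     \<le> ((C ^ (3 + K) * M 1) ^ n * M k) * ((20 * (real K)\<^sup>2 * A ^ (2 * Suc j)) * (4 * exp (S * (2
         * Suc j))) ^ n)"
  proof (rule mult_mono[OF F1 F2])
    show "0 \<le> (C ^ (3 + K) * M 1) ^ n * M k" using C M_pos[of 1] M_pos[of k] by simp
    show "0 \<le> 20 * (real N)\<^sup>2 * (A * exp (S * n)) ^ (2 * Suc j)"
      using A by (intro mult_nonneg_nonneg zero_le_power) auto
  qed
  also have "\<dots> = (20 * (real K)\<^sup>2 * A ^ (2 * Suc j)) * S' ^ n * M k"
    unfolding S'_def power_mult_distrib by (simp only: mult_ac)
  also have "\<dots> = (20 * (real K)\<^sup>2 * A ^ (2 * Suc j) * S') * S' ^ k * M k"
    unfolding n_def power_Suc by (simp only: mult_ac)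
  finally show ?thesis using 1 by linarith
qed

section \<open>Property (D)\<close>

text \<open>Halving the radius pays for the converse of Taylor's theorem. Radius at most 1/2 keeps
  two points within distance 1, where the unit disc bounds for polynomials apply.\<close>

lemma (in log_convex_weight) smooth_of_powers:
  fixes f :: "real^'n \<Rightarrow> complex" and A S r :: real
  assumes mg: "moderate_growth M" and j: "j \<ge> 1" and r: "0 < r" "r \<le> 1 / 2" and A: "A \<ge> 1" and S: "S \<ge> 1"
    and g: "smooth_on (ball 0 r) (\<lambda>x. f x ^ j)" and h: "smooth_on (ball 0 r) (\<lambda>x. f x ^ Suc j)"
    and bg: "\<And>bs x. set bs \<subseteq> Basis \<Longrightarrow> x \<in> ball 0 r
        \<Longrightarrow> norm (pderivs bs (\<lambda>x. f x ^ j) x) \<le> A * S ^ length bs * M (length bs)"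
    and bh: "\<And>bs x. set bs \<subseteq> Basis \<Longrightarrow> x \<in> ball 0 r
        \<Longrightarrow> norm (pderivs bs (\<lambda>x. f x ^ Suc j) x) \<le> A * S ^ length bs * M (length bs)"
  shows "\<exists>A' S' :: real. S' > 0 \<and> smooth_on (ball 0 (r / 2)) f \<and>
    (\<forall>bs. \<forall>x\<in>ball 0 (r / 2). set bs \<subseteq> Basis \<longrightarrow> norm (pderivs bs f x) \<le> A' * S' ^ length bs * M (length bs))"
proof -
  let ?U = "ball (0 :: real^'n) r"
  obtain C0 where C0: "\<And>j k. M (j + k) \<le> C0 ^ (j + k) * M j * M k" "C0 > 0"
    using mg by (auto simp: moderate_growth_def)
  define C where "C = max C0 1"
  have C: "C \<ge> 1" by (simp add: C_def)
  have mgC: "M (j + k) \<le> C ^ (j + k) * M j * M k" for j k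
  proof -
    have "C0 ^ (j + k) * M j * M k \<le> C ^ (j + k) * M j * M k"
      using C0(2) M_pos[of j] M_pos[of k] by (intro mult_right_mono power_mono) (auto simp: C_def)
    thus ?thesis using C0(1)[of j k] by linarith
  qed
  define S1 where "S1 = real CARD('n) * S"
  have "real CARD('n) \<ge> 1" by (simp add: Suc_leI)
  hence S1: "S1 \<ge> 1" using S mult_mono[of 1 "real CARD('n)" 1 S] by (simp add: S1_def)
  have dirb: "norm (pderivs (replicate m e) F x) \<le> A * S1 ^ m * M m"
    if F: "smooth_on ?U F" "\<And>bs x. set bs \<subseteq> Basis \<Longrightarrow> x \<in> ?U
        \<Longrightarrow> norm (pderivs bs F x) \<le> A * S ^ length bs * M (length bs)"
      and x: "x \<in> ?U" and e: "norm e \<le> 1" for m e F x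
  proof -
    have "norm (pderivs (replicate m e) F x) \<le> real CARD('n) ^ m * (A * S ^ m * M m)"
      by (rule pderivs_bound_unit_directions[OF open_ball F(1) x _ e])
         (use F(2) x A S M_pos[of m] in auto)
    also have "\<dots> = A * S1 ^ m * M m" by (simp only: S1_def power_mult_distrib mult_ac)
    finally show ?thesis .
  qed
  note dg = dirb[OF g bg] and dh = dirb[OF h bh]

  define \<Omega> where "\<Omega> = {x \<in> ?U. f x \<noteq> 0}"
  \<comment> \<open>The set where f is nonzero need not be dense. Adding the interior of the zero
    set makes it so, and there all derivatives of f vanish, so the same bounds hold.\<close>
  define Z where "Z = interior (?U - \<Omega>)"
  define W where "W = \<Omega> \<union> Z"
  have "continuous_on ?U (\<lambda>x. f x ^ j)"
    by (intro differentiable_imp_continuous_on differentiable_at_imp_differentiable_on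
        smooth_on_differentiable[OF g open_ball])
  hence "open (?U \<inter> (\<lambda>x. f x ^ j) -` (- {0}))"
    by (intro continuous_open_preimage) auto
  moreover have "?U \<inter> (\<lambda>x. f x ^ j) -` (- {0}) = \<Omega>" using j by (auto simp: \<Omega>_def)
  ultimately have O\<Omega>: "open \<Omega>" by simp
  have OZ: "open Z" by (simp add: Z_def)
  have OW: "open W" unfolding W_def by (rule open_Un[OF O\<Omega> OZ])
  have ZU: "Z \<subseteq> ?U - \<Omega>" unfolding Z_def by (rule interior_subset)
  have \<Omega>U: "\<Omega> \<subseteq> ?U" by (auto simp: \<Omega>_def)
  have WU: "W \<subseteq> ?U" using ZU \<Omega>U by (auto simp: W_def)
  have f0: "f x = 0" if "x \<in> Z" for x using that ZU by (auto simp: \<Omega>_def)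
  have sZ: "smooth_on Z f"
    by (rule smooth_on_cong[OF OZ _ smooth_on_const[OF OZ, of 0]]) (simp add: f0)
  have s\<Omega>: "smooth_on \<Omega> f"
  proof (rule smooth_on_cong[OF O\<Omega>])
    show "smooth_on \<Omega> (\<lambda>x. f x ^ Suc j * inverse (f x ^ j))"
      by (intro smooth_on_mult smooth_on_inverse O\<Omega> smooth_on_subset[OF h \<Omega>U] smooth_on_subset[OF g \<Omega>U])
         (simp add: \<Omega>_def)
    fix y assume "y \<in> \<Omega>"
    thus "f y ^ Suc j * inverse (f y ^ j) = f y" by (simp add: \<Omega>_def field_simps)
  qed
  have sW: "smooth_on W f" unfolding W_def by (rule smooth_on_Un[OF O\<Omega> OZ s\<Omega> sZ])
  have dense: "?U \<subseteq> closure W"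
  proof
    fix x assume x: "x \<in> ?U"
    show "x \<in> closure W"
    proof (rule ccontr)
      assume nx: "x \<notin> closure W"
      have "?U - closure W \<subseteq> ?U - \<Omega>" using closure_subset[of W] by (auto simp: W_def)
      hence "?U - closure W \<subseteq> Z" unfolding Z_def by (intro interior_maximal) (auto intro: open_Diff)
      thus False using x nx closure_subset[of W] by (auto simp: W_def)
    qed
  qed

  define K where "K = j * Suc j"
  define S2 where "S2 = 4 * (C ^ (3 + K) * M 1) * exp (S1 * (2 * Suc j))"
  define A2 where "A2 = 20 * (real K)\<^sup>2 * A ^ (2 * Suc j) * S2"
  have S2: "S2 > 0" using C M_pos[of 1] by (simp add: S2_def)
  have A2: "A2 \<ge> 0" using S2 A by (simp add: A2_def)
  have df: "norm (pderivs (replicate k e) f x) \<le> A2 * S2 ^ k * M k" if x: "x \<in> W"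
      and e: "norm e \<le> 1" for x e k
  proof (cases "f x = 0")
    case True
    hence xZ: "x \<in> Z" using x by (auto simp: W_def \<Omega>_def)
    have "pderivs (replicate k e) f x = pderivs (replicate k e) (\<lambda>x. 0) x"
      by (rule pderivs_cong_open[OF OZ xZ f0])
    thus ?thesis using A2 S2 M_pos[of k] by (simp add: pderivs_zero_fun)
  next
    case False
    show ?thesis unfolding A2_def S2_def K_def
      by (rule directional_derivative_bound[OF C mgC j A S1 OW sW x False e]) (use dg dh x e WU in auto)
  qed

  have base: "\<exists>D\<ge>0. \<forall>x\<in>W. \<forall>y\<in>?U. norm (f y - taylor f x (Suc k) (y - x)) \<le> D * norm (y - x) ^ Suc k" for k
  proof -
    define k1 where "k1 = Suc k"
    \<comment> \<open>\<open>two_powers_hoelder\<close> divides the order of the error by j+1, so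
      the expansion is carried to order m to keep k1; the surplus terms are dropped at the
      end.\<close>
    define m where "m = k1 * Suc j"
    define c where "c = (\<Sum>i<m. A2 * S2 ^ i * M i)"
    define c2 where "c2 = (\<Sum>i<m. A * S1 ^ i * M i)"
    define cm where "cm = A * S1 ^ m * M m"
    \<comment> \<open>One constant for both powers. The summand 1 gives D \<ge> 1, so D may be
      replaced by its power of exponent j+1 when t is formed.\<close>
    define D where "D = c ^ j + c ^ Suc j + c2 + cm + 1"
    have nn: "c \<ge> 0" "c2 \<ge> 0" "cm \<ge> 0"
      using A2 S2 A S1 M_pos unfolding c_def c2_def cm_def
          by (auto intro!: sum_nonneg mult_nonneg_nonneg simp: less_imp_le)
    have D: "D \<ge> 1" "c ^ j + c2 + cm \<le> D" "c ^ Suc j + c2 + cm \<le> D" using nn by (auto simp: D_def)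
    have m: "k1 \<le> m" "m \<ge> 1" by (auto simp: m_def k1_def)
    have "norm (f y - taylor f x k1 (y - x)) \<le> ((5 + A) * D + 2 * c) * norm (y - x) ^ k1"
      if x: "x \<in> W" and y: "y \<in> ?U" for x y
    proof (cases "y = x")
      case True
      thus ?thesis using taylor_Suc_0[OF OW sW x] by (simp add: k1_def)
    next
      case False
      define \<rho> where "\<rho> = norm (y - x)"
      define e where "e = (1 / \<rho>) *\<^sub>R (y - x)"
      have xU: "x \<in> ?U" using x WU by auto
      have \<rho>: "\<rho> > 0" "\<rho> \<le> 1"
        using False xU y r norm_triangle_ineq4[of y x] by (auto simp: \<rho>_def)
      have e: "norm e \<le> 1" "\<rho> *\<^sub>R e = y - x" "x + \<rho> *\<^sub>R e = y" using \<rho> by (auto simp: e_def \<rho>_def)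
      have z1: "norm (complex_of_real \<rho>) \<le> 1" using \<rho> by simp
      define T where "T = fps_trunc_poly m (taylor_fps f x e)"
      have Tc: "norm (fps_nth (taylor_fps f x e) i) \<le> A2 * S2 ^ i * M i" for i
      proof -
        have "norm (fps_nth (taylor_fps f x e) i) \<le> norm (pderivs (replicate i e) f x) / 1"
          unfolding taylor_fps_nth norm_divide by (intro frac_le) auto
        thus ?thesis using df[OF x e(1), of i] by simp
      qed
      have Tb: "norm (poly T z) \<le> c" if "norm z \<le> 1" for z
        unfolding T_def c_def by (rule norm_poly_le_coeff_sum[OF _ that], rule Tc)
      \<comment> \<open>The segment from x to y may meet zeros of f, so Taylor's formula is applied
        to the smooth power f^l. Its Taylor polynomial G has the same coefficients below m as T^l,
        and the Schwarz lemma bounds their difference.\<close>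
      have pw: "norm (poly T (of_real \<rho>) ^ l - f y ^ l) \<le> D * \<rho> ^ m"
        if F: "smooth_on ?U (\<lambda>x. f x ^ l)"
           "\<And>i e x. x \<in> ?U \<Longrightarrow> norm e \<le> 1 \<Longrightarrow> norm (pderivs (replicate i e) (\<lambda>x. f x ^ l) x) \<le> A * S1 ^ i * M i"
          and Dl: "c ^ l + c2 + cm \<le> D" for l
      proof -
        define G where "G = fps_trunc_poly m (taylor_fps (\<lambda>x. f x ^ l) x e)"
        have Gc: "norm (fps_nth (taylor_fps (\<lambda>x. f x ^ l) x e) i) \<le> A * S1 ^ i * M i" for i
        proof -
          have "norm (fps_nth (taylor_fps (\<lambda>x. f x ^ l) x e) i)
              \<le> norm (pderivs (replicate i e) (\<lambda>x. f x ^ l) x) / 1"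
            unfolding taylor_fps_nth norm_divide by (intro frac_le) auto
          thus ?thesis using F(2)[OF xU e(1), of i] by simp
        qed
        have Gb: "norm (poly G z) \<le> c2" if "norm z \<le> 1" for z
          unfolding G_def c2_def by (rule norm_poly_le_coeff_sum[OF _ that], rule Gc)
        have "norm (poly (T ^ l - G) (of_real \<rho>)) \<le> (c ^ l + c2) * norm (complex_of_real \<rho>) ^ m"
        proof (rule poly_div_monom_bound[OF _ _ z1])
          fix i assume i: "i < m"
          have "coeff (T ^ l) i = fps_nth (fps_of_poly T ^ l) i"
              by (simp only: fps_of_poly_power[symmetric] fps_of_poly_nth)
          also have "\<dots> = fps_nth (taylor_fps f x e ^ l) i"
            by (rule fps_nth_power_cong[OF _ i]) (simp only: T_def fps_of_poly_trunc_nth)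
          also have "\<dots> = coeff G i"
            unfolding taylor_fps_power[OF OW sW x, symmetric] using i
                by (simp add: G_def coeff_fps_trunc_poly)
          finally show "coeff (T ^ l - G) i = 0" by simp
        next
          fix z :: complex assume z: "norm z = 1"
          have "norm (poly T z) ^ l \<le> c ^ l" using Tb z by (intro power_mono) auto
          moreover have "norm (poly G z) \<le> c2" using Gb z by simp
          ultimately show "norm (poly (T ^ l - G) z) \<le> c ^ l + c2"
            using norm_triangle_ineq4[of "poly T z ^ l" "poly G z"] by (simp add: norm_power)
        qed
        moreover have "norm (f y ^ l - poly G (of_real \<rho>)) \<le> cm * \<rho> ^ m"
        proof -
          have "norm (f (x + \<rho> *\<^sub>R e) ^ l - poly G (of_real \<rho>)) \<le> cm * \<rho> ^ m"
            unfolding G_def cm_def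
            by (rule taylor_remainder_bound[OF open_ball convex_ball F(1) xU _ _ m(2)])
               (use y \<rho> F(2) e in auto)
          thus ?thesis by (simp only: e(3))
        qed
        ultimately have "norm (poly (T ^ l - G) (of_real \<rho>)) + norm (f y ^ l - poly G (of_real \<rho>))
            \<le> (c ^ l + c2 + cm) * \<rho> ^ m"
          using \<rho> by (simp add: algebra_simps)
        also have "\<dots> \<le> D * \<rho> ^ m" using Dl \<rho> by (intro mult_right_mono) auto
        finally have le: "norm (poly (T ^ l - G) (of_real \<rho>)) + norm (f y ^ l - poly G (of_real \<rho>))
            \<le> D * \<rho> ^ m" .
        have eq: "poly T (of_real \<rho>) ^ l - f y ^ l
            = poly (T ^ l - G) (of_real \<rho>) - (f y ^ l - poly G (of_real \<rho>))"
          by simp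
        show ?thesis
          unfolding eq using le norm_triangle_ineq4[of "poly (T ^ l - G) (of_real \<rho>)" "f y ^ l
              - poly G (of_real \<rho>)"] by linarith
      qed
      define t where "t = D * \<rho> ^ k1"
      have t: "t \<ge> 0" using D \<rho> by (simp add: t_def)
      have "D * \<rho> ^ m \<le> D ^ Suc j * \<rho> ^ m"
        using D(1) \<rho> power_increasing[of 1 "Suc j" D] by (intro mult_right_mono) auto
      also have "\<dots> = t ^ Suc j" unfolding t_def m_def power_mult_distrib power_mult[symmetric] ..
      finally have Dt: "D * \<rho> ^ m \<le> t ^ Suc j" .
      have "norm (poly T (of_real \<rho>) - f y) \<le> (5 + norm (f y)) * t"
      proof (rule two_powers_hoelder[OF t])
        show "norm (poly T (of_real \<rho>) ^ j - f y ^ j) \<le> t ^ Suc j"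
          using pw[OF g dg D(2)] Dt by linarith
        show "norm (poly T (of_real \<rho>) ^ Suc j - f y ^ Suc j) \<le> t ^ Suc j"
          using pw[OF h dh D(3)] Dt by linarith
      qed
      \<comment> \<open>If |f y| exceeded A \<ge> 1, it would be at most |f y|^j, which is at most
        A.\<close>
      also have "norm (f y) \<le> A"
      proof (rule ccontr)
        assume "\<not> norm (f y) \<le> A"
        hence *: "norm (f y) > A" by simp
        have "norm (f y) ^ 1 \<le> norm (f y) ^ j" using * A j by (intro power_increasing) auto
        also have "\<dots> \<le> A" using bg[of "[]" y] y by (simp add: norm_power M_0)
        finally show False using * by simp
      qed
      finally have 1: "norm (poly T (of_real \<rho>) - f y) \<le> (5 + A) * t" using t by (simp add: mult_right_mono)
      define T1 where "T1 = fps_trunc_poly k1 (taylor_fps f x e)"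
      have T1b: "norm (poly T1 z) \<le> c" if "norm z \<le> 1" for z
      proof -
        have "norm (poly T1 z) \<le> (\<Sum>i<k1. A2 * S2 ^ i * M i)"
          unfolding T1_def by (rule norm_poly_le_coeff_sum[OF _ that], rule Tc)
        also have "\<dots> \<le> c" unfolding c_def using m(1) A2 S2 M_pos
          by (intro sum_mono2) (auto intro!: mult_nonneg_nonneg simp: less_imp_le)
        finally show ?thesis .
      qed
      have "norm (poly (T - T1) (of_real \<rho>)) \<le> (c + c) * norm (complex_of_real \<rho>) ^ k1"
      proof (rule poly_div_monom_bound[OF _ _ z1])
        show "coeff (T - T1) i = 0" if "i < k1" for i
          using that m(1) by (simp add: T_def T1_def coeff_fps_trunc_poly)
        show "norm (poly (T - T1) z) \<le> c + c" if "norm z = 1" for z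
          using Tb[of z] T1b[of z] that norm_triangle_ineq4[of "poly T z" "poly T1 z"] by simp
      qed
      hence 2: "norm (poly T (of_real \<rho>) - poly T1 (of_real \<rho>)) \<le> 2 * c * \<rho> ^ k1" using \<rho> by simp
      have 3: "taylor f x k1 (y - x) = poly T1 (of_real \<rho>)"
        unfolding e(2)[symmetric] T1_def by (rule poly_fps_trunc_taylor_fps[OF OW sW x])
      have "norm (f y - poly T1 (of_real \<rho>)) \<le> norm (poly T (of_real \<rho>) - poly T1 (of_real \<rho>))
          + norm (poly T (of_real \<rho>) - f y)"
        using norm_triangle_ineq4[of "poly T (of_real \<rho>) - poly T1 (of_real \<rho>)" "poly T (of_real \<rho>)
            - f y"] by simp
      also have "\<dots> \<le> 2 * c * \<rho> ^ k1 + (5 + A) * t" using 1 2 by linarith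
      also have "\<dots> = ((5 + A) * D + 2 * c) * \<rho> ^ k1" by (simp add: t_def algebra_simps)
      finally show ?thesis unfolding 3 \<rho>_def .
    qed
    moreover have "(5 + A) * D + 2 * c \<ge> 0" using A D nn by simp
    ultimately show ?thesis unfolding k1_def by blast
  qed

  \<comment> \<open>The estimates so far concern powers of a single direction; polarization costs 2
    e per slot to reach mixed derivatives.\<close>
  define S3 where "S3 = 2 * exp 1 * S2"
  have S3: "S3 > 0" using S2 by (simp add: S3_def)
  have all: "norm (pderivs bs f x) \<le> A2 * S3 ^ length bs * M (length bs)"
    if bs: "set bs \<subseteq> Basis" and x: "x \<in> W" for bs x
  proof -
    interpret symmetric_form "\<lambda>vs. pderivs vs f x" by (rule pderivs_symmetric_form[OF OW sW x])
    have "norm (pderivs bs f x) \<le> (2 * exp 1) ^ length bs * (A2 * S2 ^ length bs * M (length bs))"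
      by (rule polarization_bound[OF df[OF x]]) (use bs in \<open>auto simp: subset_iff\<close>)
    also have "\<dots> = A2 * S3 ^ length bs * M (length bs)" unfolding S3_def power_mult_distrib
        by (simp only: mult_ac)
    finally show ?thesis .
  qed
  have r2: "r / 2 < r" using r by simp
  note fin = smooth_on_ball_if_taylor_approx[OF OW WU dense sW base r2]
  show ?thesis
  proof (intro exI conjI allI ballI impI)
    show "S3 > 0" by fact
    show "smooth_on (ball 0 (r / 2)) f" by (rule fin(1))
    fix bs :: "(real^'n) list" and x :: "real^'n"
    assume x: "x \<in> ball 0 (r / 2)" and bs: "set bs \<subseteq> Basis"
    show "norm (pderivs bs f x) \<le> A2 * S3 ^ length bs * M (length bs)"
      by (rule fin(2)[OF bs all[OF bs] x])
  qed
qed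

section \<open>From germs to bounds on balls and back\<close>

lemma germ_E_M_bounds:
  fixes g :: "real^'n \<Rightarrow> complex"
  assumes "germ_E_M M g" and M: "\<And>k. M k > 0"
  obtains r A S where "r > 0" "A \<ge> 1" "S \<ge> 1" "smooth_on (ball 0 r) g"
    "\<And>bs x. set bs \<subseteq> Basis \<Longrightarrow> x \<in> ball 0 r \<Longrightarrow> norm (pderivs bs g x) \<le> A * S ^ length bs * M (length bs)"
proof -
  obtain U where U: "open U" "0 \<in> U" "E_M M U g" using assms(1) by (auto simp: germ_E_M_def)
  obtain r where r: "r > 0" "cball 0 r \<subseteq> U" using U open_contains_cball by blast
  let ?V = "ball (0 :: real^'n) r"
  have "open ?V \<and> ?V \<subseteq> U \<and> compact (closure ?V) \<and> closure ?V \<subseteq> U"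
    using r ball_subset_cball[of "0 :: real^'n" r] by auto
  then obtain \<sigma> where \<sigma>: "\<sigma> > 0" "B_M M \<sigma> ?V g" using U(3) unfolding E_M_def by blast
  then obtain C where sm: "smooth_on ?V g" and
    C: "\<And>x bs. x \<in> ?V \<Longrightarrow> set bs \<subseteq> Basis \<Longrightarrow> norm (pderivs bs g x) / (\<sigma> ^ length bs * M (length bs)) \<le> C"
    unfolding B_M_def by blast
  show ?thesis
  proof (rule that[of r "max C 1" "max \<sigma> 1"])
    fix bs :: "(real^'n) list" and x :: "real^'n"
    assume bs: "set bs \<subseteq> Basis" and x: "x \<in> ?V"
    have p: "\<sigma> ^ length bs * M (length bs) > 0" using \<sigma> M by simp
    have "norm (pderivs bs g x) \<le> C * (\<sigma> ^ length bs * M (length bs))"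
      using C[OF x bs] p by (simp only: pos_divide_le_eq)
    also have "\<dots> \<le> max C 1 * (max \<sigma> 1 ^ length bs * M (length bs))"
      using p \<sigma> M[of "length bs"] by (intro mult_mono mult_right_mono power_mono) auto
    finally show "norm (pderivs bs g x) \<le> max C 1 * max \<sigma> 1 ^ length bs * M (length bs)"
        by (simp add: mult.assoc)
  qed (use r sm in auto)
qed

lemma germ_E_M_if_ball_bounds:
  fixes f :: "real^'n \<Rightarrow> complex"
  assumes "r > 0" "S > 0" and M: "\<And>k. M k > 0" and f: "smooth_on (ball 0 r) f"
    and bd: "\<And>bs x. set bs \<subseteq> Basis \<Longrightarrow> x \<in> ball 0 r
        \<Longrightarrow> norm (pderivs bs f x) \<le> A * S ^ length bs * M (length bs)"
  shows "germ_E_M M f"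
proof -
  have "B_M M S V f" if "V \<subseteq> ball 0 r" for V
    unfolding B_M_def
  proof (intro conjI exI ballI allI impI)
    show "smooth_on V f" using smooth_on_subset[OF f that] .
    fix x and bs :: "(real^'n) list" assume x: "x \<in> V" and bs: "set bs \<subseteq> Basis"
    have "S ^ length bs * M (length bs) > 0" using assms(2) M by simp
    thus "norm (pderivs bs f x) / (S ^ length bs * M (length bs)) \<le> A"
      using bd[OF bs] x that by (auto simp: pos_divide_le_eq mult.assoc)
  qed
  hence "E_M M (ball 0 r) f" using f assms(2) by (auto simp: E_M_def)
  thus ?thesis using assms(1) by (auto simp: germ_E_M_def intro!: exI[of _ "ball 0 r"])
qed

theorem theorem2p2:
  fixes M :: "nat \<Rightarrow> real"
  assumes "weight_sequence M"
    and "non_quasianalytic M"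
    and "regular M"
    and "moderate_growth M"
  shows "property_D (germ_E_M M :: (real^'n \<Rightarrow> complex) \<Rightarrow> bool)"
  unfolding property_D_def
proof (intro allI impI, elim conjE)
  fix f :: "real^'n \<Rightarrow> complex" and j :: nat
  assume j: "1 \<le> j" and g: "germ_E_M M (\<lambda>x. f x ^ j)" and h: "germ_E_M M (\<lambda>x. f x ^ (j + 1))"
  obtain \<mu> where "log_convex_weight M \<mu>"
    using assms(1) unfolding weight_sequence_def log_convex_weight_def by blast
  then interpret log_convex_weight M \<mu> .
  obtain r1 A1 S1 where 1: "r1 > 0" "A1 \<ge> 1" "S1 \<ge> 1" "smooth_on (ball 0 r1) (\<lambda>x. f x ^ j)"
    "\<And>bs x. set bs \<subseteq> Basis \<Longrightarrow> x \<in> ball 0 r1 \<Longrightarrow> norm (pderivs bs (\<lambda>x. f x ^ j) x)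
        \<le> A1 * S1 ^ length bs * M (length bs)"
    using germ_E_M_bounds[OF g M_pos] by metis
  obtain r2 A2 S2 where 2: "r2 > 0" "A2 \<ge> 1" "S2 \<ge> 1" "smooth_on (ball 0 r2) (\<lambda>x. f x ^ (j + 1))"
    "\<And>bs x. set bs \<subseteq> Basis \<Longrightarrow> x \<in> ball 0 r2 \<Longrightarrow> norm (pderivs bs (\<lambda>x. f x ^ (j + 1)) x)
        \<le> A2 * S2 ^ length bs * M (length bs)"
    using germ_E_M_bounds[OF h M_pos] by metis
  \<comment> \<open>The two germs come with different balls and constants; the smaller ball and the
    larger constants serve both, and 1/2 is the radius restriction of
    \<open>smooth_of_powers\<close>.\<close>
  define r where "r = min (min r1 r2) (1 / 2)"
  define A where "A = max A1 A2"
  define S where "S = max S1 S2"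
  have sub: "ball 0 r \<subseteq> ball (0 :: real^'n) r1" "ball 0 r \<subseteq> ball (0 :: real^'n) r2" by (auto simp: r_def)
  have mono: "A' * S' ^ m * M m \<le> A * S ^ m * M m" if "A' \<le> A" "S' \<le> S" "A' \<ge> 1" "S' \<ge> 1" for A' S' m
    using that M_pos[of m] by (intro mult_right_mono mult_mono power_mono) auto
  have "\<exists>A' S' :: real. S' > 0 \<and> smooth_on (ball 0 (r / 2)) f \<and>
    (\<forall>bs. \<forall>x\<in>ball 0 (r / 2). set bs \<subseteq> Basis \<longrightarrow> norm (pderivs bs f x) \<le> A' * S' ^ length bs * M (length bs))"
  proof (rule smooth_of_powers[OF assms(4) j, of r A S])
    show "smooth_on (ball 0 r) (\<lambda>x. f x ^ j)" "smooth_on (ball 0 r) (\<lambda>x. f x ^ Suc j)"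
      using smooth_on_subset[OF 1(4) sub(1)] smooth_on_subset[OF 2(4) sub(2)] by simp_all
    fix bs :: "(real^'n) list" and x :: "real^'n"
    assume bs: "set bs \<subseteq> Basis" and x: "x \<in> ball 0 r"
    show "norm (pderivs bs (\<lambda>x. f x ^ j) x) \<le> A * S ^ length bs * M (length bs)"
      by (rule order_trans[OF 1(5)[OF bs subsetD[OF sub(1) x]] mono]) (use 1 2 in \<open>auto simp: A_def S_def\<close>)
    have "norm (pderivs bs (\<lambda>x. f x ^ (j + 1)) x) \<le> A * S ^ length bs * M (length bs)"
      by (rule order_trans[OF 2(5)[OF bs subsetD[OF sub(2) x]] mono]) (use 1 2 in \<open>auto simp: A_def S_def\<close>)
    thus "norm (pderivs bs (\<lambda>x. f x ^ Suc j) x) \<le> A * S ^ length bs * M (length bs)" by simp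
  qed (use 1 2 in \<open>auto simp: r_def A_def S_def\<close>)
  then obtain A' S' where "S' > 0" "smooth_on (ball 0 (r / 2)) f"
    "\<And>bs x. x \<in> ball 0 (r / 2) \<Longrightarrow> set bs \<subseteq> Basis
        \<Longrightarrow> norm (pderivs bs f x) \<le> A' * S' ^ length bs * M (length bs)"
    by blast
  moreover have "r / 2 > 0" using 1 2 by (simp add: r_def)
  ultimately show "germ_E_M M f" using M_pos by (intro germ_E_M_if_ball_bounds[of "r / 2" S' M f A'])
qed

end
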